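(* Let $\alpha>0$, $L>0$, $0<r<s\le 2$. Assume Assumption (N) and Assumption (ND) hold and $\Phi^{\varepsilon}(u)\neq 0$ for all $u\in\mathbb{R}$. Let $\hat f_n$ be the kernel estimator with bandwidth $h_n=h_*$, or, if $r<s/2$, with bandwidth $h_n=h_n^{a}=\left(\frac{\log n}{2\beta}-\sqrt{\frac{\log n}{2\beta}}\right)^{-1/s}$. Then for every $x\in\mathbb{R}$, $$\lim_{n\to\infty} R_n(x,\hat f_n,\mathcal{A}_{\alpha,r}(L))\,\varphi_n^{-2}=\lim_{n\to\infty}\inf_{T_n} R_n(x,T_n,\mathcal{A}_{\alpha,r}(L))\,\varphi_n^{-2}=1,$$ and $$\lim_{n\to\infty} R_n(\mathbb{L}_2,\hat f_n,\mathcal{A}_{\alpha,r}(L))\,\varphi_n^{-2}(\mathbb{L}_2)=\lim_{n\to\infty}\inf_{T_n} R_n(\mathbb{L}_2,T_n,\mathcal{A}_{\alpha,r}(L))\,\varphi_n^{-2}(\mathbb{L}_2)=1,$$ where $\inf_{T_n}$ is over all estimators (measurable functions of $Y_1,\dots,Y_n$).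
   Context: Observations $Y_i=X_i+\varepsilon_i$, $i=1,\dots,n$, where $X_1,\dots,X_n$ are i.i.d. with unknown probability density $f$ on $\mathbb{R}$, $\varepsilon_1,\dots,\varepsilon_n$ are i.i.d. with known density $f^\varepsilon$, and $(\varepsilon_i)$ is independent of $(X_i)$. For integrable $g$, $\Phi^g(u)=\int g(x)e^{ixu}dx$; $\Phi^\varepsilon$ is the characteristic function of $\varepsilon_1$. The class $\mathcal{A}_{\alpha,r}(L)$ is the set of probability densities $f$ on $\mathbb{R}$ with $\int|\Phi^f(u)|^2\exp(2\alpha|u|^r)du\le 2\pi L$. Assumption (N): there are constants $u_0>0,\beta>0,s>0,b_{\min}>0,b_{\max}>0,\gamma,\gamma'\in\mathbb{R}$ with $b_{\min}|u|^{\gamma}e^{-\beta|u|^s}\le|\Phi^\varepsilon(u)|\le b_{\max}|u|^{\gamma'}e^{-\beta|u|^s}$ for $|u|\ge u_0$. Assumption (ND): there are $u_1>0$, $B>0$, $\gamma_1\in\mathbb{R}$ such that $\Phi^\varepsilon$ is twice continuously differentiable on $|u|\ge u_1$ and $\max\{|(\Phi^\varepsilon)'(u)|,|(\Phi^\varepsilon)''(u)|\}\le B|u|^{\gamma_1}e^{-\beta|u|^s}$ there, with the same $\beta,s$ as in (N). The kernel estimator is $\hat f_n(x)=\frac{1}{nh_n}\sum_{i=1}^n K_n\big(\frac{x-Y_i}{h_n}\big)$, where $h_n>0$ and $K_n$ is the inverse Fourier transform of $\Phi^{K_n}(u)=I(|u|\le1)/\Phi^\varepsilon(u/h_n)$.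 For $n\ge3$, $h_*=h_*(n)$ is the unique solution of $\frac{2\beta}{h_*^s}+\frac{2\alpha}{h_*^r}=\log n-(\log\log n)^2$. Rates: $\varphi_n^2=\frac{L}{2\pi\alpha r}h_*^{r-1}\exp(-2\alpha/h_*^r)$ and $\varphi_n^2(\mathbb{L}_2)=L\exp(-2\alpha/h_*^r)$. Risks: $R_n(x,T_n,\mathcal{A}_{\alpha,r}(L))=\sup_{f\in\mathcal{A}_{\alpha,r}(L)}E_f|T_n(x)-f(x)|^2$ and $R_n(\mathbb{L}_2,T_n,\mathcal{A}_{\alpha,r}(L))=\sup_{f\in\mathcal{A}_{\alpha,r}(L)}E_f\|T_n-f\|_2^2$, where $E_f$ is expectation under the joint law of $Y_1,\dots,Y_n$ when $X_i$ have density $f$.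
   Formalization: The class A_{α,r}(L) is taken to consist of continuous densities (each density in it has a unique continuous version); otherwise changing f at the single point x would make the pointwise risk infinite. The L2 risk is unaffected by this choice. *)

theory Defs
  imports "HOL-Probability.Probability"
begin

definition fourier :: "(real \<Rightarrow> real) \<Rightarrow> real \<Rightarrow> complex" where
  "fourier g u = (LINT x|lborel. complex_of_real (g x) * cis (x * u))"

definition prob_density :: "(real \<Rightarrow> real) \<Rightarrow> bool" where
  "prob_density g \<longleftrightarrow> g \<in> borel_measurable borel \<and> (\<forall>x. 0 \<le> g x)
      \<and> integrable lborel g \<and> (LINT x|lborel. g x) = 1"

definition dens_class :: "real \<Rightarrow> real \<Rightarrow> real \<Rightarrow> (real \<Rightarrow> real) set" where
  "dens_class \<alpha> r L = {f. prob_density f \<and> continuous_on UNIV f \<and>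
      (\<integral>\<^sup>+ u. ennreal ((cmod (fourier f u))\<^sup>2 * exp (2 * \<alpha> * \<bar>u\<bar> powr r)) \<partial>lborel)
        \<le> ennreal (2 * pi * L)}"

definition assumption_N :: "real \<Rightarrow> real \<Rightarrow> (real \<Rightarrow> complex) \<Rightarrow> bool" where
  "assumption_N \<beta> s \<Phi> \<longleftrightarrow> 0 < \<beta> \<and> 0 < s \<and>
     (\<exists>u0 bmin bmax \<gamma> \<gamma>'. 0 < u0 \<and> 0 < bmin \<and> 0 < bmax \<and>
        (\<forall>u. u0 \<le> \<bar>u\<bar> \<longrightarrow>
            bmin * \<bar>u\<bar> powr \<gamma> * exp (- \<beta> * \<bar>u\<bar> powr s) \<le> cmod (\<Phi> u) \<and>
            cmod (\<Phi> u) \<le> bmax * \<bar>u\<bar> powr \<gamma>' * exp (- \<beta> * \<bar>u\<bar> powr s)))"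

definition assumption_ND :: "real \<Rightarrow> real \<Rightarrow> (real \<Rightarrow> complex) \<Rightarrow> bool" where
  "assumption_ND \<beta> s \<Phi> \<longleftrightarrow>
     (\<exists>u1 B \<gamma>1 (D1 :: real \<Rightarrow> complex) (D2 :: real \<Rightarrow> complex). 0 < u1 \<and> 0 < B \<and>
        (\<forall>u. u1 \<le> \<bar>u\<bar> \<longrightarrow>
            (\<Phi> has_vector_derivative D1 u) (at u within {v. u1 \<le> \<bar>v\<bar>}) \<and>
            (D1 has_vector_derivative D2 u) (at u within {v. u1 \<le> \<bar>v\<bar>}) \<and>
            max (cmod (D1 u)) (cmod (D2 u)) \<le> B * \<bar>u\<bar> powr \<gamma>1 * exp (- \<beta> * \<bar>u\<bar> powr s)) \<and>
        continuous_on {v. u1 \<le> \<bar>v\<bar>} D2)"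

definition law_Y :: "(real \<Rightarrow> real) \<Rightarrow> (real \<Rightarrow> real) \<Rightarrow> real measure" where
  "law_Y f fe = distr (density lborel f \<Otimes>\<^sub>M density lborel fe) borel (\<lambda>(x, e). x + e)"

definition sample_law :: "(real \<Rightarrow> real) \<Rightarrow> (real \<Rightarrow> real) \<Rightarrow> nat \<Rightarrow> (nat \<Rightarrow> real) measure" where
  "sample_law f fe n = PiM {..<n} (\<lambda>_. law_Y f fe)"

definition estimators :: "nat \<Rightarrow> ((nat \<Rightarrow> real) \<Rightarrow> real \<Rightarrow> real) set" where
  "estimators n = {T. (\<lambda>(Y, x). T Y x) \<in> borel_measurable (PiM {..<n} (\<lambda>_. borel) \<Otimes>\<^sub>M borel)}"

definition risk_pt :: "(real \<Rightarrow> real) \<Rightarrow> real \<Rightarrow> real \<Rightarrow> real \<Rightarrow> nat \<Rightarrow> real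
    \<Rightarrow> ((nat \<Rightarrow> real) \<Rightarrow> real \<Rightarrow> real) \<Rightarrow> ennreal" where
  "risk_pt fe \<alpha> r L n x T =
     (SUP f \<in> dens_class \<alpha> r L. \<integral>\<^sup>+ Y. ennreal ((T Y x - f x)\<^sup>2) \<partial>sample_law f fe n)"

definition risk_L2 :: "(real \<Rightarrow> real) \<Rightarrow> real \<Rightarrow> real \<Rightarrow> real \<Rightarrow> nat
    \<Rightarrow> ((nat \<Rightarrow> real) \<Rightarrow> real \<Rightarrow> real) \<Rightarrow> ennreal" where
  "risk_L2 fe \<alpha> r L n T =
     (SUP f \<in> dens_class \<alpha> r L.
        \<integral>\<^sup>+ Y. (\<integral>\<^sup>+ z. ennreal ((T Y z - f z)\<^sup>2) \<partial>lborel) \<partial>sample_law f fe n)"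

definition dkernel :: "(real \<Rightarrow> real) \<Rightarrow> real \<Rightarrow> real \<Rightarrow> complex" where
  "dkernel fe h z = complex_of_real (1 / (2 * pi)) *
     (LINT u|lborel. complex_of_real (indicator {-1..1} u) * cis (- (u * z)) / fourier fe (u / h))"

text \<open>K_n is real-valued (Phi^eps(-u) = conj Phi^eps(u)); we take the real part.\<close>
definition kernel_est :: "(real \<Rightarrow> real) \<Rightarrow> nat \<Rightarrow> real \<Rightarrow> (nat \<Rightarrow> real) \<Rightarrow> real \<Rightarrow> real" where
  "kernel_est fe n h Y x =
     Re ((\<Sum>i<n. dkernel fe h ((x - Y i) / h)) / complex_of_real (real n * h))"

definition h_star :: "real \<Rightarrow> real \<Rightarrow> real \<Rightarrow> real \<Rightarrow> nat \<Rightarrow> real" where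
  "h_star \<alpha> \<beta> r s n = (THE h. 0 < h \<and>
      2 * \<beta> / h powr s + 2 * \<alpha> / h powr r = ln (real n) - (ln (ln (real n)))\<^sup>2)"

definition h_a :: "real \<Rightarrow> real \<Rightarrow> nat \<Rightarrow> real" where
  "h_a \<beta> s n = (ln (real n) / (2 * \<beta>) - sqrt (ln (real n) / (2 * \<beta>))) powr (- 1 / s)"

definition rate_pt :: "real \<Rightarrow> real \<Rightarrow> real \<Rightarrow> real \<Rightarrow> real \<Rightarrow> nat \<Rightarrow> real" where
  "rate_pt \<alpha> \<beta> r s L n = L / (2 * pi * \<alpha> * r) * h_star \<alpha> \<beta> r s n powr (r - 1)
      * exp (- 2 * \<alpha> / h_star \<alpha> \<beta> r s n powr r)"

definition rate_L2 :: "real \<Rightarrow> real \<Rightarrow> real \<Rightarrow> real \<Rightarrow> real \<Rightarrow> nat \<Rightarrow> real" where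
  "rate_L2 \<alpha> \<beta> r s L n = L * exp (- 2 * \<alpha> / h_star \<alpha> \<beta> r s n powr r)"

end

theory Submission
  imports Defs "HOL-Real_Asymp.Real_Asymp"
begin

text \<open>
  Write \<open>a = 1/h\<close>. For a density of the class, Cauchy-Schwarz (pointwise) and Plancherel (in \<open>L\<^sub>2\<close>) bound the
  squared bias of the kernel estimator by \<open>(L/2\<pi>) \<integral>\<^bsub>|u|>a\<^esub> exp(-2\<alpha>|u|\<^sup>r) du\<close> and \<open>L exp(-2\<alpha>a\<^sup>r)\<close>, which are
  asymptotically the rates; the variance is a power of \<open>a\<close> times \<open>exp(2\<beta>a\<^sup>s)/n\<close>, hence negligible for both
  bandwidths.

  The lower bounds use two hypotheses \<open>f\<^sub>0 \<plusminus> G\<close>. The characteristic function of \<open>f\<^sub>0\<close>, a dilated sum of two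
  Fejer kernels, has compact support and a weighted norm as small as we like, while \<open>f\<^sub>0(y) \<ge> c/(1+y\<^sup>2)\<close>. The
  Fourier transform of \<open>G\<close> is supported in \<open>a \<le> |u| \<le> b\<close> and proportional there to a smooth cut-off times
  \<open>exp(-2\<alpha>|u|\<^sup>r)\<close>, the extremal shape in Cauchy-Schwarz; \<open>b = 2a\<close> serves pointwise, a narrow band \<open>b = a + 1/a\<close>
  in \<open>L\<^sub>2\<close>. Two integrations by parts show that \<open>G\<close> and its convolution with the noise density decay like
  \<open>1/(1+y\<^sup>2)\<close>, which gives positivity of \<open>f\<^sub>0 \<plusminus> G\<close> and a bound for the chi-square distance. Once
  \<open>2\<beta>a\<^sup>s + 2\<alpha>a\<^sup>r\<close> exceeds \<open>log n + (log log n)\<^sup>2\<close> the product laws merge, while replacing \<open>1/h\<^sub>*\<close> by such an \<open>a\<close>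
  changes \<open>a\<^sup>r\<close> by \<open>o(1)\<close> only, because \<open>r < s\<close>.
\<close>

section \<open>Integration on the real line\<close>

lemma one_plus_square_pos: "0 < 1 + (t::real)\<^sup>2"
  by (simp add: add_pos_nonneg)

lemma integrable_lborel_shift:
  fixes f :: "real \<Rightarrow> 'a::{banach, second_countable_topology}"
  assumes "integrable lborel f" shows "integrable lborel (\<lambda>x. f (x - t))"
  using lborel_integrable_real_affine[OF assms, of 1 "- t"] by simp

lemma integral_lborel_shift:
  fixes f :: "real \<Rightarrow> 'a::{banach, second_countable_topology}"
  shows "(LINT x|lborel. f (x - t)) = (LINT x|lborel. f x)"
  using lborel_integral_real_affine[of 1 f "- t"] by simp

lemma nn_integral_lborel_shift:
  assumes [measurable]: "f \<in> borel_measurable borel"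
  shows "(\<integral>\<^sup>+x. f (x - t) \<partial>lborel) = (\<integral>\<^sup>+x. f (x::real) \<partial>lborel)"
  using nn_integral_real_affine[of f 1 "- t"] by simp

lemma nn_integral_lborel_minus:
  assumes [measurable]: "f \<in> borel_measurable borel"
  shows "(\<integral>\<^sup>+x. f (- x) \<partial>lborel) = (\<integral>\<^sup>+x. f (x::real) \<partial>lborel)"
  using nn_integral_real_affine[of f "- 1" 0] by simp

lemma nn_integral_lborel_even:
  assumes [measurable]: "\<phi> \<in> borel_measurable borel"
  shows "(\<integral>\<^sup>+u. \<phi> \<bar>u\<bar> \<partial>lborel) = 2 * (\<integral>\<^sup>+u. indicator {0..} u * \<phi> (u::real) \<partial>lborel)"
proof -
  have "AE u::real in lborel. u \<noteq> 0" by (rule AE_lborel_singleton)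
  then have "(\<integral>\<^sup>+u. \<phi> \<bar>u\<bar> \<partial>lborel)
      = (\<integral>\<^sup>+u. indicator {0..} u * \<phi> u + indicator {0..} (- u) * \<phi> (- u) \<partial>lborel)"
    by (intro nn_integral_cong_AE, eventually_elim) (auto split: split_indicator)
  also have "\<dots> = (\<integral>\<^sup>+u. indicator {0..} u * \<phi> u \<partial>lborel) + (\<integral>\<^sup>+u. indicator {0..} (- u) * \<phi> (- u) \<partial>lborel)"
    by (rule nn_integral_add) measurable
  also have "(\<integral>\<^sup>+u. indicator {0..} (- u) * \<phi> (- u) \<partial>lborel) = (\<integral>\<^sup>+u. indicator {0..} u * \<phi> u \<partial>lborel)"
    by (rule nn_integral_lborel_minus) measurable
  finally show ?thesis by (simp add: mult_2)
qed

lemma integrable_indicator_Icc: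
  fixes w :: "real \<Rightarrow> 'a::{banach, second_countable_topology}"
  assumes "continuous_on {a..b} w"
  shows "integrable lborel (\<lambda>u. indicator {a..b} u *\<^sub>R w u)"
  using borel_integrable_compact[OF _ assms] by auto

lemma integrable_inverse_one_plus_square: "integrable lborel (\<lambda>x::real. 1 / (1 + x\<^sup>2))"
  using integrable_inverse_1_plus_square by (simp add: set_integrable_def divide_inverse)

lemma integral_inverse_one_plus_square: "(LINT x|lborel. 1 / (1 + (x::real)\<^sup>2)) = pi"
  using LBINT_inverse_1_plus_square
  by (simp add: interval_lebesgue_integral_def set_lebesgue_integral_def divide_inverse)

lemma integrable_inverse_square_decay:
  fixes f :: "real \<Rightarrow> 'a::{banach, second_countable_topology}"
  assumes "f \<in> borel_measurable borel" and "\<And>x. norm (f x) \<le> C / (1 + x\<^sup>2)"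
  shows "integrable lborel f"
proof (rule Bochner_Integration.integrable_bound)
  show "integrable lborel (\<lambda>x::real. C * (1 / (1 + x\<^sup>2)))"
    by (intro integrable_mult_right integrable_inverse_one_plus_square)
  show "AE x in lborel. norm (f x) \<le> norm (C * (1 / (1 + x\<^sup>2)))"
    by (auto intro!: order_trans[OF assms(2)] divide_right_mono)
qed (use assms(1) in simp)

lemma ennreal_norm_integral_le: "ennreal (norm (integral\<^sup>L M f)) \<le> (\<integral>\<^sup>+x. ennreal (norm (f x)) \<partial>M)"
  by (cases "integrable M f") (auto simp: integral_norm_bound_ennreal not_integrable_integral_eq)

lemma (in pair_sigma_finite) integrable_mult_bounded:
  fixes g :: "'a \<Rightarrow> complex" and k :: "'b \<Rightarrow> complex"
  assumes g: "integrable M1 g" and k: "integrable M2 k"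
    and [measurable]: "(\<lambda>(x, u). b x u) \<in> borel_measurable (M1 \<Otimes>\<^sub>M M2)" and b: "\<And>x u. cmod (b x u) \<le> 1"
  shows "integrable (M1 \<Otimes>\<^sub>M M2) (\<lambda>(x, u). g x * k u * b x u)"
proof (rule Bochner_Integration.integrable_bound)
  note [measurable] = borel_measurable_integrable[OF g] borel_measurable_integrable[OF k]
  show "integrable (M1 \<Otimes>\<^sub>M M2) (\<lambda>(x, u). g x * k u)"
    by (rule Fubini_integrable) (use g k in \<open>auto simp: norm_mult\<close>)
  show "AE z in M1 \<Otimes>\<^sub>M M2. cmod (case z of (x, u) \<Rightarrow> g x * k u * b x u) \<le> cmod (case z of (x, u) \<Rightarrow> g x * k u)"
    by (auto simp: norm_mult intro!: AE_I2 mult_right_le_one_le mult_nonneg_nonneg b)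
qed (use g k in measurable)

lemma (in pair_sigma_finite) Fubini_mult_bounded:
  fixes g :: "'a \<Rightarrow> complex" and k :: "'b \<Rightarrow> complex"
  assumes "integrable M1 g" and "integrable M2 k"
    and "(\<lambda>(x, u). b x u) \<in> borel_measurable (M1 \<Otimes>\<^sub>M M2)" and "\<And>x u. cmod (b x u) \<le> 1"
  shows "(LINT u|M2. LINT x|M1. g x * k u * b x u) = (LINT x|M1. LINT u|M2. g x * k u * b x u)"
  using Fubini_integral[OF integrable_mult_bounded[OF assms]] by simp

section \<open>The Fourier transform of integrable functions\<close>

definition cfourier :: "(real \<Rightarrow> complex) \<Rightarrow> real \<Rightarrow> complex" where
  "cfourier g u = (LINT x|lborel. g x * cis (x * u))"

lemma fourier_eq_cfourier: "fourier g = cfourier (\<lambda>x. complex_of_real (g x))"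
  by (simp add: fun_eq_iff fourier_def cfourier_def)

lemma borel_measurable_cis[measurable]: "cis \<in> borel_measurable borel"
  by (intro borel_measurable_continuous_onI continuous_intros)

lemma integrable_mult_cis:
  assumes "integrable M g" and [measurable]: "p \<in> borel_measurable M"
  shows "integrable M (\<lambda>x. g x * cis (p x))"
  using assms(1) by (rule Bochner_Integration.integrable_bound)
    (use assms(1) in \<open>auto simp: norm_mult\<close>)

lemma norm_cfourier_le: "cmod (cfourier g u) \<le> (LINT x|lborel. cmod (g x))"
  unfolding cfourier_def using integral_norm_bound[of lborel "\<lambda>x. g x * cis (x * u)"]
  by (simp add: norm_mult)

lemma isCont_cfourier:
  assumes g: "integrable lborel g" shows "isCont (cfourier g) u"
proof (rule continuous_at_sequentiallyI)
  fix X :: "nat \<Rightarrow> real" assume X: "X \<longlonglongrightarrow> u"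
  have [measurable]: "g \<in> borel_measurable borel" using g by auto
  show "(\<lambda>n. cfourier g (X n)) \<longlonglongrightarrow> cfourier g u"
    unfolding cfourier_def
  proof (rule integral_dominated_convergence[where w="\<lambda>x. cmod (g x)"])
    have "isCont cis z" for z
      using continuous_on_cis[of UNIV "\<lambda>x. x"] by (simp add: continuous_on_eq_continuous_at)
    then show "AE x in lborel. (\<lambda>n. g x * cis (x * X n)) \<longlonglongrightarrow> g x * cis (x * u)"
      by (intro AE_I2 tendsto_intros isCont_tendsto_compose[of _ cis] X)
  qed (use g in \<open>auto simp: norm_mult\<close>)
qed

lemma continuous_on_cfourier: "integrable lborel g \<Longrightarrow> continuous_on S (cfourier g)"
  by (intro continuous_at_imp_continuous_on ballI isCont_cfourier)

lemma borel_measurable_cfourier: "integrable lborel g \<Longrightarrow> cfourier g \<in> borel_measurable borel"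
  by (intro borel_measurable_continuous_onI continuous_on_cfourier)

lemma continuous_on_fourier: "integrable lborel g \<Longrightarrow> continuous_on S (fourier g)"
  unfolding fourier_eq_cfourier by (intro continuous_on_cfourier) simp

lemma borel_measurable_fourier: "integrable lborel g \<Longrightarrow> fourier g \<in> borel_measurable borel"
  by (intro borel_measurable_continuous_onI continuous_on_fourier)

lemma fourier_add:
  assumes "integrable lborel f" "integrable lborel g"
  shows "fourier (\<lambda>x. f x + g x) u = fourier f u + fourier g u"
  unfolding fourier_def using assms
  by (subst Bochner_Integration.integral_add[symmetric])
    (auto intro!: integrable_mult_cis simp: ring_distribs)

lemma fourier_cmult: "fourier (\<lambda>x. c * f x) u = c * fourier f u"
  unfolding fourier_def by (simp add: mult.assoc flip: integral_mult_right_zero)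

lemma fourier_shift: "fourier (\<lambda>y. g (y - x)) u = cis (x * u) * fourier g u"
proof -
  have "fourier (\<lambda>y. g (y - x)) u = (LINT y|lborel. complex_of_real (g y) * cis ((x + y) * u))"
    unfolding fourier_def by (subst lborel_integral_real_affine[where c=1 and t=x]) auto
  also have "\<dots> = (LINT y|lborel. cis (x * u) * (complex_of_real (g y) * cis (y * u)))"
    by (intro Bochner_Integration.integral_cong refl) (simp add: cis_mult algebra_simps)
  finally show ?thesis by (simp add: fourier_def)
qed

lemma fourier_dilation:
  assumes "0 < \<sigma>" shows "fourier (\<lambda>y. g (y / \<sigma>)) u = \<sigma> * fourier g (\<sigma> * u)"
  unfolding fourier_def using assms
  by (subst lborel_integral_real_affine[where c=\<sigma> and t=0]) (auto simp: scaleR_conv_of_real mult_ac)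

lemma of_real_integral_eq_fourier_zero: "complex_of_real (LINT y|lborel. g y) = fourier g 0"
  by (simp add: fourier_def)

lemma cfourier_multiplication_formula:
  assumes g: "integrable lborel g" and k: "integrable lborel k"
  shows "(LINT u|lborel. cfourier g u * k u) = (LINT x|lborel. g x * cfourier k x)"
proof -
  have "(LINT u|lborel. cfourier g u * k u) = (LINT u|lborel. LINT x|lborel. g x * k u * cis (x * u))"
    unfolding cfourier_def by (simp add: mult_ac flip: integral_mult_right_zero)
  also have "\<dots> = (LINT x|lborel. LINT u|lborel. g x * k u * cis (x * u))"
    by (rule lborel_pair.Fubini_mult_bounded[OF g k]) auto
  also have "\<dots> = (LINT x|lborel. g x * cfourier k x)"
    unfolding cfourier_def by (simp add: mult_ac flip: integral_mult_right_zero)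
  finally show ?thesis .
qed

subsection \<open>Gaussian regularization\<close>

lemma integrable_gaussian:
  assumes "0 < \<sigma>" shows "integrable lborel (\<lambda>u::real. exp (- (\<sigma> * u)\<^sup>2 / 2))"
proof -
  have "integrable lborel (\<lambda>u::real. sqrt (2 * pi) * std_normal_density (0 + \<sigma> * u))"
    using assms by (intro integrable_mult_right lborel_integrable_real_affine) auto
  then show ?thesis by (simp add: std_normal_density_def)
qed

lemma cfourier_gaussian:
  assumes "0 < \<sigma>"
  shows "cfourier (\<lambda>u. complex_of_real (exp (- (\<sigma> * u)\<^sup>2 / 2))) t = 2 * pi * normal_density 0 \<sigma> t"
proof -
  have "complex_of_real (exp (- (t / \<sigma>)\<^sup>2 / 2)) = char std_normal_distribution (t / \<sigma>)"
    by (simp add: char_std_normal_distribution)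
  also have "\<dots> = (LINT x|lborel. complex_of_real (std_normal_density x) * cis (t / \<sigma> * x))"
    unfolding char_def by (subst integral_density) (auto simp: cis_conv_exp scaleR_conv_of_real)
  also have "\<dots> = \<sigma> * (LINT u|lborel. complex_of_real (std_normal_density (\<sigma> * u)) * cis (u * t))"
    using assms by (subst lborel_integral_real_affine[where c=\<sigma> and t=0])
      (auto simp: field_simps scaleR_conv_of_real)
  also have "(\<lambda>u. complex_of_real (std_normal_density (\<sigma> * u)) * cis (u * t))
      = (\<lambda>u. complex_of_real (1 / sqrt (2 * pi)) * (complex_of_real (exp (- (\<sigma> * u)\<^sup>2 / 2)) * cis (u * t)))"
    by (simp add: std_normal_density_def mult.assoc)
  finally have "complex_of_real (exp (- (t / \<sigma>)\<^sup>2 / 2)) * sqrt (2 * pi) / \<sigma>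
      = cfourier (\<lambda>u. complex_of_real (exp (- (\<sigma> * u)\<^sup>2 / 2))) t"
    using assms by (simp add: cfourier_def field_simps)
  moreover have "exp (- (t / \<sigma>)\<^sup>2 / 2) * sqrt (2 * pi) / \<sigma> = 2 * pi * normal_density 0 \<sigma> t"
    using assms by (simp add: normal_density_def power_divide real_sqrt_mult real_div_sqrt field_simps)
  ultimately show ?thesis by (metis (no_types) of_real_mult of_real_divide of_real_numeral)
qed

lemma cfourier_gaussian_modulated:
  assumes "0 < \<sigma>"
  shows "cfourier (\<lambda>u. complex_of_real (exp (- (\<sigma> * u)\<^sup>2 / 2)) * cis (- (u * y))) x
      = 2 * pi * normal_density y \<sigma> x"
proof -
  have "cfourier (\<lambda>u. complex_of_real (exp (- (\<sigma> * u)\<^sup>2 / 2)) * cis (- (u * y))) x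
      = cfourier (\<lambda>u. complex_of_real (exp (- (\<sigma> * u)\<^sup>2 / 2))) (x - y)"
    unfolding cfourier_def
    by (intro Bochner_Integration.integral_cong refl) (simp add: cis_mult algebra_simps)
  then show ?thesis unfolding cfourier_gaussian[OF assms] by (simp add: normal_density_def)
qed

lemma integral_cfourier_gaussian:
  assumes g: "integrable lborel g" and \<sigma>: "0 < \<sigma>"
  shows "(LINT u|lborel. cfourier g u * (complex_of_real (exp (- (\<sigma> * u)\<^sup>2 / 2)) * cis (- (u * y))))
    = 2 * pi * (LINT x|lborel. g x * complex_of_real (normal_density y \<sigma> x))"
proof -
  have "integrable lborel (\<lambda>u. complex_of_real (exp (- (\<sigma> * u)\<^sup>2 / 2)) * cis (- (u * y)))"
    using integrable_gaussian[OF \<sigma>] by (intro integrable_mult_cis) auto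
  from cfourier_multiplication_formula[OF g this] show ?thesis
    unfolding cfourier_gaussian_modulated[OF \<sigma>] by (simp add: mult.left_commute[of "g _"])
qed

lemma integral_normal_density_variance:
  assumes "0 < \<sigma>" shows "(LINT x|lborel. normal_density \<mu> \<sigma> x * (x - \<mu>)\<^sup>2) = \<sigma>\<^sup>2"
  using integral_normal_moment_even[OF assms, of \<mu> 1] by (simp add: fact_2)

lemma normal_density_le_outside:
  assumes "0 < \<sigma>" "0 \<le> \<delta>" "\<delta> \<le> \<bar>x - \<mu>\<bar>"
  shows "normal_density \<mu> \<sigma> x \<le> normal_density 0 \<sigma> \<delta>"
proof -
  have "\<delta>\<^sup>2 \<le> (x - \<mu>)\<^sup>2" using assms by (metis abs_le_square_iff abs_of_nonneg)
  then show ?thesis using assms unfolding normal_density_def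
    by (intro mult_left_mono) (auto intro!: divide_right_mono)
qed

lemma integrable_mult_normal_density:
  fixes g :: "real \<Rightarrow> complex"
  assumes g: "integrable lborel g" and "0 < \<sigma>"
  shows "integrable lborel (\<lambda>x. g x * complex_of_real (normal_density \<mu> \<sigma> x))"
proof (rule Bochner_Integration.integrable_bound)
  show "integrable lborel (\<lambda>x. g x * complex_of_real (normal_density 0 \<sigma> 0))" using g by simp
  have "normal_density \<mu> \<sigma> x \<le> normal_density 0 \<sigma> 0" for x
    using normal_density_le_outside[OF \<open>0 < \<sigma>\<close>, of 0 x \<mu>] by simp
  then show "AE x in lborel. cmod (g x * complex_of_real (normal_density \<mu> \<sigma> x))
      \<le> cmod (g x * complex_of_real (normal_density 0 \<sigma> 0))"
    by (simp add: norm_mult mult_left_mono)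
qed (use g in measurable)

lemma norm_mult_normal_density_diff_le:
  fixes w z :: complex
  assumes \<sigma>: "0 < \<sigma>" and \<delta>: "0 < \<delta>" and "0 \<le> \<epsilon>" and close: "\<bar>x - y\<bar> < \<delta> \<Longrightarrow> cmod (w - z) \<le> \<epsilon>"
  shows "cmod ((w - z) * complex_of_real (normal_density y \<sigma> x))
    \<le> \<epsilon> * normal_density y \<sigma> x + cmod w * normal_density 0 \<sigma> \<delta>
        + cmod z / \<delta>\<^sup>2 * (normal_density y \<sigma> x * (x - y)\<^sup>2)"
    (is "_ \<le> \<epsilon> * ?N x + _ + _")
proof (cases "\<bar>x - y\<bar> < \<delta>")
    case True
    then have "cmod (w - z) * ?N x \<le> \<epsilon> * ?N x" by (intro mult_right_mono close) auto
    moreover have "0 \<le> cmod (w) * normal_density 0 \<sigma> \<delta>" "0 \<le> cmod (z) / \<delta>\<^sup>2 * (?N x * (x - y)\<^sup>2)" by auto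
    ultimately show ?thesis unfolding norm_mult norm_of_real abs_of_nonneg[OF normal_density_nonneg]
      by linarith
  next
    case False
    then have "1 \<le> (x - y)\<^sup>2 / \<delta>\<^sup>2"
      using \<delta> by (simp add: abs_le_square_iff[symmetric])
    then have "cmod (z) * ?N x * 1 \<le> cmod (z) * ?N x * ((x - y)\<^sup>2 / \<delta>\<^sup>2)" by (intro mult_left_mono) auto
    then have "cmod (z) * ?N x \<le> cmod (z) / \<delta>\<^sup>2 * (?N x * (x - y)\<^sup>2)" by (simp add: mult_ac)
    moreover have "cmod (w) * ?N x \<le> cmod (w) * normal_density 0 \<sigma> \<delta>"
      using False \<delta> \<sigma> by (intro mult_left_mono normal_density_le_outside) auto
    moreover have "cmod (w - z) * ?N x \<le> (cmod (w) + cmod (z)) * ?N x"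
      by (intro mult_right_mono norm_triangle_ineq4) auto
    moreover have "0 \<le> \<epsilon> * ?N x" using \<open>0 \<le> \<epsilon>\<close> by simp
    ultimately show ?thesis
      unfolding norm_mult norm_of_real abs_of_nonneg[OF normal_density_nonneg] distrib_right by linarith
qed

lemma norm_integral_normal_density_diff_le:
  fixes g :: "real \<Rightarrow> complex"
  assumes g: "integrable lborel g" and \<sigma>: "0 < \<sigma>" and \<delta>: "0 < \<delta>" and "0 \<le> \<epsilon>"
    and close: "\<And>x. \<bar>x - y\<bar> < \<delta> \<Longrightarrow> cmod (g x - g y) \<le> \<epsilon>"
  shows "cmod ((LINT x|lborel. g x * complex_of_real (normal_density y \<sigma> x)) - g y)
    \<le> \<epsilon> + (LINT x|lborel. cmod (g x)) * normal_density 0 \<sigma> \<delta> + cmod (g y) * \<sigma>\<^sup>2 / \<delta>\<^sup>2"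
proof -
  let ?N = "normal_density y \<sigma>"
  let ?bound = "\<lambda>x. \<epsilon> * ?N x + cmod (g x) * normal_density 0 \<sigma> \<delta> + cmod (g y) / \<delta>\<^sup>2 * (?N x * (x - y)\<^sup>2)"
  have gN: "integrable lborel (\<lambda>x. g x * complex_of_real (?N x))"
    and N: "integrable lborel ?N" and N2: "integrable lborel (\<lambda>x. ?N x * (x - y)\<^sup>2)"
    using integrable_mult_normal_density[OF g \<sigma>] integrable_normal_moment[OF \<sigma>] \<sigma> by auto
  have diff: "integrable lborel (\<lambda>x. (g x - g y) * complex_of_real (?N x))"
    using gN N unfolding left_diff_distrib by (intro Bochner_Integration.integrable_diff) auto
  have "(LINT x|lborel. (g x - g y) * complex_of_real (?N x))
      = (LINT x|lborel. g x * complex_of_real (?N x)) - g y"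
    unfolding left_diff_distrib using \<sigma> N by (subst Bochner_Integration.integral_diff[OF gN]) auto
  then have "cmod ((LINT x|lborel. g x * complex_of_real (?N x)) - g y)
      \<le> (LINT x|lborel. cmod ((g x - g y) * complex_of_real (?N x)))"
    using integral_norm_bound[of lborel "\<lambda>x. (g x - g y) * complex_of_real (?N x)"] by simp
  also have "\<dots> \<le> (LINT x|lborel. ?bound x)"
  proof (rule integral_mono)
    show "integrable lborel ?bound"
      using N N2 g by (intro Bochner_Integration.integrable_add integrable_mult_right integrable_mult_left
          integrable_norm)
    show "integrable lborel (\<lambda>x. cmod ((g x - g y) * complex_of_real (?N x)))" using diff
      by (rule integrable_norm)
    fix x
    show "cmod ((g x - g y) * complex_of_real (?N x)) \<le> ?bound x"
      by (rule norm_mult_normal_density_diff_le[OF \<sigma> \<delta> \<open>0 \<le> \<epsilon>\<close> close])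
  qed
  also have "\<dots> = \<epsilon> + (LINT x|lborel. cmod (g x)) * normal_density 0 \<sigma> \<delta> + cmod (g y) * \<sigma>\<^sup>2 / \<delta>\<^sup>2"
    using N N2 g \<sigma> by (simp add: integral_normal_density_variance)
  finally show ?thesis .
qed

lemma tendsto_integral_normal_density:
  fixes g :: "real \<Rightarrow> complex"
  assumes g: "integrable lborel g" and cont: "isCont g y"
  shows "((\<lambda>\<sigma>. LINT x|lborel. g x * complex_of_real (normal_density y \<sigma> x)) \<longlongrightarrow> g y) (at_right 0)"
proof (rule tendstoI)
  fix e :: real assume "0 < e"
  then obtain \<delta> where \<delta>: "0 < \<delta>" "\<And>x. \<bar>x - y\<bar> < \<delta> \<Longrightarrow> cmod (g x - g y) < e / 2"
    using cont[unfolded continuous_at_eps_delta] by (metis dist_norm real_norm_def half_gt_zero)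
  let ?r = "\<lambda>\<sigma>. e / 2 + (LINT x|lborel. cmod (g x)) * normal_density 0 \<sigma> \<delta> + cmod (g y) * \<sigma>\<^sup>2 / \<delta>\<^sup>2"
  have "((\<lambda>\<sigma>. normal_density 0 \<sigma> \<delta>) \<longlongrightarrow> 0) (at_right 0)"
    unfolding normal_density_def using \<delta>(1) by real_asymp
  then have "(?r \<longlongrightarrow> e / 2 + (LINT x|lborel. cmod (g x)) * 0 + cmod (g y) * 0\<^sup>2 / \<delta>\<^sup>2) (at_right 0)"
    using \<delta>(1) by (intro tendsto_intros) auto
  then have "\<forall>\<^sub>F \<sigma> in at_right 0. ?r \<sigma> < e" by (rule order_tendstoD) (use \<open>0 < e\<close> in simp)
  with eventually_at_right_less
  show "\<forall>\<^sub>F \<sigma> in at_right 0. dist (LINT x|lborel. g x * complex_of_real (normal_density y \<sigma> x)) (g y) < e"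
  proof eventually_elim
    case (elim \<sigma>)
    have "cmod ((LINT x|lborel. g x * complex_of_real (normal_density y \<sigma> x)) - g y) \<le> ?r \<sigma>"
      by (rule norm_integral_normal_density_diff_le[OF g elim(1) \<delta>(1)])
        (use \<delta>(2) \<open>0 < e\<close> in \<open>auto intro: less_imp_le\<close>)
    then show ?case using elim(2) by (simp add: dist_norm)
  qed
qed

theorem fourier_inversion:
  fixes g :: "real \<Rightarrow> complex"
  assumes g: "integrable lborel g" and cont: "isCont g y" and G: "integrable lborel (cfourier g)"
  shows "cfourier (cfourier g) (- y) = 2 * pi * g y"
proof -
  define \<sigma> where "\<sigma> n = 1 / real (Suc n)" for n
  have \<sigma>: "0 < \<sigma> n" for n by (simp add: \<sigma>_def)
  have \<sigma>0: "\<sigma> \<longlonglongrightarrow> 0" unfolding \<sigma>_def by (rule LIMSEQ_Suc[OF lim_1_over_n])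
  let ?k = "\<lambda>\<sigma> u. complex_of_real (exp (- (\<sigma> * u)\<^sup>2 / 2)) * cis (- (u * y))"
  have [measurable]: "cfourier g \<in> borel_measurable borel" using G by auto
  have "(\<lambda>n. LINT u|lborel. cfourier g u * ?k (\<sigma> n) u) \<longlonglongrightarrow> (LINT u|lborel. cfourier g u * ?k 0 u)"
  proof (rule integral_dominated_convergence[where w="\<lambda>u. cmod (cfourier g u)"])
    show "AE u in lborel. (\<lambda>n. cfourier g u * ?k (\<sigma> n) u) \<longlonglongrightarrow> cfourier g u * ?k 0 u"
      by (intro AE_I2 tendsto_intros \<sigma>0) simp
    show "AE u in lborel. cmod (cfourier g u * ?k (\<sigma> n) u) \<le> cmod (cfourier g u)" for n
      by (auto simp: norm_mult intro!: mult_left_le)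
  qed (use G in auto)
  moreover have "filterlim \<sigma> (at_right 0) sequentially"
    unfolding filterlim_at using \<sigma>0 \<sigma> by (auto intro!: always_eventually simp: less_imp_neq[symmetric])
  from filterlim_compose[OF tendsto_integral_normal_density[OF g cont] this]
  have "(\<lambda>n. 2 * pi * (LINT x|lborel. g x * complex_of_real (normal_density y (\<sigma> n) x))) \<longlonglongrightarrow> 2 * pi * g y"
    by (intro tendsto_intros)
  then have "(\<lambda>n. LINT u|lborel. cfourier g u * ?k (\<sigma> n) u) \<longlonglongrightarrow> 2 * pi * g y"
    unfolding integral_cfourier_gaussian[OF g \<sigma>] .
  ultimately have "(LINT u|lborel. cfourier g u * ?k 0 u) = 2 * pi * g y" by (rule LIMSEQ_unique)
  then show ?thesis by (simp add: cfourier_def[of "cfourier g"])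
qed

subsection \<open>The Plancherel inequality\<close>

lemma two_mult_le_sum_squares_ennreal: "2 * (x * y) \<le> x\<^sup>2 + (y\<^sup>2 :: ennreal)"
proof (cases x; cases y)
  fix a b assume "x = ennreal a" "0 \<le> a" "y = ennreal b" "0 \<le> b"
  then show ?thesis
    using sum_squares_bound[of a b]
    by (simp add: ennreal_power ennreal_mult[symmetric] ennreal_plus[symmetric] mult.assoc del: ennreal_plus
        flip: ennreal_numeral)
qed (auto simp: power2_eq_square ennreal_mult_eq_top_iff)

lemma nn_integral_symmetric_markov_kernel_le:
  fixes p :: "'a \<Rightarrow> ennreal"
  assumes "sigma_finite_measure M" and [measurable]: "p \<in> borel_measurable M"
    and [measurable]: "(\<lambda>(x, t). k x t) \<in> borel_measurable (M \<Otimes>\<^sub>M M)"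
    and sym: "\<And>x t. k x t = k t x" and markov: "\<And>x. (\<integral>\<^sup>+t. k x t \<partial>M) = 1"
  shows "(\<integral>\<^sup>+x. \<integral>\<^sup>+t. p x * (p t * k x t) \<partial>M \<partial>M) \<le> (\<integral>\<^sup>+x. (p x)\<^sup>2 \<partial>M)"
proof -
  interpret M: sigma_finite_measure M by fact
  interpret P: pair_sigma_finite M M ..
  have mass: "(\<integral>\<^sup>+x. \<integral>\<^sup>+t. (p x)\<^sup>2 * k x t \<partial>M \<partial>M) = (\<integral>\<^sup>+x. (p x)\<^sup>2 \<partial>M)"
    by (intro nn_integral_cong) (simp add: nn_integral_cmult markov)
  have "2 * (\<integral>\<^sup>+x. \<integral>\<^sup>+t. p x * (p t * k x t) \<partial>M \<partial>M) = (\<integral>\<^sup>+x. \<integral>\<^sup>+t. 2 * (p x * p t) * k x t \<partial>M \<partial>M)"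
    by (subst nn_integral_cmult[symmetric], measurable)
       (intro nn_integral_cong, simp add: mult.assoc flip: nn_integral_cmult)
  also have "\<dots> \<le> (\<integral>\<^sup>+x. \<integral>\<^sup>+t. (p x)\<^sup>2 * k x t + (p t)\<^sup>2 * k t x \<partial>M \<partial>M)"
    using two_mult_le_sum_squares_ennreal
    by (intro nn_integral_mono) (simp add: sym[of _ "_ :: 'a"] distrib_right[symmetric] mult_right_mono)
  also have "\<dots> = (\<integral>\<^sup>+x. \<integral>\<^sup>+t. (p x)\<^sup>2 * k x t \<partial>M \<partial>M) + (\<integral>\<^sup>+x. \<integral>\<^sup>+t. (p t)\<^sup>2 * k t x \<partial>M \<partial>M)"
    by (subst nn_integral_add[symmetric], measurable) (intro nn_integral_cong nn_integral_add, measurable)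
  also have "(\<integral>\<^sup>+x. \<integral>\<^sup>+t. (p t)\<^sup>2 * k t x \<partial>M \<partial>M) = (\<integral>\<^sup>+t. \<integral>\<^sup>+x. (p t)\<^sup>2 * k t x \<partial>M \<partial>M)"
    by (rule P.Fubini') measurable
  finally have "2 * (\<integral>\<^sup>+x. \<integral>\<^sup>+t. p x * (p t * k x t) \<partial>M \<partial>M) \<le> 2 * (\<integral>\<^sup>+x. (p x)\<^sup>2 \<partial>M)"
    unfolding mass by (simp add: mult_2)
  then show ?thesis by (simp add: ennreal_mult_le_mult_iff)
qed

lemma nn_integral_normal_density:
  assumes "0 < \<sigma>" shows "(\<integral>\<^sup>+t. ennreal (normal_density x \<sigma> t) \<partial>lborel) = 1"
  using assms by (subst nn_integral_eq_integral) auto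

lemma nn_integral_gaussian_cfourier_square_eq:
  assumes g: "integrable lborel g" and \<sigma>: "0 < \<sigma>"
  shows "(\<integral>\<^sup>+y. ennreal ((cmod (cfourier g y))\<^sup>2 * exp (- (\<sigma> * y)\<^sup>2 / 2)) \<partial>lborel)
    = ennreal (cmod (LINT x|lborel. g x
        * cnj (2 * pi * (LINT t|lborel. g t * complex_of_real (normal_density x \<sigma> t)))))"
proof -
  have [measurable]: "cfourier g \<in> borel_measurable borel" by (rule borel_measurable_cfourier[OF g])
  let ?\<gamma> = "\<lambda>y. exp (- (\<sigma> * y)\<^sup>2 / 2)"
    and ?S = "\<lambda>x. LINT t|lborel. g t * complex_of_real (normal_density x \<sigma> t)"
  let ?k = "\<lambda>y. cnj (cfourier g y) * complex_of_real (?\<gamma> y)"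
  define C where "C = (LINT x|lborel. cmod (g x))"
  have C: "cmod (cfourier g y) \<le> C" for y unfolding C_def by (rule norm_cfourier_le)
  have dominated: "integrable lborel k"
    if "k \<in> borel_measurable borel" "\<And>y. norm (k y) \<le> B * ?\<gamma> y" for B
      and k :: "real \<Rightarrow> 'b::{banach, second_countable_topology}"
    by (rule Bochner_Integration.integrable_bound[OF
        integrable_mult_right[OF integrable_gaussian[OF \<sigma>], of B]])
       (use that in \<open>auto intro: order_trans[OF _ abs_ge_self]\<close>)
  have k: "integrable lborel ?k"
  proof (rule dominated[of _ C])
    show "?k \<in> borel_measurable borel"
      by (intro borel_measurable_continuous_onI continuous_intros continuous_on_cfourier g) simp
  qed (simp add: norm_mult mult_right_mono C)
  have square: "integrable lborel (\<lambda>y. (cmod (cfourier g y))\<^sup>2 * ?\<gamma> y)"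
    by (rule dominated[of _ "C\<^sup>2"]) (auto simp: abs_mult intro!: mult_right_mono power_mono C)
  have k_transform: "cfourier ?k x = cnj (2 * pi * ?S x)" for x
    unfolding integral_cfourier_gaussian[OF g \<sigma>, symmetric] cfourier_def[of ?k]
    by (subst Bochner_Integration.integral_cnj[symmetric])
       (intro Bochner_Integration.integral_cong refl, simp add: cis_cnj mult_ac)
  have "complex_of_real (LINT y|lborel. (cmod (cfourier g y))\<^sup>2 * ?\<gamma> y)
      = (LINT y|lborel. cfourier g y * ?k y)"
    by (subst integral_complex_of_real[symmetric])
       (intro Bochner_Integration.integral_cong refl, simp add: complex_norm_square del: of_real_power)
  also have "\<dots> = (LINT x|lborel. g x * cnj (2 * pi * ?S x))"
    unfolding cfourier_multiplication_formula[OF g k] k_transform ..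
  finally have "cmod (complex_of_real (LINT y|lborel. (cmod (cfourier g y))\<^sup>2 * ?\<gamma> y))
      = cmod (LINT x|lborel. g x * cnj (2 * pi * ?S x))" by (rule arg_cong)
  moreover have "0 \<le> (LINT y|lborel. (cmod (cfourier g y))\<^sup>2 * ?\<gamma> y)" by simp
  ultimately have "(LINT y|lborel. (cmod (cfourier g y))\<^sup>2 * ?\<gamma> y)
      = cmod (LINT x|lborel. g x * cnj (2 * pi * ?S x))"
    unfolding norm_of_real by (simp only: abs_of_nonneg)
  then show "(\<integral>\<^sup>+y. ennreal ((cmod (cfourier g y))\<^sup>2 * ?\<gamma> y) \<partial>lborel)
      = ennreal (cmod (LINT x|lborel. g x * cnj (2 * pi * ?S x)))"
    by (subst nn_integral_eq_integral[OF square]) auto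
qed

lemma norm_integral_mult_gaussian_smoothing_le:
  fixes g :: "real \<Rightarrow> complex"
  assumes g: "integrable lborel g" and \<sigma>: "0 < \<sigma>"
  shows "ennreal (cmod
      (LINT x|lborel. g x * cnj (2 * pi * (LINT t|lborel. g t * complex_of_real (normal_density x \<sigma> t)))))
    \<le> ennreal (2 * pi) * (\<integral>\<^sup>+x. ennreal ((cmod (g x))\<^sup>2) \<partial>lborel)"
proof -
  have [measurable]: "g \<in> borel_measurable borel" using g by auto
  let ?N = "\<lambda>x t. normal_density x \<sigma> t"
  let ?S = "\<lambda>x. LINT t|lborel. g t * complex_of_real (?N x t)"
  have [measurable]: "(\<lambda>x. normal_density (fst x) \<sigma> (snd x)) \<in> borel_measurable (borel \<Otimes>\<^sub>M borel)"
    unfolding normal_density_def by measurable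
  have "ennreal (cmod (LINT x|lborel. g x * cnj (2 * pi * ?S x)))
      \<le> (\<integral>\<^sup>+x. ennreal (cmod (g x * cnj (2 * pi * ?S x))) \<partial>lborel)" by (rule ennreal_norm_integral_le)
  also have "\<dots> = (\<integral>\<^sup>+x. ennreal (2 * pi) * (ennreal (cmod (g x)) * ennreal (cmod (?S x))) \<partial>lborel)"
    by (intro nn_integral_cong) (simp add: norm_mult ennreal_mult'[symmetric] mult_ac)
  also have "\<dots> \<le> (\<integral>\<^sup>+x. ennreal (2 * pi)
      * (\<integral>\<^sup>+t. ennreal (cmod (g x)) * (ennreal (cmod (g t)) * ennreal (?N x t)) \<partial>lborel) \<partial>lborel)"
  proof (intro nn_integral_mono mult_left_mono)
    fix x
    have "ennreal (cmod (?S x)) \<le> (\<integral>\<^sup>+t. ennreal (cmod (g t)) * ennreal (?N x t) \<partial>lborel)"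
      using ennreal_norm_integral_le[of lborel "\<lambda>t. g t * complex_of_real (?N x t)"]
      by (simp add: norm_mult ennreal_mult)
    then show "ennreal (cmod (g x)) * ennreal (cmod (?S x))
        \<le> (\<integral>\<^sup>+t. ennreal (cmod (g x)) * (ennreal (cmod (g t)) * ennreal (?N x t)) \<partial>lborel)"
      by (subst nn_integral_cmult) (auto intro: mult_left_mono)
  qed simp
  also have "\<dots> = ennreal (2 * pi)
      * (\<integral>\<^sup>+x. \<integral>\<^sup>+t. ennreal (cmod (g x)) * (ennreal (cmod (g t)) * ennreal (?N x t)) \<partial>lborel \<partial>lborel)"
    by (rule nn_integral_cmult) measurable
  also have "\<dots> \<le> ennreal (2 * pi) * (\<integral>\<^sup>+x. (ennreal (cmod (g x)))\<^sup>2 \<partial>lborel)"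
    by (intro mult_left_mono nn_integral_symmetric_markov_kernel_le lborel.sigma_finite_measure_axioms
        nn_integral_normal_density \<sigma>) (auto simp: normal_density_def power2_commute)
  finally show ?thesis by (simp add: ennreal_power)
qed

theorem plancherel_le:
  assumes g: "integrable lborel g"
  shows "(\<integral>\<^sup>+y. ennreal ((cmod (cfourier g y))\<^sup>2) \<partial>lborel)
      \<le> ennreal (2 * pi) * (\<integral>\<^sup>+x. ennreal ((cmod (g x))\<^sup>2) \<partial>lborel)"
proof -
  have [measurable]: "cfourier g \<in> borel_measurable borel" by (rule borel_measurable_cfourier[OF g])
  let ?F = "\<lambda>n y. ennreal ((cmod (cfourier g y))\<^sup>2 * exp (- (1 / real (Suc n) * y)\<^sup>2 / 2))"
  have "(\<lambda>n. ?F n y) \<longlonglongrightarrow> ennreal ((cmod (cfourier g y))\<^sup>2 * exp (- (0 * y)\<^sup>2 / 2))" for y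
    by (intro tendsto_intros LIMSEQ_Suc[OF lim_1_over_n]) auto
  then have "(\<integral>\<^sup>+y. ennreal ((cmod (cfourier g y))\<^sup>2) \<partial>lborel) = (\<integral>\<^sup>+y. liminf (\<lambda>n. ?F n y) \<partial>lborel)"
    by (intro nn_integral_cong lim_imp_Liminf[symmetric]) auto
  also have "\<dots> \<le> liminf (\<lambda>n. \<integral>\<^sup>+y. ?F n y \<partial>lborel)" by (rule nn_integral_liminf) measurable
  also have "\<dots> \<le> liminf (\<lambda>n. ennreal (2 * pi) * (\<integral>\<^sup>+x. ennreal ((cmod (g x))\<^sup>2) \<partial>lborel))"
  proof (intro Liminf_mono always_eventually allI)
    fix n
    have "0 < 1 / real (Suc n)" by simp
    from norm_integral_mult_gaussian_smoothing_le[OF g this]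
    show "(\<integral>\<^sup>+y. ?F n y \<partial>lborel) \<le> ennreal (2 * pi) * (\<integral>\<^sup>+x. ennreal ((cmod (g x))\<^sup>2) \<partial>lborel)"
      unfolding nn_integral_gaussian_cfourier_square_eq[OF g \<open>0 < 1 / real (Suc n)\<close>] .
  qed
  finally show ?thesis by (simp add: Liminf_const)
qed

section \<open>Risk of the kernel estimator\<close>

subsection \<open>Densities and the law of the observations\<close>

lemma prob_densityD:
  assumes "prob_density f"
  shows "f \<in> borel_measurable borel" "0 \<le> f x" "integrable lborel f" "(LINT x|lborel. f x) = 1"
  using assms by (auto simp: prob_density_def)

lemma prob_space_prob_density:
  assumes "prob_density f" shows "prob_space (density lborel f)"
proof (rule prob_spaceI)
  note [measurable] = prob_densityD(1)[OF assms]
  have "(\<integral>\<^sup>+x. ennreal (f x) \<partial>lborel) = ennreal 1"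
    using prob_densityD[OF assms] by (subst nn_integral_eq_integral) auto
  then show "emeasure (density lborel f) (space (density lborel f)) = 1"
    by (simp add: emeasure_density)
qed

lemma borel_measurable_fourier_prob_density: "prob_density f \<Longrightarrow> fourier f \<in> borel_measurable borel"
  by (intro borel_measurable_fourier prob_densityD)

lemma norm_fourier_prob_density_le: "prob_density f \<Longrightarrow> cmod (fourier f u) \<le> 1"
  using norm_cfourier_le[of "\<lambda>x. complex_of_real (f x)" u] prob_densityD[of f]
  by (simp add: fourier_eq_cfourier)

lemma law_Y_convolution: "law_Y f fe = (density lborel f \<star> density lborel fe)"
  by (simp add: law_Y_def convolution_def)

lemma sets_law_Y[simp, measurable_cong]: "sets (law_Y f fe) = sets borel"
  by (simp add: law_Y_def)

lemma space_law_Y[simp]: "space (law_Y f fe) = UNIV"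
  by (simp add: law_Y_def)

lemma prob_space_law_Y:
  assumes "prob_density f" "prob_density fe" shows "prob_space (law_Y f fe)"
proof -
  interpret M: prob_space "density lborel f" by (rule prob_space_prob_density) fact
  interpret N: prob_space "density lborel fe" by (rule prob_space_prob_density) fact
  interpret P: pair_prob_space "density lborel f" "density lborel fe" ..
  show ?thesis unfolding law_Y_def by (rule P.prob_space_distr) simp
qed

lemma integral_cis_density:
  assumes "prob_density f"
  shows "(LINT x|density lborel f. cis (u * x)) = fourier f u"
  using prob_densityD[OF assms] unfolding fourier_def
  by (subst integral_density) (auto simp: scaleR_conv_of_real mult.commute)

lemma integral_cis_law_Y:
  assumes f: "prob_density f" and fe: "prob_density fe"
  shows "(LINT y|law_Y f fe. cis (u * y)) = fourier f u * fourier fe u"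
proof -
  interpret M: prob_space "density lborel f" by (rule prob_space_prob_density) fact
  interpret N: prob_space "density lborel fe" by (rule prob_space_prob_density) fact
  interpret P: pair_prob_space "density lborel f" "density lborel fe" ..
  have int: "integrable (density lborel f \<Otimes>\<^sub>M density lborel fe) (\<lambda>(x, e). cis (u * (x + e)))"
    by (rule P.integrable_const_bound[where B=1]) auto
  have "(LINT y|law_Y f fe. cis (u * y))
      = integral\<^sup>L (density lborel f \<Otimes>\<^sub>M density lborel fe) (\<lambda>(x, e). cis (u * (x + e)))"
    unfolding law_Y_def by (subst integral_distr) (auto simp: case_prod_beta')
  also have "\<dots> = (LINT x|density lborel f. LINT e|density lborel fe. cis (u * x) * cis (u * e))"
    using P.integral_fst[OF int] by (simp add: cis_mult ring_distribs)
  also have "\<dots> = fourier f u * fourier fe u"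
    by (simp add: integral_cis_density f fe)
  finally show ?thesis .
qed

subsection \<open>Mean square error of an empirical mean\<close>

lemma integrable_PiM_component:
  fixes f :: "'a \<Rightarrow> 'b::{banach, second_countable_topology}"
  assumes Q: "prob_space Q" and i: "i \<in> I" and f: "integrable Q f"
  shows "integrable (PiM I (\<lambda>_. Q)) (\<lambda>Y. f (Y i))"
    and "(LINT Y|PiM I (\<lambda>_. Q). f (Y i)) = (LINT y|Q. f y)"
proof -
  have distr: "distr (PiM I (\<lambda>_. Q)) Q (\<lambda>Y. Y i) = Q"
    by (rule distr_PiM_component[where M="\<lambda>_. Q"]) (use Q i in auto)
  show "integrable (PiM I (\<lambda>_. Q)) (\<lambda>Y. f (Y i))"
    using f i integrable_distr[of "\<lambda>Y. Y i" "PiM I (\<lambda>_. Q)" Q f] by (simp add: distr)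
  show "(LINT Y|PiM I (\<lambda>_. Q). f (Y i)) = (LINT y|Q. f y)"
    using f i integral_distr[of "\<lambda>Y. Y i" "PiM I (\<lambda>_. Q)" Q f] by (simp add: distr)
qed

lemma integrable_PiM_mult_components:
  fixes f g :: "'a \<Rightarrow> real"
  assumes Q: "prob_space Q" and I: "finite I" "i \<in> I" "j \<in> I" "i \<noteq> j" and f: "integrable Q f"
    and g: "integrable Q g"
  shows "integrable (PiM I (\<lambda>_. Q)) (\<lambda>Y. f (Y i) * g (Y j))"
    and "(LINT Y|PiM I (\<lambda>_. Q). f (Y i) * g (Y j)) = (LINT y|Q. f y) * (LINT y|Q. g y)"
proof -
  interpret Q: prob_space Q by fact
  interpret P: product_sigma_finite "\<lambda>_. Q" ..
  define \<phi> where "\<phi> k y = (if k = i then f y else if k = j then g y else 1)" for k y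
  have factor: "(\<Prod>k\<in>I. F k) = F i * F j" if "\<And>k. k \<noteq> i \<Longrightarrow> k \<noteq> j \<Longrightarrow> F k = 1" for F :: "_ \<Rightarrow> real"
  proof -
    have "(\<Prod>k\<in>I. F k) = (\<Prod>k\<in>{i, j}. F k)"
      using I that by (intro prod.mono_neutral_right) auto
    then show ?thesis using I by simp
  qed
  have int: "integrable Q (\<phi> k)" for k
    using f g by (cases "k = i"; cases "k = j") (auto simp: \<phi>_def[abs_def])
  have prod: "(\<Prod>k\<in>I. \<phi> k (Y k)) = f (Y i) * g (Y j)" for Y
    using I(4) by (subst factor) (auto simp: \<phi>_def)
  show "integrable (PiM I (\<lambda>_. Q)) (\<lambda>Y. f (Y i) * g (Y j))"
    using P.product_integrable_prod[OF I(1), of \<phi>] int by (simp add: prod)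
  have "(\<Prod>k\<in>I. LINT y|Q. \<phi> k y) = (LINT y|Q. f y) * (LINT y|Q. g y)"
    using I(4) by (subst factor) (auto simp: \<phi>_def[abs_def] Q.prob_space)
  then show "(LINT Y|PiM I (\<lambda>_. Q). f (Y i) * g (Y j)) = (LINT y|Q. f y) * (LINT y|Q. g y)"
    using P.product_integral_prod[OF I(1), of \<phi>] int by (simp add: prod)
qed

lemma empirical_mean_moments:
  fixes Z :: "'a \<Rightarrow> real" and n :: nat
  defines "X \<equiv> \<lambda>Y. (\<Sum>i<n. Z (Y i)) / real n"
  assumes Q: "prob_space Q" and Z: "integrable Q Z" and Z2: "integrable Q (\<lambda>y. (Z y)\<^sup>2)" and n: "0 < n"
  shows "integrable (PiM {..<n} (\<lambda>_. Q)) X" "integrable (PiM {..<n} (\<lambda>_. Q)) (\<lambda>Y. (X Y)\<^sup>2)"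
    and "(LINT Y|PiM {..<n} (\<lambda>_. Q). X Y) = (LINT y|Q. Z y)"
    and "(LINT Y|PiM {..<n} (\<lambda>_. Q). (X Y)\<^sup>2)
      = (LINT y|Q. Z y)\<^sup>2 + ((LINT y|Q. (Z y)\<^sup>2) - (LINT y|Q. Z y)\<^sup>2) / real n"
proof -
  let ?P = "PiM {..<n} (\<lambda>_. Q)"
  define \<mu> m where "\<mu> = (LINT y|Q. Z y)" and "m = (LINT y|Q. (Z y)\<^sup>2)"
  have pair: "integrable ?P (\<lambda>Y. Z (Y i) * Z (Y j)) \<and>
      (LINT Y|?P. Z (Y i) * Z (Y j)) = \<mu>\<^sup>2 + (if i = j then m - \<mu>\<^sup>2 else 0)" if "i < n" "j < n" for i j
  proof (cases "i = j")
    case True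
    then show ?thesis
      using integrable_PiM_component[OF Q _ Z2, of i "{..<n}"] that by (simp add: power2_eq_square m_def)
  next
    case False
    then show ?thesis
      using integrable_PiM_mult_components[OF Q _ _ _ False Z Z, of "{..<n}"] that
      by (simp add: power2_eq_square \<mu>_def)
  qed
  have single: "integrable ?P (\<lambda>Y. Z (Y i)) \<and> (LINT Y|?P. Z (Y i)) = \<mu>" if "i < n" for i
    using integrable_PiM_component[OF Q _ Z, of i "{..<n}"] that by (simp add: \<mu>_def)
  then show "integrable ?P X"
    unfolding X_def by (intro integrable_divide Bochner_Integration.integrable_sum) auto
  show "(LINT Y|?P. X Y) = (LINT y|Q. Z y)"
    using single n by (simp add: X_def \<mu>_def)
  have X2_sum: "(X Y)\<^sup>2 = (\<Sum>i<n. \<Sum>j<n. Z (Y i) * Z (Y j)) / (real n)\<^sup>2" for Y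
    by (simp add: X_def power_divide power2_eq_square sum_product)
  show "integrable ?P (\<lambda>Y. (X Y)\<^sup>2)"
    unfolding X2_sum using pair by (intro integrable_divide Bochner_Integration.integrable_sum) auto
  have "(LINT Y|?P. (\<Sum>i<n. \<Sum>j<n. Z (Y i) * Z (Y j))) = (\<Sum>i<n. \<Sum>j<n. (LINT Y|?P. Z (Y i) * Z (Y j)))"
    using pair by (subst Bochner_Integration.integral_sum)
      (auto intro!: Bochner_Integration.integrable_sum sum.cong Bochner_Integration.integral_sum)
  also have "\<dots> = (\<Sum>i<n. \<Sum>j<n. \<mu>\<^sup>2 + (if i = j then m - \<mu>\<^sup>2 else 0))"
    using pair by (intro sum.cong refl) auto
  also have "\<dots> = (real n)\<^sup>2 * \<mu>\<^sup>2 + real n * (m - \<mu>\<^sup>2)"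
    by (simp add: sum.distrib power2_eq_square distrib_left)
  finally show "(LINT Y|?P. (X Y)\<^sup>2) = (LINT y|Q. Z y)\<^sup>2 + ((LINT y|Q. (Z y)\<^sup>2) - (LINT y|Q. Z y)\<^sup>2) / real n"
    unfolding X2_sum \<mu>_def[symmetric] m_def[symmetric] using n by (simp add: power2_eq_square field_simps)
qed

lemma mean_square_error_empirical_mean_le:
  fixes Z :: "'a \<Rightarrow> real"
  assumes Q: "prob_space Q" and [measurable]: "Z \<in> borel_measurable Q"
    and Z2: "integrable Q (\<lambda>y. (Z y)\<^sup>2)" and n: "0 < n"
  shows "(\<integral>\<^sup>+Y. ennreal (((\<Sum>i<n. Z (Y i)) / real n - c)\<^sup>2) \<partial>PiM {..<n} (\<lambda>_. Q))
    \<le> ennreal (1 / real n) * (\<integral>\<^sup>+y. ennreal ((Z y)\<^sup>2) \<partial>Q) + ennreal (((LINT y|Q. Z y) - c)\<^sup>2)"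
proof -
  interpret Q: prob_space Q by fact
  let ?P = "PiM {..<n} (\<lambda>_. Q)"
  interpret P: prob_space ?P by (intro prob_space_PiM Q)
  have Z: "integrable Q Z" by (rule Q.square_integrable_imp_integrable[OF _ Z2]) measurable
  define \<mu> m where "\<mu> = (LINT y|Q. Z y)" and "m = (LINT y|Q. (Z y)\<^sup>2)"
  define X where "X Y = (\<Sum>i<n. Z (Y i)) / real n" for Y
  note X = empirical_mean_moments[OF Q Z Z2 n, folded X_def \<mu>_def m_def]
  have expand: "(X Y - c)\<^sup>2 = (X Y)\<^sup>2 - 2 * c * X Y + c\<^sup>2" for Y by (simp add: power2_eq_square algebra_simps)
  have "integrable ?P (\<lambda>Y. (X Y - c)\<^sup>2)" unfolding expand using X by simp
  then have "(\<integral>\<^sup>+Y. ennreal ((X Y - c)\<^sup>2) \<partial>?P) = ennreal (LINT Y|?P. (X Y - c)\<^sup>2)"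
    by (rule nn_integral_eq_integral) simp
  also have "(LINT Y|?P. (X Y - c)\<^sup>2) = (m - \<mu>\<^sup>2) / real n + (\<mu> - c)\<^sup>2"
    unfolding expand using X by (simp add: P.prob_space power2_eq_square algebra_simps)
  also have "ennreal \<dots> \<le> ennreal (1 / real n * m + (\<mu> - c)\<^sup>2)"
    using n by (intro ennreal_leI add_mono) (auto simp: field_simps)
  also have "\<dots> = ennreal (1 / real n) * ennreal m + ennreal ((\<mu> - c)\<^sup>2)"
    by (simp add: m_def ennreal_mult'[symmetric])
  also have "ennreal m = (\<integral>\<^sup>+y. ennreal ((Z y)\<^sup>2) \<partial>Q)"
    unfolding m_def by (intro nn_integral_eq_integral[symmetric] Z2) auto
  finally show ?thesis by (simp add: X_def \<mu>_def)
qed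

subsection \<open>Fourier tails of the smoothness class\<close>

definition fourier_energy :: "real \<Rightarrow> real \<Rightarrow> (real \<Rightarrow> real) \<Rightarrow> ennreal" where
  "fourier_energy \<alpha> r f = (\<integral>\<^sup>+u. ennreal ((cmod (fourier f u))\<^sup>2 * exp (2 * \<alpha> * \<bar>u\<bar> powr r)) \<partial>lborel)"

lemma dens_class_iff:
  "f \<in> dens_class \<alpha> r L \<longleftrightarrow> prob_density f \<and> continuous_on UNIV f \<and> fourier_energy \<alpha> r f \<le> ennreal (2 * pi * L)"
  by (simp add: dens_class_def fourier_energy_def)

definition fourier_tail :: "(real \<Rightarrow> real) \<Rightarrow> real \<Rightarrow> real \<Rightarrow> complex" where
  "fourier_tail f a u = indicator {u. a < \<bar>u\<bar>} u * fourier f u"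

definition exp_tail :: "real \<Rightarrow> real \<Rightarrow> real \<Rightarrow> ennreal" where
  "exp_tail \<alpha> r a = (\<integral>\<^sup>+u. indicator {u. a < \<bar>u\<bar>} u * ennreal (exp (- 2 * \<alpha> * \<bar>u\<bar> powr r)) \<partial>lborel)"

lemma borel_measurable_fourier_tail:
  assumes "prob_density f" shows "fourier_tail f a \<in> borel_measurable borel"
  unfolding fourier_tail_def using borel_measurable_fourier_prob_density[OF assms] by measurable

lemma nn_integral_norm_fourier_tail_le:
  assumes f: "prob_density f"
  shows "(\<integral>\<^sup>+u. ennreal (cmod (fourier_tail f a u)) \<partial>lborel)\<^sup>2 \<le> fourier_energy \<alpha> r f * exp_tail \<alpha> r a"
proof -
  note [measurable] = borel_measurable_fourier_prob_density[OF f]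
  let ?w = "\<lambda>u::real. exp (\<alpha> * \<bar>u\<bar> powr r)" and ?I = "indicator {u. a < \<bar>u\<bar>} :: real \<Rightarrow> real"
  have "cmod (fourier_tail f a u) = cmod (fourier f u) * ?w u * (?I u * exp (- \<alpha> * \<bar>u\<bar> powr r))" for u
    by (simp add: fourier_tail_def norm_mult exp_minus split: split_indicator)
  then have "(\<integral>\<^sup>+u. ennreal (cmod (fourier_tail f a u)) \<partial>lborel)\<^sup>2
      = (\<integral>\<^sup>+u. ennreal (cmod (fourier f u) * ?w u) * ennreal (?I u * exp (- \<alpha> * \<bar>u\<bar> powr r)) \<partial>lborel)\<^sup>2"
    by (simp add: ennreal_mult)
  also have "\<dots> \<le> (\<integral>\<^sup>+u. (ennreal (cmod (fourier f u) * ?w u))\<^sup>2 \<partial>lborel)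
      * (\<integral>\<^sup>+u. (ennreal (?I u * exp (- \<alpha> * \<bar>u\<bar> powr r)))\<^sup>2 \<partial>lborel)"
    by (rule Cauchy_Schwarz_nn_integral) measurable
  also have "(\<integral>\<^sup>+u. (ennreal (cmod (fourier f u) * ?w u))\<^sup>2 \<partial>lborel) = fourier_energy \<alpha> r f"
    unfolding fourier_energy_def
    by (intro nn_integral_cong) (simp add: ennreal_power power_mult_distrib exp_double[symmetric] mult.assoc)
  also have "(\<integral>\<^sup>+u. (ennreal (?I u * exp (- \<alpha> * \<bar>u\<bar> powr r)))\<^sup>2 \<partial>lborel) = exp_tail \<alpha> r a"
    unfolding exp_tail_def
    by (intro nn_integral_cong)
      (simp add: ennreal_power exp_double[symmetric] mult.assoc split: split_indicator)
  finally show ?thesis .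
qed

lemma nn_integral_norm_fourier_tail_square_le:
  assumes f: "prob_density f" and "0 \<le> \<alpha>" "0 \<le> r" "0 \<le> a"
  shows "(\<integral>\<^sup>+u. ennreal ((cmod (fourier_tail f a u))\<^sup>2) \<partial>lborel)
    \<le> ennreal (exp (- 2 * \<alpha> * a powr r)) * fourier_energy \<alpha> r f"
proof -
  note [measurable] = borel_measurable_fourier_prob_density[OF f]
  have "(cmod (fourier_tail f a u))\<^sup>2
      \<le> exp (- 2 * \<alpha> * a powr r) * ((cmod (fourier f u))\<^sup>2 * exp (2 * \<alpha> * \<bar>u\<bar> powr r))" for u
  proof (cases "a < \<bar>u\<bar>")
    case True
    then have "a powr r \<le> \<bar>u\<bar> powr r" using assms by (intro powr_mono2) auto
    then have "1 \<le> exp (- 2 * \<alpha> * a powr r) * exp (2 * \<alpha> * \<bar>u\<bar> powr r)"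
      using assms by (simp add: mult_left_mono flip: exp_add)
    then have "(cmod (fourier f u))\<^sup>2 * 1
        \<le> (cmod (fourier f u))\<^sup>2 * (exp (- 2 * \<alpha> * a powr r) * exp (2 * \<alpha> * \<bar>u\<bar> powr r))"
      by (rule mult_left_mono) simp
    then show ?thesis using True by (simp add: fourier_tail_def mult_ac)
  qed (simp add: fourier_tail_def)
  then have "(\<integral>\<^sup>+u. ennreal ((cmod (fourier_tail f a u))\<^sup>2) \<partial>lborel)
      \<le> (\<integral>\<^sup>+u. ennreal (exp (- 2 * \<alpha> * a powr r))
          * ennreal ((cmod (fourier f u))\<^sup>2 * exp (2 * \<alpha> * \<bar>u\<bar> powr r)) \<partial>lborel)"
    by (intro nn_integral_mono) (simp add: ennreal_leI flip: ennreal_mult')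
  then show ?thesis unfolding fourier_energy_def by (subst (asm) nn_integral_cmult) auto
qed

lemma integrable_fourier_tail:
  assumes f: "f \<in> dens_class \<alpha> r L" and tail: "exp_tail \<alpha> r a < \<infinity>"
  shows "integrable lborel (fourier_tail f a)"
proof (rule integrableI_bounded)
  have fp: "prob_density f" and "fourier_energy \<alpha> r f < \<infinity>"
    using f by (auto simp: dens_class_iff intro: order_le_less_trans)
  then have "fourier_energy \<alpha> r f * exp_tail \<alpha> r a < \<infinity>" using tail by (simp add: ennreal_mult_less_top)
  then have "(\<integral>\<^sup>+u. ennreal (cmod (fourier_tail f a u)) \<partial>lborel)\<^sup>2 < \<infinity>"
    using nn_integral_norm_fourier_tail_le[OF fp] by (rule order_le_less_trans[rotated])
  then show "(\<integral>\<^sup>+u. ennreal (cmod (fourier_tail f a u)) \<partial>lborel) < \<infinity>"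
    by (auto simp: power2_eq_square ennreal_mult_less_top)
  show "fourier_tail f a \<in> borel_measurable lborel" using borel_measurable_fourier_tail[OF fp] by simp
qed

lemma norm_cfourier_fourier_tail_square_le:
  assumes f: "f \<in> dens_class \<alpha> r L" and "exp_tail \<alpha> r a < \<infinity>"
  shows "ennreal ((cmod (cfourier (fourier_tail f a) y))\<^sup>2) \<le> ennreal (2 * pi * L) * exp_tail \<alpha> r a"
proof -
  have fp: "prob_density f" using f by (simp add: dens_class_iff)
  note tail = integrable_fourier_tail[OF assms]
  have "ennreal ((cmod (cfourier (fourier_tail f a) y))\<^sup>2)
      \<le> (ennreal (LINT u|lborel. cmod (fourier_tail f a u)))\<^sup>2"
    by (simp add: ennreal_power power_mono norm_cfourier_le ennreal_leI)
  also have "\<dots> = (\<integral>\<^sup>+u. ennreal (cmod (fourier_tail f a u)) \<partial>lborel)\<^sup>2"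
    using tail by (subst nn_integral_eq_integral) auto
  also have "\<dots> \<le> fourier_energy \<alpha> r f * exp_tail \<alpha> r a" by (rule nn_integral_norm_fourier_tail_le[OF fp])
  also have "\<dots> \<le> ennreal (2 * pi * L) * exp_tail \<alpha> r a" using f
    by (intro mult_right_mono) (auto simp: dens_class_iff)
  finally show ?thesis .
qed

lemma truncated_fourier_inversion:
  assumes f: "prob_density f" "continuous_on UNIV f" and tail: "integrable lborel (fourier_tail f a)"
  shows "(LINT u|lborel. indicator {-a..a} u * fourier f u * cis (- (u * x))) - 2 * pi * f x
    = - cfourier (fourier_tail f a) (- x)"
proof -
  let ?head = "\<lambda>u. indicator {-a..a} u * fourier f u"
  have head: "integrable lborel ?head"
  proof (rule Bochner_Integration.integrable_bound)
    show "integrable lborel (indicator {-a..a} :: real \<Rightarrow> real)" by (cases "-a \<le> a") auto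
    show "AE u in lborel. cmod (?head u) \<le> norm (indicator {-a..a} u :: real)"
      using norm_fourier_prob_density_le[OF f(1)] by (auto simp: indicator_def)
  qed (use borel_measurable_fourier_prob_density[OF f(1)] in measurable)
  have split: "fourier f = (\<lambda>u. ?head u + fourier_tail f a u)"
    by (auto simp: fourier_tail_def indicator_def abs_le_iff fun_eq_iff)
  have whole: "integrable lborel (fourier f)"
    by (subst split) (intro Bochner_Integration.integrable_add head tail)
  have "isCont (\<lambda>x. complex_of_real (f x)) x"
    using f(2) by (intro continuous_intros) (auto simp: continuous_on_eq_continuous_at)
  then have whole_inversion: "cfourier (fourier f) (- x) = complex_of_real (2 * pi * f x)"
    using fourier_inversion[of "\<lambda>x. complex_of_real (f x)" x] f(1) whole
    by (simp add: prob_densityD fourier_eq_cfourier)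
  have "cfourier (fourier f) (- x)
      = (LINT u|lborel. ?head u * cis (u * - x) + fourier_tail f a u * cis (u * - x))"
    unfolding cfourier_def
    by (intro Bochner_Integration.integral_cong refl)
      (simp only: distrib_right[symmetric] split[THEN fun_cong, symmetric])
  also have "\<dots> = (LINT u|lborel. ?head u * cis (u * - x)) + cfourier (fourier_tail f a) (- x)"
    unfolding cfourier_def by (intro Bochner_Integration.integral_add integrable_mult_cis head tail) auto
  finally show ?thesis unfolding whole_inversion[symmetric] by simp
qed

subsection \<open>The deconvolution kernel\<close>

definition deconv_kernel :: "(real \<Rightarrow> real) \<Rightarrow> real \<Rightarrow> real \<Rightarrow> complex" where
  "deconv_kernel fe a z = cfourier (\<lambda>u. indicator {-a..a} u / fourier fe u) (- z) / (2 * pi)"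

lemma dkernel_eq_deconv_kernel:
  assumes "0 < h"
  shows "dkernel fe h (z / h) / h = deconv_kernel fe (1 / h) z"
proof -
  have ind: "indicator {- (1 / h)..1 / h} (u / h) = (indicator {-1..1} u :: complex)" for u
    using assms by (simp add: indicator_def field_simps)
  show ?thesis
    unfolding dkernel_def deconv_kernel_def cfourier_def
    using assms by (subst lborel_integral_real_affine[where c="1 / h" and t=0])
      (auto simp: ind scaleR_conv_of_real mult_ac of_real_indicator)
qed

lemma kernel_est_eq_empirical_mean:
  assumes "0 < h"
  shows "kernel_est fe n h Y x = (\<Sum>i<n. Re (deconv_kernel fe (1 / h) (x - Y i))) / real n"
proof -
  have "(\<Sum>i<n. dkernel fe h ((x - Y i) / h)) / complex_of_real (real n * h)
     = (\<Sum>i<n. dkernel fe h ((x - Y i) / h) / h) / complex_of_real (real n)"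
    by (simp add: sum_divide_distrib mult.commute)
  then show ?thesis
    unfolding kernel_est_def by (simp add: dkernel_eq_deconv_kernel[OF assms] Re_divide_of_real)
qed

locale deconvolution =
  fixes fe :: "real \<Rightarrow> real" and h M :: real
  assumes noise: "prob_density fe" and noise_nonzero: "\<And>u. fourier fe u \<noteq> 0" and bandwidth: "0 < h"
    and inverse_noise_le: "\<And>u. \<bar>u\<bar> \<le> 1 / h \<Longrightarrow> 1 / cmod (fourier fe u) \<le> M"
begin

abbreviation "a \<equiv> 1 / h"

abbreviation truncated_inverse :: "real \<Rightarrow> complex" where
  "truncated_inverse u \<equiv> indicator {-a..a} u / fourier fe u"

abbreviation K :: "real \<Rightarrow> complex" where "K \<equiv> deconv_kernel fe a"

lemma norm_truncated_inverse_le: "cmod (truncated_inverse u) \<le> M * indicator {-a..a} u"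
  using inverse_noise_le[of u] by (auto simp: indicator_def norm_divide)

lemma integrable_truncated_inverse: "integrable lborel truncated_inverse"
proof (rule Bochner_Integration.integrable_bound)
  show "integrable lborel (\<lambda>u. M * indicator {-a..a} u)" using bandwidth by auto
  show "AE u in lborel. cmod (truncated_inverse u) \<le> norm (M * indicator {-a..a} u)"
    using norm_truncated_inverse_le by (intro AE_I2) (auto intro: order_trans[OF _ abs_ge_self])
qed (use borel_measurable_fourier_prob_density[OF noise] in measurable)

lemma borel_measurable_deconv_kernel: "K \<in> borel_measurable borel"
  unfolding deconv_kernel_def using borel_measurable_cfourier[OF integrable_truncated_inverse] by measurable

lemma norm_deconv_kernel_le: "cmod (K z) \<le> a * M / pi"
proof -
  have "cmod (cfourier truncated_inverse (- z)) \<le> (LINT u|lborel. cmod (truncated_inverse u))"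
    by (rule norm_cfourier_le)
  also have "\<dots> \<le> (LINT u|lborel. M * indicator {-a..a} u)"
    using integrable_truncated_inverse bandwidth by (intro integral_mono norm_truncated_inverse_le) auto
  also have "\<dots> = 2 * a * M" using bandwidth by simp
  finally show ?thesis unfolding deconv_kernel_def by (simp add: norm_divide field_simps)
qed

lemma nn_integral_deconv_kernel_square_le: "(\<integral>\<^sup>+z. ennreal ((cmod (K z))\<^sup>2) \<partial>lborel) \<le> ennreal (a * M\<^sup>2 / pi)"
proof -
  let ?F = "cfourier truncated_inverse"
  have [measurable]: "?F \<in> borel_measurable borel"
    by (rule borel_measurable_cfourier[OF integrable_truncated_inverse])
  have "(\<integral>\<^sup>+z. ennreal ((cmod (K z))\<^sup>2) \<partial>lborel)
      = (\<integral>\<^sup>+z. ennreal (1 / (2 * pi)\<^sup>2) * ennreal ((cmod (?F (- z)))\<^sup>2) \<partial>lborel)"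
    unfolding deconv_kernel_def
    by (intro nn_integral_cong) (simp add: norm_divide power_divide norm_mult flip: ennreal_mult)
  also have "\<dots> = ennreal (1 / (2 * pi)\<^sup>2) * (\<integral>\<^sup>+z. ennreal ((cmod (?F z))\<^sup>2) \<partial>lborel)"
    by (simp add: nn_integral_cmult nn_integral_lborel_minus[of "\<lambda>z. ennreal ((cmod (?F z))\<^sup>2)"])
  also have "(\<integral>\<^sup>+z. ennreal ((cmod (?F z))\<^sup>2) \<partial>lborel)
      \<le> ennreal (2 * pi) * (\<integral>\<^sup>+u. ennreal ((cmod (truncated_inverse u))\<^sup>2) \<partial>lborel)"
    by (rule plancherel_le[OF integrable_truncated_inverse])
  also have "(\<integral>\<^sup>+u. ennreal ((cmod (truncated_inverse u))\<^sup>2) \<partial>lborel)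
      \<le> (\<integral>\<^sup>+u. ennreal (M\<^sup>2) * indicator {-a..a} u \<partial>lborel)"
  proof (intro nn_integral_mono)
    fix u show "ennreal ((cmod (truncated_inverse u))\<^sup>2) \<le> ennreal (M\<^sup>2) * indicator {-a..a} u"
      using power_mono[OF norm_truncated_inverse_le[of u] norm_ge_zero, of 2]
      by (auto simp: power_mult_distrib intro!: ennreal_leI split: split_indicator)
  qed
  also have "\<dots> = ennreal (2 * a * M\<^sup>2)"
    using bandwidth by (simp add: nn_integral_cmult_indicator ennreal_mult'[symmetric] mult_ac)
  finally have "(\<integral>\<^sup>+z. ennreal ((cmod (K z))\<^sup>2) \<partial>lborel)
      \<le> ennreal (1 / (2 * pi)\<^sup>2) * (ennreal (2 * pi) * ennreal (2 * a * M\<^sup>2))"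
    by (simp add: mult_left_mono)
  also have "\<dots> = ennreal (a * M\<^sup>2 / pi)"
    using bandwidth by (simp add: ennreal_mult[symmetric] power2_eq_square)
  finally show ?thesis .
qed

lemma expectation_deconv_kernel:
  assumes f: "prob_density f"
  shows "(LINT y|law_Y f fe. K (x - y))
    = (LINT u|lborel. indicator {-a..a} u * fourier f u * cis (- (u * x))) / (2 * pi)"
proof -
  interpret Q: prob_space "law_Y f fe" by (rule prob_space_law_Y[OF f noise])
  interpret LQ: pair_sigma_finite lborel "law_Y f fe" ..
  have "(LINT y|law_Y f fe. LINT u|lborel. truncated_inverse u * 1 * cis (u * (y - x)))
      = (LINT u|lborel. LINT y|law_Y f fe. truncated_inverse u * 1 * cis (u * (y - x)))"
    by (rule LQ.Fubini_mult_bounded) (use integrable_truncated_inverse in auto)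
  also have "\<dots> = (LINT u|lborel. LINT y|law_Y f fe. truncated_inverse u * cis (- (u * x)) * cis (u * y))"
  proof -
    have "cis (u * (y - x)) = cis (- (u * x)) * cis (u * y)" for u y by (simp add: cis_mult algebra_simps)
    then show ?thesis by (simp add: mult.assoc)
  qed
  also have "\<dots> = (LINT u|lborel. indicator {-a..a} u * fourier f u * cis (- (u * x)))"
    by (intro Bochner_Integration.integral_cong refl) (simp add: integral_cis_law_Y[OF f noise] noise_nonzero)
  finally show ?thesis by (simp add: deconv_kernel_def cfourier_def)
qed

subsection \<open>Risk bounds\<close>

lemma kernel_est_in_estimators: "(\<lambda>Y z. kernel_est fe n h Y z) \<in> estimators n"
proof -
  note [measurable] = borel_measurable_deconv_kernel
  show ?thesis unfolding estimators_def kernel_est_eq_empirical_mean[OF bandwidth] by simp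
qed

lemma bias_deconv_kernel:
  assumes f: "f \<in> dens_class \<alpha> r L" and tail: "exp_tail \<alpha> r a < \<infinity>"
  shows "(LINT y|law_Y f fe. K (x - y)) - f x = - cfourier (fourier_tail f a) (- x) / (2 * pi)"
proof -
  have fp: "prob_density f" "continuous_on UNIV f" using f by (auto simp: dens_class_iff)
  show ?thesis
    unfolding expectation_deconv_kernel[OF fp(1)]
        truncated_fourier_inversion[OF fp integrable_fourier_tail[OF assms], symmetric]
    by (simp add: diff_divide_distrib)
qed

lemma kernel_est_mse_le:
  assumes f: "f \<in> dens_class \<alpha> r L" and tail: "exp_tail \<alpha> r a < \<infinity>" and n: "0 < n"
  shows "(\<integral>\<^sup>+Y. ennreal ((kernel_est fe n h Y x - f x)\<^sup>2) \<partial>sample_law f fe n)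
    \<le> ennreal (1 / real n) * (\<integral>\<^sup>+y. ennreal ((cmod (K (x - y)))\<^sup>2) \<partial>law_Y f fe)
      + ennreal (1 / (2 * pi)\<^sup>2) * ennreal ((cmod (cfourier (fourier_tail f a) (- x)))\<^sup>2)"
proof -
  have fp: "prob_density f" using f by (simp add: dens_class_iff)
  note [measurable] = borel_measurable_deconv_kernel
  interpret Q: prob_space "law_Y f fe" by (rule prob_space_law_Y[OF fp noise])
  let ?R = "\<lambda>y. Re (K (x - y))"
  have "integrable (law_Y f fe) (\<lambda>y. K (x - y))"
    by (rule Q.integrable_const_bound[OF AE_I2[OF norm_deconv_kernel_le]]) measurable
  then have "(LINT y|law_Y f fe. ?R y) - f x = Re ((LINT y|law_Y f fe. K (x - y)) - f x)" by simp
  also have "\<bar>\<dots>\<bar> \<le> cmod (cfourier (fourier_tail f a) (- x)) / (2 * pi)"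
    unfolding bias_deconv_kernel[OF f tail]
    by (rule order_trans[OF abs_Re_le_cmod]) (simp add: norm_divide norm_mult)
  finally have bias: "((LINT y|law_Y f fe. ?R y) - f x)\<^sup>2
      \<le> (cmod (cfourier (fourier_tail f a) (- x)) / (2 * pi))\<^sup>2"
    by (rule power2_le_iff_abs_le[THEN iffD2, rotated]) simp
  have square: "(?R y)\<^sup>2 \<le> (cmod (K (x - y)))\<^sup>2" for y
    using abs_Re_le_cmod[of "K (x - y)"] by (simp add: abs_le_square_iff[symmetric])
  have "(?R y)\<^sup>2 \<le> (a * M / pi)\<^sup>2" for y
    using square power_mono[OF norm_deconv_kernel_le norm_ge_zero] by (rule order_trans)
  then have "integrable (law_Y f fe) (\<lambda>y. (?R y)\<^sup>2)"
    by (intro Q.integrable_const_bound[of _ "(a * M / pi)\<^sup>2"]) auto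
  then have "(\<integral>\<^sup>+Y. ennreal ((kernel_est fe n h Y x - f x)\<^sup>2) \<partial>sample_law f fe n)
     \<le> ennreal (1 / real n) * (\<integral>\<^sup>+y. ennreal ((?R y)\<^sup>2) \<partial>law_Y f fe)
         + ennreal (((LINT y|law_Y f fe. ?R y) - f x)\<^sup>2)"
    unfolding kernel_est_eq_empirical_mean[OF bandwidth] sample_law_def
    by (intro mean_square_error_empirical_mean_le Q.prob_space_axioms n) measurable
  also have "\<dots> \<le> ennreal (1 / real n) * (\<integral>\<^sup>+y. ennreal ((cmod (K (x - y)))\<^sup>2) \<partial>law_Y f fe)
      + ennreal ((cmod (cfourier (fourier_tail f a) (- x)) / (2 * pi))\<^sup>2)"
    by (intro add_mono mult_left_mono nn_integral_mono ennreal_leI square bias) auto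
  finally show ?thesis by (simp add: power_divide ennreal_mult'[symmetric])
qed

lemma risk_pt_kernel_est_le:
  assumes tail: "exp_tail \<alpha> r a < \<infinity>" and n: "0 < n"
  shows "risk_pt fe \<alpha> r L n x (\<lambda>Y z. kernel_est fe n h Y z)
    \<le> ennreal ((a * M / pi)\<^sup>2 / real n) + ennreal (L / (2 * pi)) * exp_tail \<alpha> r a"
  unfolding risk_pt_def
proof (rule SUP_least)
  fix f assume f: "f \<in> dens_class \<alpha> r L"
  then have fp: "prob_density f" by (simp add: dens_class_iff)
  interpret Q: prob_space "law_Y f fe" by (rule prob_space_law_Y[OF fp noise])
  have "(\<integral>\<^sup>+y. ennreal ((cmod (K (x - y)))\<^sup>2) \<partial>law_Y f fe) \<le> (\<integral>\<^sup>+y. ennreal ((a * M / pi)\<^sup>2) \<partial>law_Y f fe)"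
    by (intro nn_integral_mono ennreal_leI power_mono norm_deconv_kernel_le) auto
  also have "\<dots> = ennreal ((a * M / pi)\<^sup>2)" using Q.emeasure_space_1 by simp
  finally have "(\<integral>\<^sup>+Y. ennreal ((kernel_est fe n h Y x - f x)\<^sup>2) \<partial>sample_law f fe n)
      \<le> ennreal (1 / real n) * ennreal ((a * M / pi)\<^sup>2)
          + ennreal (1 / (2 * pi)\<^sup>2) * (ennreal (2 * pi * L) * exp_tail \<alpha> r a)"
    by (intro order_trans[OF kernel_est_mse_le[OF f tail n]] add_mono mult_left_mono
        norm_cfourier_fourier_tail_square_le[OF f tail]) auto
  also have "ennreal (1 / (2 * pi)\<^sup>2) * (ennreal (2 * pi * L) * exp_tail \<alpha> r a)
      = ennreal (L / (2 * pi)) * exp_tail \<alpha> r a"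
    by (simp add: mult.assoc[symmetric] ennreal_mult'[symmetric] power2_eq_square)
  finally show "(\<integral>\<^sup>+Y. ennreal ((kernel_est fe n h Y x - f x)\<^sup>2) \<partial>sample_law f fe n)
      \<le> ennreal ((a * M / pi)\<^sup>2 / real n) + ennreal (L / (2 * pi)) * exp_tail \<alpha> r a"
    by (simp add: ennreal_mult'[symmetric])
qed

lemma integrated_variance_le:
  assumes f: "prob_density f"
  shows "(\<integral>\<^sup>+z. \<integral>\<^sup>+y. ennreal ((cmod (K (z - y)))\<^sup>2) \<partial>law_Y f fe \<partial>lborel) \<le> ennreal (a * M\<^sup>2 / pi)"
proof -
  note [measurable] = borel_measurable_deconv_kernel
  interpret Q: prob_space "law_Y f fe" by (rule prob_space_law_Y[OF f noise])
  interpret LQ: pair_sigma_finite "law_Y f fe" lborel ..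
  have "(\<integral>\<^sup>+z. \<integral>\<^sup>+y. ennreal ((cmod (K (z - y)))\<^sup>2) \<partial>law_Y f fe \<partial>lborel)
      = (\<integral>\<^sup>+y. \<integral>\<^sup>+z. ennreal ((cmod (K (z - y)))\<^sup>2) \<partial>lborel \<partial>law_Y f fe)"
    by (rule LQ.Fubini') measurable
  also have "\<dots> = (\<integral>\<^sup>+y. \<integral>\<^sup>+z. ennreal ((cmod (K z))\<^sup>2) \<partial>lborel \<partial>law_Y f fe)"
    by (intro nn_integral_cong nn_integral_lborel_shift) measurable
  also have "\<dots> \<le> ennreal (a * M\<^sup>2 / pi)"
    using Q.emeasure_space_1 nn_integral_deconv_kernel_square_le by simp
  finally show ?thesis .
qed

lemma integrated_squared_bias_le:
  assumes f: "f \<in> dens_class \<alpha> r L" and tail: "exp_tail \<alpha> r a < \<infinity>" and "0 \<le> \<alpha>" "0 \<le> r"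
  shows "(\<integral>\<^sup>+z. ennreal ((cmod (cfourier (fourier_tail f a) (- z)))\<^sup>2) \<partial>lborel)
    \<le> ennreal ((2 * pi)\<^sup>2) * ennreal (L * exp (- 2 * \<alpha> * a powr r))"
proof -
  have fp: "prob_density f" using f by (simp add: dens_class_iff)
  note T = integrable_fourier_tail[OF f tail]
  note [measurable] = borel_measurable_cfourier[OF T]
  have "(\<integral>\<^sup>+z. ennreal ((cmod (cfourier (fourier_tail f a) (- z)))\<^sup>2) \<partial>lborel)
      = (\<integral>\<^sup>+z. ennreal ((cmod (cfourier (fourier_tail f a) z))\<^sup>2) \<partial>lborel)"
    by (rule nn_integral_lborel_minus) measurable
  also have "\<dots> \<le> ennreal (2 * pi) * (\<integral>\<^sup>+u. ennreal ((cmod (fourier_tail f a u))\<^sup>2) \<partial>lborel)"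
    by (rule plancherel_le[OF T])
  also have "\<dots> \<le> ennreal (2 * pi) * (ennreal (exp (- 2 * \<alpha> * a powr r)) * fourier_energy \<alpha> r f)"
    using fp assms bandwidth by (intro mult_left_mono nn_integral_norm_fourier_tail_square_le) auto
  also have "\<dots> \<le> ennreal (2 * pi) * (ennreal (exp (- 2 * \<alpha> * a powr r)) * ennreal (2 * pi * L))"
    using f by (intro mult_left_mono) (auto simp: dens_class_iff)
  also have "\<dots> = ennreal ((2 * pi)\<^sup>2) * ennreal (L * exp (- 2 * \<alpha> * a powr r))"
    by (simp add: ennreal_mult' ennreal_mult'' power2_eq_square mult_ac)
  finally show ?thesis .
qed

lemma risk_L2_kernel_est_le:
  assumes tail: "exp_tail \<alpha> r a < \<infinity>" and "0 \<le> \<alpha>" "0 \<le> r" and n: "0 < n"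
  shows "risk_L2 fe \<alpha> r L n (\<lambda>Y z. kernel_est fe n h Y z)
    \<le> ennreal (a * M\<^sup>2 / pi / real n) + ennreal (L * exp (- 2 * \<alpha> * a powr r))"
  unfolding risk_L2_def
proof (rule SUP_least)
  fix f assume f: "f \<in> dens_class \<alpha> r L"
  then have fp: "prob_density f" by (simp add: dens_class_iff)
  note [measurable] = borel_measurable_deconv_kernel prob_densityD(1)[OF fp]
    borel_measurable_cfourier[OF integrable_fourier_tail[OF f tail]]
  interpret Q: prob_space "law_Y f fe" by (rule prob_space_law_Y[OF fp noise])
  interpret P: product_prob_space "\<lambda>_. law_Y f fe" "{..<n}" ..
  let ?P = "sample_law f fe n" and ?b = "\<lambda>z. ennreal ((cmod (cfourier (fourier_tail f a) (- z)))\<^sup>2)"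
  interpret PQ: pair_sigma_finite ?P lborel unfolding sample_law_def by standard
  have "(\<integral>\<^sup>+Y. (\<integral>\<^sup>+z. ennreal ((kernel_est fe n h Y z - f z)\<^sup>2) \<partial>lborel) \<partial>?P)
      = (\<integral>\<^sup>+z. (\<integral>\<^sup>+Y. ennreal ((kernel_est fe n h Y z - f z)\<^sup>2) \<partial>?P) \<partial>lborel)"
    by (rule PQ.Fubini'[symmetric]) (simp add: kernel_est_eq_empirical_mean[OF bandwidth] sample_law_def)
  also have "\<dots> \<le> (\<integral>\<^sup>+z. ennreal (1 / real n) * (\<integral>\<^sup>+y. ennreal ((cmod (K (z - y)))\<^sup>2) \<partial>law_Y f fe)
      + ennreal (1 / (2 * pi)\<^sup>2) * ?b z \<partial>lborel)"
    by (intro nn_integral_mono kernel_est_mse_le[OF f tail n])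
  also have "\<dots> = ennreal (1 / real n) * (\<integral>\<^sup>+z. \<integral>\<^sup>+y. ennreal ((cmod (K (z - y)))\<^sup>2) \<partial>law_Y f fe \<partial>lborel)
      + ennreal (1 / (2 * pi)\<^sup>2) * (\<integral>\<^sup>+z. ?b z \<partial>lborel)"
    by (subst nn_integral_add, measurable)
      (subst nn_integral_cmult, measurable, subst nn_integral_cmult, measurable)
  also have "\<dots> \<le> ennreal (1 / real n) * ennreal (a * M\<^sup>2 / pi)
      + ennreal (1 / (2 * pi)\<^sup>2) * (ennreal ((2 * pi)\<^sup>2) * ennreal (L * exp (- 2 * \<alpha> * a powr r)))"
    by (intro add_mono mult_left_mono integrated_variance_le[OF fp] integrated_squared_bias_le[OF f tail]
        assms) auto
  also have "\<dots> = ennreal (a * M\<^sup>2 / pi / real n) + ennreal (L * exp (- 2 * \<alpha> * a powr r))"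
    by (simp add: mult.assoc[symmetric] ennreal_mult'[symmetric], simp add: mult_ac)
  finally show "(\<integral>\<^sup>+Y. (\<integral>\<^sup>+z. ennreal ((kernel_est fe n h Y z - f z)\<^sup>2) \<partial>lborel) \<partial>?P)
      \<le> ennreal (a * M\<^sup>2 / pi / real n) + ennreal (L * exp (- 2 * \<alpha> * a powr r))" .
qed

end

section \<open>Two-point lower bound\<close>

subsection \<open>Product laws with bounded likelihood ratio\<close>

lemma indicator_PiE_eq_prod:
  assumes "finite I" "Y \<in> extensional I"
  shows "indicator (Pi\<^sub>E I A) Y = (\<Prod>i\<in>I. indicator (A i) (Y i) :: ennreal)"
proof (cases "Y \<in> Pi\<^sub>E I A")
  case False
  then obtain i where "i \<in> I" "Y i \<notin> A i" using assms(2) by (auto simp: PiE_def)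
  then show ?thesis using False assms(1) by (auto simp: prod_zero_iff indicator_def)
qed (auto simp: PiE_iff)

lemma PiM_density:
  fixes M :: "'i \<Rightarrow> 'a measure" and l :: "'i \<Rightarrow> 'a \<Rightarrow> ennreal"
  assumes M: "product_sigma_finite M" and D: "product_sigma_finite (\<lambda>i. density (M i) (l i))"
    and [measurable]: "\<And>i. l i \<in> borel_measurable (M i)" and I: "finite I"
  shows "PiM I (\<lambda>i. density (M i) (l i)) = density (PiM I M) (\<lambda>Y. \<Prod>i\<in>I. l i (Y i))"
proof -
  interpret M: product_sigma_finite M by fact
  interpret D: product_sigma_finite "\<lambda>i. density (M i) (l i)" by fact
  show ?thesis
  proof (rule D.PiM_eqI[OF I, symmetric])
    show "sets (density (PiM I M) (\<lambda>Y. \<Prod>i\<in>I. l i (Y i))) = sets (PiM I (\<lambda>i. density (M i) (l i)))"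
      by (auto intro!: sets_PiM_cong)
    fix A :: "'i \<Rightarrow> 'a set" assume "\<And>i. i \<in> I \<Longrightarrow> A i \<in> sets (density (M i) (l i))"
    then have A[measurable]: "\<And>i. i \<in> I \<Longrightarrow> A i \<in> sets (M i)" by simp
    have "emeasure (density (PiM I M) (\<lambda>Y. \<Prod>i\<in>I. l i (Y i))) (Pi\<^sub>E I A)
        = (\<integral>\<^sup>+Y. (\<Prod>i\<in>I. l i (Y i)) * indicator (Pi\<^sub>E I A) Y \<partial>PiM I M)"
      using A I by (intro emeasure_density sets_PiM_I_finite) auto
    also have "\<dots> = (\<integral>\<^sup>+Y. (\<Prod>i\<in>I. l i (Y i) * indicator (A i) (Y i)) \<partial>PiM I M)"
      using I by (intro nn_integral_cong) (auto simp: space_PiM PiE_iff indicator_PiE_eq_prod prod.distrib)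
    also have "\<dots> = (\<Prod>i\<in>I. \<integral>\<^sup>+y. l i y * indicator (A i) y \<partial>M i)"
      using A by (intro M.product_nn_integral_prod I) auto
    also have "\<dots> = (\<Prod>i\<in>I. emeasure (density (M i) (l i)) (A i))"
      using A by (intro prod.cong refl emeasure_density[symmetric]) auto
    finally show "emeasure (density (PiM I M) (\<lambda>Y. \<Prod>i\<in>I. l i (Y i))) (Pi\<^sub>E I A)
        = (\<Prod>i\<in>I. emeasure (density (M i) (l i)) (A i))" .
  qed
qed

lemma emeasure_density_one_plus:
  assumes Q: "prob_space Q" and [measurable]: "g \<in> borel_measurable Q" and bounded: "\<And>y. \<bar>g y\<bar> \<le> (1::real)"
  shows "emeasure (density Q (\<lambda>y. ennreal (1 + g y))) (space Q) = ennreal (1 + (LINT y|Q. g y))"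
proof -
  interpret Q: prob_space Q by fact
  have g: "integrable Q g" by (rule Q.integrable_const_bound[where B=1]) (use bounded in auto)
  have "0 \<le> 1 + g y" for y using bounded[of y] by linarith
  then have "(\<integral>\<^sup>+y. ennreal (1 + g y) \<partial>Q) = ennreal (LINT y|Q. 1 + g y)"
    using g by (intro nn_integral_eq_integral) auto
  moreover have "emeasure (density Q (\<lambda>y. ennreal (1 + g y))) (space Q) = (\<integral>\<^sup>+y. ennreal (1 + g y) \<partial>Q)"
    by (subst emeasure_density) (auto intro!: nn_integral_cong)
  ultimately show ?thesis using g by (simp add: Q.prob_space)
qed

lemma prob_space_density_one_plus:
  assumes "prob_space Q" "g \<in> borel_measurable Q" "\<And>y. \<bar>g y\<bar> \<le> (1::real)" and "(LINT y|Q. g y) = 0"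
  shows "prob_space (density Q (\<lambda>y. ennreal (1 + g y)))"
  using emeasure_density_one_plus[OF assms(1-3)] assms(4) by (intro prob_spaceI) simp

lemma integral_eq_zero_if_prob_space_density_one_plus:
  assumes "prob_space Q" "g \<in> borel_measurable Q" "\<And>y. \<bar>g y\<bar> \<le> (1::real)"
    and "prob_space (density Q (\<lambda>y. ennreal (1 + g y)))"
  shows "(LINT y|Q. g y) = 0"
  using emeasure_density_one_plus[OF assms(1-3)] prob_space.emeasure_space_1[OF assms(4)] by simp

lemma integral_abs_likelihood_ratio_le:
  fixes g :: "'a \<Rightarrow> real"
  assumes Q: "prob_space Q" and [measurable]: "g \<in> borel_measurable Q"
    and bounded: "\<And>y. \<bar>g y\<bar> \<le> 1" and centered: "(LINT y|Q. g y) = 0"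
  shows "integrable (PiM {..<n::nat} (\<lambda>_. Q)) (\<lambda>Y. \<bar>(\<Prod>i<n. 1 + g (Y i)) - 1\<bar>)"
    and "(LINT Y|PiM {..<n} (\<lambda>_. Q). \<bar>(\<Prod>i<n. 1 + g (Y i)) - 1\<bar>) \<le> sqrt ((1 + (LINT y|Q. (g y)\<^sup>2)) ^ n - 1)"
proof -
  interpret Q: prob_space Q by fact
  interpret PQ: product_sigma_finite "\<lambda>_::nat. Q" ..
  let ?P = "PiM {..<n} (\<lambda>_. Q)"
  interpret P: prob_space ?P by (intro prob_space_PiM Q)
  let ?l = "\<lambda>Y. \<Prod>i<n. 1 + g (Y i)"
  have g: "integrable Q g" by (rule Q.integrable_const_bound[where B=1]) (use bounded in auto)
  have g2: "integrable Q (\<lambda>y. (g y)\<^sup>2)"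
    by (rule Q.integrable_const_bound[where B=1]) (use bounded in \<open>auto simp: abs_square_le_1\<close>)
  have l: "integrable ?P ?l" and El: "(LINT Y|?P. ?l Y) = 1"
    using PQ.product_integrable_prod[of "{..<n}" "\<lambda>_ y. 1 + g y"]
      PQ.product_integral_prod[of "{..<n}" "\<lambda>_ y. 1 + g y"] g centered by (auto simp: Q.prob_space)
  have square: "(1 + g y)\<^sup>2 = 1 + 2 * g y + (g y)\<^sup>2" for y by (simp add: power2_eq_square algebra_simps)
  have l2: "integrable ?P (\<lambda>Y. (?l Y)\<^sup>2)" and El2: "(LINT Y|?P. (?l Y)\<^sup>2) = (1 + (LINT y|Q. (g y)\<^sup>2)) ^ n"
    unfolding prod_power_distrib square
    using PQ.product_integrable_prod[of "{..<n}" "\<lambda>_ y. 1 + 2 * g y + (g y)\<^sup>2"]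
      PQ.product_integral_prod[of "{..<n}" "\<lambda>_ y. 1 + 2 * g y + (g y)\<^sup>2"] g g2 centered by (auto simp: Q.prob_space)
  show abs: "integrable ?P (\<lambda>Y. \<bar>?l Y - 1\<bar>)" using l by simp
  have expand: "\<bar>?l Y - 1\<bar>\<^sup>2 = (?l Y)\<^sup>2 - 2 * ?l Y + 1" for Y by (simp add: power2_eq_square algebra_simps)
  have abs2: "integrable ?P (\<lambda>Y. \<bar>?l Y - 1\<bar>\<^sup>2)" unfolding expand using l l2 by simp
  have "(LINT Y|?P. \<bar>?l Y - 1\<bar>\<^sup>2) = (1 + (LINT y|Q. (g y)\<^sup>2)) ^ n - 1"
    unfolding expand using l l2 by (simp add: El El2 P.prob_space)
  moreover have "(LINT Y|?P. \<bar>?l Y - 1\<bar>)\<^sup>2 \<le> (LINT Y|?P. \<bar>?l Y - 1\<bar>\<^sup>2)"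
    using P.variance_eq[OF abs abs2] P.variance_positive[of "\<lambda>Y. \<bar>?l Y - 1\<bar>"] by linarith
  ultimately show "(LINT Y|?P. \<bar>?l Y - 1\<bar>) \<le> sqrt ((1 + (LINT y|Q. (g y)\<^sup>2)) ^ n - 1)"
    by (intro real_le_rsqrt) simp
qed

lemma nn_integral_PiM_density_one_plus:
  fixes g :: "'a \<Rightarrow> real"
  assumes Q: "prob_space Q" and [measurable]: "g \<in> borel_measurable Q"
    and bounded: "\<And>y. \<bar>g y\<bar> \<le> 1" and centered: "(LINT y|Q. g y) = 0"
    and [measurable]: "W \<in> borel_measurable (PiM {..<n::nat} (\<lambda>_. Q))"
  shows "(\<integral>\<^sup>+Y. W Y \<partial>PiM {..<n} (\<lambda>_. density Q (\<lambda>y. ennreal (1 + g y))))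
    = (\<integral>\<^sup>+Y. ennreal (\<Prod>i<n. 1 + g (Y i)) * W Y \<partial>PiM {..<n} (\<lambda>_. Q))"
proof -
  interpret Q: prob_space Q by fact
  interpret D: prob_space "density Q (\<lambda>y. ennreal (1 + g y))" by (rule prob_space_density_one_plus) fact+
  have "0 \<le> 1 + g y" for y using bounded[of y] by linarith
  then show ?thesis
    by (subst PiM_density)
       (auto simp: nn_integral_density prod_ennreal
         intro: Q.sigma_finite_measure_axioms D.sigma_finite_measure_axioms product_sigma_finite.intro)
qed

lemma ennreal_integral_le_nn_integral:
  fixes f :: "'a \<Rightarrow> real"
  assumes f: "integrable M f" shows "ennreal (LINT x|M. f x) \<le> (\<integral>\<^sup>+x. ennreal (f x) \<partial>M)"
proof -
  have "(LINT x|M. f x) \<le> (LINT x|M. max 0 (f x))" using f by (intro integral_mono) auto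
  then have "ennreal (LINT x|M. f x) \<le> ennreal (LINT x|M. max 0 (f x))" by (rule ennreal_leI)
  also have "\<dots> = (\<integral>\<^sup>+x. ennreal (max 0 (f x)) \<partial>M)" using f by (intro nn_integral_eq_integral[symmetric]) auto
  also have "\<dots> = (\<integral>\<^sup>+x. ennreal (f x) \<partial>M)" by (intro nn_integral_cong) (auto simp: max_def ennreal_neg)
  finally show ?thesis .
qed

text \<open>A lower bound for the total mass of the minimum of two product laws on \<open>n\<close> observations whose densities
  \<open>1 \<plusminus> g\<close> are at chi-square distance \<open>\<kappa>\<close> from their average.\<close>

definition affinity_bound :: "real \<Rightarrow> nat \<Rightarrow> real" where
  "affinity_bound \<kappa> n = 1 - 2 * sqrt ((1 + \<kappa>) ^ n - 1)"

lemma affinity_bound_antimono: "0 \<le> \<kappa> \<Longrightarrow> \<kappa> \<le> \<kappa>' \<Longrightarrow> affinity_bound \<kappa>' n \<le> affinity_bound \<kappa> n"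
  unfolding affinity_bound_def by (simp add: power_mono)

lemma two_point_lower_bound:
  fixes g :: "'a \<Rightarrow> real" and W1 W2 :: "(nat \<Rightarrow> 'a) \<Rightarrow> ennreal"
  assumes Q: "prob_space Q" and [measurable]: "g \<in> borel_measurable Q"
    and bounded: "\<And>y. \<bar>g y\<bar> \<le> 1" and centered: "(LINT y|Q. g y) = 0"
    and [measurable]: "W1 \<in> borel_measurable (PiM {..<n} (\<lambda>_. Q))"
        "W2 \<in> borel_measurable (PiM {..<n} (\<lambda>_. Q))"
    and W: "\<And>Y. Y \<in> space (PiM {..<n} (\<lambda>_. Q)) \<Longrightarrow> ennreal d \<le> W1 Y + W2 Y" and d: "0 \<le> d"
  shows "ennreal (d * affinity_bound (LINT y|Q. (g y)\<^sup>2) n)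
    \<le> (\<integral>\<^sup>+Y. W1 Y \<partial>PiM {..<n} (\<lambda>_. density Q (\<lambda>y. ennreal (1 + g y))))
      + (\<integral>\<^sup>+Y. W2 Y \<partial>PiM {..<n} (\<lambda>_. density Q (\<lambda>y. ennreal (1 - g y))))"
proof -
  let ?P = "PiM {..<n} (\<lambda>_. Q)"
  interpret P: prob_space ?P by (intro prob_space_PiM Q)
  let ?l = "\<lambda>g Y. \<Prod>i<n. 1 + g (Y i)" and ?g' = "\<lambda>y. - g y"
  let ?overlap = "\<lambda>Y. 1 - \<bar>?l g Y - 1\<bar> - \<bar>?l ?g' Y - 1\<bar>"
  have bounded': "\<bar>?g' y\<bar> \<le> 1" for y using bounded[of y] by simp
  have centered': "(LINT y|Q. ?g' y) = 0" using centered by simp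
  note plus = integral_abs_likelihood_ratio_le[OF Q \<open>g \<in> _\<close> bounded centered, of n]
  note minus = integral_abs_likelihood_ratio_le[OF Q borel_measurable_uminus[OF \<open>g \<in> _\<close>] bounded' centered', of n]
  have "0 \<le> 1 + g y" "0 \<le> 1 + ?g' y" for y using bounded[of y] by linarith+
  then have pos: "0 \<le> ?l g Y" "0 \<le> ?l ?g' Y" for Y by (auto intro: prod_nonneg)
  have overlap: "integrable ?P (\<lambda>Y. d * ?overlap Y)"
    using plus(1) minus(1) by (intro integrable_mult_right Bochner_Integration.integrable_diff) auto
  have "affinity_bound (LINT y|Q. (g y)\<^sup>2) n \<le> (LINT Y|?P. ?overlap Y)"
    using plus minus by (simp add: affinity_bound_def P.prob_space)
  then have "ennreal (d * affinity_bound (LINT y|Q. (g y)\<^sup>2) n) \<le> ennreal (LINT Y|?P. d * ?overlap Y)"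
    using d by (simp add: ennreal_leI mult_left_mono)
  also have "\<dots> \<le> (\<integral>\<^sup>+Y. ennreal (d * ?overlap Y) \<partial>?P)" by (rule ennreal_integral_le_nn_integral[OF overlap])
  also have "\<dots> \<le> (\<integral>\<^sup>+Y. ennreal (?l g Y) * W1 Y + ennreal (?l ?g' Y) * W2 Y \<partial>?P)"
  proof (rule nn_integral_mono)
    fix Y assume Y: "Y \<in> space ?P"
    define k where "k = min (?l g Y) (?l ?g' Y)"
    have "0 \<le> k" "?overlap Y \<le> k" using pos[of Y] by (auto simp: k_def)
    then have "ennreal (d * ?overlap Y) \<le> ennreal k * ennreal d"
      using d by (subst ennreal_mult'[symmetric])
        (auto intro!: ennreal_leI mult_left_mono simp: mult.commute[of k])
    also have "\<dots> \<le> ennreal k * W1 Y + ennreal k * W2 Y"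
      unfolding distrib_left[symmetric] by (rule mult_left_mono[OF W[OF Y]]) simp
    also have "\<dots> \<le> ennreal (?l g Y) * W1 Y + ennreal (?l ?g' Y) * W2 Y"
      by (intro add_mono mult_right_mono ennreal_leI) (auto simp: k_def)
    finally show "ennreal (d * ?overlap Y) \<le> ennreal (?l g Y) * W1 Y + ennreal (?l ?g' Y) * W2 Y" .
  qed
  also have "\<dots> = (\<integral>\<^sup>+Y. ennreal (?l g Y) * W1 Y \<partial>?P) + (\<integral>\<^sup>+Y. ennreal (?l ?g' Y) * W2 Y \<partial>?P)"
    by (rule nn_integral_add) measurable
  finally show ?thesis
    using nn_integral_PiM_density_one_plus[OF Q _ bounded centered, of W1 n]
      nn_integral_PiM_density_one_plus[OF Q _ bounded' centered', of W2 n] by simp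
qed

subsection \<open>Convolution with the noise density\<close>

definition conv :: "(real \<Rightarrow> real) \<Rightarrow> (real \<Rightarrow> real) \<Rightarrow> real \<Rightarrow> real" where
  "conv f fe y = (LINT e|lborel. f (y - e) * fe e)"

lemma integrable_conv:
  assumes fe: "prob_density fe" and [measurable]: "f \<in> borel_measurable borel" and B: "\<And>y. \<bar>f y\<bar> \<le> B"
  shows "integrable lborel (\<lambda>e. f (y - e) * fe e)"
proof (rule Bochner_Integration.integrable_bound)
  show "integrable lborel (\<lambda>e. B * fe e)" using prob_densityD[OF fe] by simp
  have "0 \<le> B" using B[of 0] by linarith
  then show "AE e in lborel. norm (f (y - e) * fe e) \<le> norm (B * fe e)"
    using B prob_densityD(2)[OF fe] by (intro AE_I2) (simp add: abs_mult mult_right_mono)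
qed (use prob_densityD(1)[OF fe] in measurable)

lemma borel_measurable_conv:
  assumes fe: "prob_density fe" and [measurable]: "f \<in> borel_measurable borel"
  shows "conv f fe \<in> borel_measurable borel"
  using prob_densityD(1)[OF fe] unfolding conv_def by measurable

lemma conv_nonneg: "prob_density fe \<Longrightarrow> (\<And>y. 0 \<le> f y) \<Longrightarrow> 0 \<le> conv f fe y"
  unfolding conv_def by (intro integral_nonneg_AE AE_I2 mult_nonneg_nonneg) (auto intro: prob_densityD)

lemma conv_add:
  assumes "prob_density fe" "f \<in> borel_measurable borel" "\<And>y. \<bar>f y\<bar> \<le> B" "g \<in> borel_measurable borel"
      "\<And>y. \<bar>g y\<bar> \<le> C"
  shows "conv (\<lambda>y. f y + g y) fe y = conv f fe y + conv g fe y"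
  unfolding conv_def distrib_right
  using integrable_conv[OF assms(1-3)] integrable_conv[OF assms(1,4,5)]
  by (rule Bochner_Integration.integral_add)

lemma conv_uminus: "conv (\<lambda>y. - f y) fe y = - conv f fe y"
  by (simp add: conv_def)

lemma conv_shift: "conv (\<lambda>y. g (y - x)) fe y = conv g fe (y - x)"
  unfolding conv_def by (simp add: algebra_simps)

lemma law_Y_eq_density_conv:
  assumes f: "prob_density f" and fe: "prob_density fe" and B: "\<And>y. f y \<le> B"
  shows "law_Y f fe = density lborel (\<lambda>y. ennreal (conv f fe y))"
proof -
  note [measurable] = prob_densityD(1)[OF fe] prob_densityD(1)[OF f]
  have fin: "finite_measure (density lborel f)" "finite_measure (density lborel fe)"
    using prob_space_prob_density[OF f] prob_space_prob_density[OF fe] by (auto simp: prob_space_def)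
  have "\<bar>f y\<bar> \<le> B" for y using B[of y] prob_densityD(2)[OF f, of y] by simp
  then have "(\<integral>\<^sup>+e. ennreal (f (y - e)) * ennreal (fe e) \<partial>lborel) = ennreal (conv f fe y)" for y
    unfolding conv_def using prob_densityD(2)[OF f] prob_densityD(2)[OF fe]
    by (subst nn_integral_eq_integral[symmetric])
      (auto simp: ennreal_mult intro!: integrable_conv[OF fe, of f B])
  then show ?thesis unfolding law_Y_convolution by (subst convolution_density) (auto simp: fin)
qed

lemma law_Y_add_eq_density:
  assumes fe: "prob_density fe" and f: "prob_density f" "\<And>y. f y \<le> B"
    and G: "G \<in> borel_measurable borel" "\<And>y. \<bar>G y\<bar> \<le> B"
    and fG: "prob_density (\<lambda>y. f y + G y)" and pos: "\<And>y. 0 < conv f fe y"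
  shows "law_Y (\<lambda>y. f y + G y) fe = density (law_Y f fe) (\<lambda>y. ennreal (1 + conv G fe y / conv f fe y))"
proof -
  note [measurable] = borel_measurable_conv[OF fe] prob_densityD(1)[OF f(1)] G(1)
  have f_abs: "\<bar>f y\<bar> \<le> B" for y using f(2)[of y] prob_densityD(2)[OF f(1), of y] by simp
  have "conv (\<lambda>y. f y + G y) fe y = conv f fe y + conv G fe y" for y
    by (rule conv_add[OF fe prob_densityD(1)[OF f(1)] f_abs G])
  then have "conv (\<lambda>y. f y + G y) fe y = conv f fe y * (1 + conv G fe y / conv f fe y)" for y
    using pos[of y] by (simp add: distrib_left)
  then have "ennreal (conv (\<lambda>y. f y + G y) fe y)
      = ennreal (conv f fe y) * ennreal (1 + conv G fe y / conv f fe y)" for y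
    using pos[of y] by (simp add: ennreal_mult')
  moreover have "f y + G y \<le> 2 * B" for y using f(2)[of y] G(2)[of y] by linarith
  ultimately show ?thesis
    by (simp add: law_Y_eq_density_conv[OF fG fe, of "2 * B"] law_Y_eq_density_conv[OF f(1) fe f(2)]
        density_density_eq)
qed

lemma prob_density_tight:
  assumes fe: "prob_density fe"
  obtains m where "0 < m" "1 / 2 \<le> (LINT e|lborel. indicator {-m..m} e * fe e)"
proof -
  note [measurable] = prob_densityD(1)[OF fe]
  have "(\<lambda>n. LINT e|lborel. indicator {-real n..real n} e * fe e) \<longlonglongrightarrow> (LINT e|lborel. fe e)"
  proof (rule integral_dominated_convergence[where w=fe])
    show "AE e in lborel. (\<lambda>n. indicator {-real n..real n} e * fe e) \<longlonglongrightarrow> fe e"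
    proof (rule AE_I2)
      fix e
      obtain N where N: "\<bar>e\<bar> \<le> real N" using real_arch_simple by blast
      have "\<forall>\<^sub>F n in sequentially. indicator {-real n..real n} e * fe e = fe e"
        using eventually_ge_at_top[of N] by eventually_elim (use N in \<open>auto simp: indicator_def abs_le_iff\<close>)
      then show "(\<lambda>n. indicator {-real n..real n} e * fe e) \<longlonglongrightarrow> fe e" by (rule tendsto_eventually)
    qed
    show "AE e in lborel. norm (indicator {-real n..real n} e * fe e) \<le> fe e" for n
      using prob_densityD(2)[OF fe] by (intro AE_I2) (simp split: split_indicator)
  qed (use prob_densityD(3)[OF fe] in auto)
  then have "\<forall>\<^sub>F n in sequentially. 1 / 2 < (LINT e|lborel. indicator {-real n..real n} e * fe e)"
    using prob_densityD(4)[OF fe] by (intro order_tendstoD) auto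
  then obtain N where N: "\<And>n. N \<le> n \<Longrightarrow> 1 / 2 < (LINT e|lborel. indicator {-real n..real n} e * fe e)"
    unfolding eventually_sequentially by auto
  show ?thesis by (rule that[of "real (Suc N)"]) (use N[of "Suc N"] in auto)
qed

lemma one_plus_square_diff_le:
  fixes t e m :: real
  assumes "\<bar>e\<bar> \<le> m"
  shows "1 + (t - e)\<^sup>2 \<le> 2 * (1 + m\<^sup>2) * (1 + t\<^sup>2)"
proof -
  have "e\<^sup>2 \<le> m\<^sup>2" using assms by (simp add: power2_le_iff_abs_le)
  moreover have "(t - e)\<^sup>2 \<le> 2 * t\<^sup>2 + 2 * e\<^sup>2"
    using sum_squares_bound[of t "- e"] by (simp add: power2_eq_square algebra_simps)
  moreover have "2 * (1 + m\<^sup>2) * (1 + t\<^sup>2) = 2 + 2 * m\<^sup>2 + 2 * t\<^sup>2 + 2 * (m * t)\<^sup>2"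
    by (simp add: power_mult_distrib algebra_simps)
  ultimately show ?thesis using zero_le_power2[of "m * t"] by linarith
qed

lemma conv_ge_inverse_square:
  assumes fe: "prob_density fe" and m: "0 < m" "1 / 2 \<le> (LINT e|lborel. indicator {-m..m} e * fe e)"
    and f: "f \<in> borel_measurable borel" "\<And>y. f y \<le> B" and c: "0 < c" "\<And>y. c / (1 + (y - x)\<^sup>2) \<le> f y"
  shows "c / (4 * (1 + m\<^sup>2)) / (1 + (y - x)\<^sup>2) \<le> conv f fe y"
proof -
  let ?c = "c / (2 * (1 + m\<^sup>2) * (1 + (y - x)\<^sup>2))"
  have f0: "0 \<le> f z" for z using order_trans[OF _ c(2)[of z], of 0] c(1) by simp
  have f_abs: "\<bar>f z\<bar> \<le> B" for z using f0[of z] f(2)[of z] by simp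
  have "c / (4 * (1 + m\<^sup>2)) / (1 + (y - x)\<^sup>2) = ?c * (1 / 2)" by simp
  also have "\<dots> \<le> ?c * (LINT e|lborel. indicator {-m..m} e * fe e)"
    using c(1) m(2) by (intro mult_left_mono) auto
  also have "\<dots> = (LINT e|lborel. ?c * (fe e * indicator {-m..m} e))" by (simp add: mult.commute)
  also have "\<dots> \<le> (LINT e|lborel. f (y - e) * fe e)"
  proof (rule integral_mono)
    show "integrable lborel (\<lambda>e. ?c * (fe e * indicator {-m..m} e))"
      using prob_densityD(3)[OF fe] by (intro integrable_mult_right integrable_real_mult_indicator) auto
    show "integrable lborel (\<lambda>e. f (y - e) * fe e)" by (rule integrable_conv[OF fe f(1) f_abs])
    fix e
    show "?c * (fe e * indicator {-m..m} e) \<le> f (y - e) * fe e"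
    proof (cases "e \<in> {-m..m}")
      case True
      then have "1 + ((y - x) - e)\<^sup>2 \<le> 2 * (1 + m\<^sup>2) * (1 + (y - x)\<^sup>2)"
        by (intro one_plus_square_diff_le) auto
      then have "?c \<le> c / (1 + ((y - x) - e)\<^sup>2)"
        using c(1) by (intro divide_left_mono mult_pos_pos one_plus_square_pos) auto
      also have "\<dots> \<le> f (y - e)" using c(2)[of "y - e"] by (simp add: algebra_simps)
      finally have "?c \<le> f (y - e)" .
      from mult_right_mono[OF this prob_densityD(2)[OF fe, of e]] show ?thesis using True by simp
    qed (use f0 prob_densityD(2)[OF fe] in simp)
  qed
  finally show ?thesis by (simp add: conv_def)
qed

subsection \<open>Risk lower bounds from a pair of densities\<close>

lemma ennreal_double_square_le:
  "ennreal (2 * g\<^sup>2) \<le> ennreal ((t - (f + g))\<^sup>2) + ennreal ((t - (f - g))\<^sup>2)" for t f g :: real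
proof -
  have "(t - (f + g))\<^sup>2 + (t - (f - g))\<^sup>2 = 2 * (t - f)\<^sup>2 + 2 * g\<^sup>2"
    by (simp add: power2_eq_square algebra_simps)
  then show ?thesis by (simp add: ennreal_plus[symmetric] ennreal_leI del: ennreal_plus)
qed

lemma ennreal_le_if_double_le: "ennreal (2 * y) \<le> R + R \<Longrightarrow> ennreal y \<le> R" for y :: real
  by (cases R) (auto simp: ennreal_plus[symmetric] ennreal_le_iff2 simp del: ennreal_plus)

definition chi_square_bound :: "real \<Rightarrow> real \<Rightarrow> real \<Rightarrow> real" where
  "chi_square_bound c m E = 4 * pi * (1 + m\<^sup>2) * E\<^sup>2 / c"

locale two_hypotheses =
  fixes fe f0 G :: "real \<Rightarrow> real" and B c m x E :: real
  assumes noise: "prob_density fe" and base: "prob_density f0"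
    and plus: "prob_density (\<lambda>y. f0 y + G y)" and minus: "prob_density (\<lambda>y. f0 y - G y)"
    and base_le: "\<And>y. f0 y \<le> B" and c: "0 < c" and base_ge: "\<And>y. c / (1 + (y - x)\<^sup>2) \<le> f0 y"
    and m: "0 < m" "1 / 2 \<le> (LINT e|lborel. indicator {-m..m} e * fe e)"
    and conv_G_le: "\<And>y. \<bar>conv G fe y\<bar> \<le> E / (1 + (y - x)\<^sup>2)"
begin

definition ratio :: "real \<Rightarrow> real" where "ratio y = conv G fe y / conv f0 fe y"

lemma borel_measurable_perturbation: "G \<in> borel_measurable borel"
  using borel_measurable_diff[OF prob_densityD(1)[OF plus] prob_densityD(1)[OF base]] by simp

lemma perturbation_le: "\<bar>G y\<bar> \<le> f0 y"
  using prob_densityD(2)[OF plus, of y] prob_densityD(2)[OF minus, of y] by linarith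

lemma perturbation_bounded: "\<bar>G y\<bar> \<le> B"
  using perturbation_le[of y] base_le[of y] by linarith

lemma borel_measurable_ratio: "ratio \<in> borel_measurable borel"
  unfolding ratio_def using borel_measurable_perturbation prob_densityD(1)[OF base]
  by (intro borel_measurable_divide borel_measurable_conv noise)

lemma conv_base_ge: "c / (4 * (1 + m\<^sup>2)) / (1 + (y - x)\<^sup>2) \<le> conv f0 fe y"
  by (rule conv_ge_inverse_square[OF noise m prob_densityD(1)[OF base] base_le c base_ge])

lemma conv_base_pos: "0 < conv f0 fe y"
proof -
  have "0 < c / (4 * (1 + m\<^sup>2)) / (1 + (y - x)\<^sup>2)" using c
    by (intro divide_pos_pos mult_pos_pos one_plus_square_pos) auto
  then show ?thesis using conv_base_ge[of y] by linarith
qed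

lemma ratio_le: "\<bar>ratio y\<bar> \<le> 1"
proof -
  have base_abs: "\<bar>f0 z\<bar> \<le> B" for z using base_le[of z] prob_densityD(2)[OF base, of z] by simp
  note add = conv_add[OF noise prob_densityD(1)[OF base] base_abs]
  have "0 \<le> conv f0 fe y + conv G fe y"
    using conv_nonneg[OF noise, of "\<lambda>z. f0 z + G z" y] prob_densityD(2)[OF plus]
    by (simp add: add[OF borel_measurable_perturbation perturbation_bounded])
  moreover have "0 \<le> conv f0 fe y - conv G fe y"
    using conv_nonneg[OF noise, of "\<lambda>z. f0 z - G z" y] prob_densityD(2)[OF minus]
      add[of "\<lambda>z. - G z" B] borel_measurable_perturbation perturbation_bounded by (simp add: conv_uminus)
  ultimately have "\<bar>conv G fe y\<bar> \<le> conv f0 fe y" by linarith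
  then show ?thesis using conv_base_pos[of y] by (simp add: ratio_def)
qed

lemma law_Y_plus: "law_Y (\<lambda>y. f0 y + G y) fe = density (law_Y f0 fe) (\<lambda>y. ennreal (1 + ratio y))"
  unfolding ratio_def
  by (rule law_Y_add_eq_density[OF noise base base_le borel_measurable_perturbation perturbation_bounded plus
      conv_base_pos])

lemma law_Y_minus: "law_Y (\<lambda>y. f0 y - G y) fe = density (law_Y f0 fe) (\<lambda>y. ennreal (1 - ratio y))"
  using law_Y_add_eq_density[OF noise base base_le, of "\<lambda>y. - G y"] borel_measurable_perturbation
      perturbation_bounded
    minus conv_base_pos by (simp add: ratio_def conv_uminus)

lemma integral_ratio: "(LINT y|law_Y f0 fe. ratio y) = 0"
  using borel_measurable_ratio ratio_le prob_space_law_Y[OF plus noise]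
  by (intro integral_eq_zero_if_prob_space_density_one_plus prob_space_law_Y base noise)
    (auto simp: law_Y_plus)

lemma integral_ratio_square_le: "(LINT y|law_Y f0 fe. (ratio y)\<^sup>2) \<le> chi_square_bound c m E"
proof -
  note [measurable] = borel_measurable_ratio borel_measurable_conv[OF noise prob_densityD(1)[OF base]]
  have E_nonneg: "0 \<le> E" using order_trans[OF abs_ge_zero conv_G_le[of x]] by simp
  let ?b = "\<lambda>y. E\<^sup>2 / (c / (4 * (1 + m\<^sup>2))) * (1 / (1 + (y - x)\<^sup>2))"
  have le: "conv f0 fe y * (ratio y)\<^sup>2 \<le> ?b y" for y
  proof -
    have scale: "(E / t)\<^sup>2 / (k / t) = E\<^sup>2 / k * (1 / t)" if "0 < t" for t k
      using that by (simp add: power2_eq_square field_simps)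
    have "conv f0 fe y * (ratio y)\<^sup>2 = (conv G fe y)\<^sup>2 / conv f0 fe y"
      using conv_base_pos[of y] by (simp add: ratio_def power2_eq_square)
    also have "\<dots> \<le> (E / (1 + (y - x)\<^sup>2))\<^sup>2 / (c / (4 * (1 + m\<^sup>2)) / (1 + (y - x)\<^sup>2))"
      using conv_G_le[of y] conv_base_ge[of y] c E_nonneg
      by (intro frac_le divide_pos_pos one_plus_square_pos mult_pos_pos)
        (auto simp: abs_le_square_iff[symmetric])
    finally show ?thesis unfolding scale[OF one_plus_square_pos] .
  qed
  have b: "integrable lborel ?b"
    by (intro integrable_mult_right integrable_lborel_shift[of "\<lambda>y. 1 / (1 + y\<^sup>2)"]
        integrable_inverse_one_plus_square)
  have nn: "0 \<le> conv f0 fe y * (ratio y)\<^sup>2" for y using conv_base_pos[of y] by simp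
  have "(LINT y|law_Y f0 fe. (ratio y)\<^sup>2) = (LINT y|lborel. conv f0 fe y * (ratio y)\<^sup>2)"
    unfolding law_Y_eq_density_conv[OF base noise base_le]
    using conv_base_pos by (subst integral_density) (auto intro: less_imp_le)
  also have "\<dots> \<le> (LINT y|lborel. ?b y)"
  proof (rule integral_mono[OF _ b le], rule Bochner_Integration.integrable_bound[OF b])
    have "norm (conv f0 fe y * (ratio y)\<^sup>2) \<le> norm (?b y)" for y
      unfolding real_norm_def abs_of_nonneg[OF nn] using le[of y] abs_ge_self by (rule order_trans)
    then show "AE y in lborel. norm (conv f0 fe y * (ratio y)\<^sup>2) \<le> norm (?b y)" by (rule AE_I2)
  qed measurable
  also have "\<dots> = E\<^sup>2 / (c / (4 * (1 + m\<^sup>2))) * pi"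
    unfolding integral_mult_right_zero integral_lborel_shift[of "\<lambda>y. 1 / (1 + y\<^sup>2)" x]
      integral_inverse_one_plus_square ..
  finally show ?thesis by (simp add: chi_square_bound_def mult_ac)
qed

lemma two_densities_lower_bound:
  assumes W_meas: "W1 \<in> borel_measurable (PiM {..<n} (\<lambda>_. borel))"
      "W2 \<in> borel_measurable (PiM {..<n} (\<lambda>_. borel))"
    and W: "\<And>Y. Y \<in> space (PiM {..<n} (\<lambda>_. borel :: real measure)) \<Longrightarrow> ennreal d \<le> W1 Y + W2 Y" and d: "0 \<le> d"
  shows "ennreal (d * affinity_bound (chi_square_bound c m E) n)
    \<le> (\<integral>\<^sup>+Y. W1 Y \<partial>sample_law (\<lambda>y. f0 y + G y) fe n) + (\<integral>\<^sup>+Y. W2 Y \<partial>sample_law (\<lambda>y. f0 y - G y) fe n)"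
proof -
  have "sets (PiM {..<n} (\<lambda>_. law_Y f0 fe)) = sets (PiM {..<n} (\<lambda>_. borel))" by (intro sets_PiM_cong) auto
  then have meas: "borel_measurable (PiM {..<n} (\<lambda>_. law_Y f0 fe))
      = (borel_measurable (PiM {..<n} (\<lambda>_. borel)) :: ((nat \<Rightarrow> real) \<Rightarrow> ennreal) set)"
    by (intro measurable_cong_sets) auto
  have "ennreal (d * affinity_bound (chi_square_bound c m E) n)
      \<le> ennreal (d * affinity_bound (LINT y|law_Y f0 fe. (ratio y)\<^sup>2) n)"
    using d integral_ratio_square_le by (intro ennreal_leI mult_left_mono affinity_bound_antimono) auto
  also have "\<dots> \<le> (\<integral>\<^sup>+Y. W1 Y \<partial>sample_law (\<lambda>y. f0 y + G y) fe n)
      + (\<integral>\<^sup>+Y. W2 Y \<partial>sample_law (\<lambda>y. f0 y - G y) fe n)"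
    unfolding sample_law_def law_Y_plus law_Y_minus using W_meas borel_measurable_ratio
    by (intro two_point_lower_bound prob_space_law_Y[OF base noise] ratio_le integral_ratio W d)
      (auto simp: meas space_PiM)
  finally show ?thesis .
qed

lemma risk_pt_lower_bound:
  assumes cl: "(\<lambda>y. f0 y + G y) \<in> dens_class \<alpha> r L" "(\<lambda>y. f0 y - G y) \<in> dens_class \<alpha> r L"
    and T: "T \<in> estimators n"
  shows "ennreal ((G z)\<^sup>2 * affinity_bound (chi_square_bound c m E) n) \<le> risk_pt fe \<alpha> r L n z T"
proof (rule ennreal_le_if_double_le)
  have "(\<lambda>(Y, x). T Y x) \<in> borel_measurable (PiM {..<n} (\<lambda>_. borel) \<Otimes>\<^sub>M borel)" using T
    by (simp add: estimators_def)
  from measurable_compose[OF measurable_Pair2'[of z] this]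
  have [measurable]: "(\<lambda>Y. T Y z) \<in> borel_measurable (PiM {..<n} (\<lambda>_. borel))" by simp
  let ?I = "\<lambda>f. \<integral>\<^sup>+Y. ennreal ((T Y z - f z)\<^sup>2) \<partial>sample_law f fe n"
  have "ennreal (2 * (G z)\<^sup>2 * affinity_bound (chi_square_bound c m E) n)
      \<le> ?I (\<lambda>y. f0 y + G y) + ?I (\<lambda>y. f0 y - G y)"
    by (rule two_densities_lower_bound) (auto intro: ennreal_double_square_le)
  also have "\<dots> \<le> risk_pt fe \<alpha> r L n z T + risk_pt fe \<alpha> r L n z T"
    unfolding risk_pt_def by (intro add_mono SUP_upper2[OF cl(1)] SUP_upper2[OF cl(2)]) auto
  finally show "ennreal (2 * ((G z)\<^sup>2 * affinity_bound (chi_square_bound c m E) n))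
      \<le> risk_pt fe \<alpha> r L n z T + risk_pt fe \<alpha> r L n z T"
    by (simp add: mult.assoc)
qed

lemma risk_L2_lower_bound:
  assumes cl: "(\<lambda>y. f0 y + G y) \<in> dens_class \<alpha> r L" "(\<lambda>y. f0 y - G y) \<in> dens_class \<alpha> r L"
    and T: "T \<in> estimators n"
    and G2: "integrable lborel (\<lambda>z. (G z)\<^sup>2)"
  shows "ennreal ((LINT z|lborel. (G z)\<^sup>2) * affinity_bound (chi_square_bound c m E) n)
      \<le> risk_L2 fe \<alpha> r L n T"
proof (rule ennreal_le_if_double_le)
  note [measurable] = borel_measurable_perturbation prob_densityD(1)[OF base]
  have [measurable]: "(\<lambda>(Y, x). T Y x) \<in> borel_measurable (PiM {..<n} (\<lambda>_. borel) \<Otimes>\<^sub>M borel)" using T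
    by (simp add: estimators_def)
  let ?J = "LINT z|lborel. (G z)\<^sup>2"
  let ?I = "\<lambda>f. \<integral>\<^sup>+Y. (\<integral>\<^sup>+z. ennreal ((T Y z - f z)\<^sup>2) \<partial>lborel) \<partial>sample_law f fe n"
  have "ennreal (2 * ?J * affinity_bound (chi_square_bound c m E) n)
      \<le> ?I (\<lambda>y. f0 y + G y) + ?I (\<lambda>y. f0 y - G y)"
  proof (rule two_densities_lower_bound)
    show "(\<lambda>Y. \<integral>\<^sup>+z. ennreal ((T Y z - (f0 z + G z))\<^sup>2) \<partial>lborel) \<in> borel_measurable (PiM {..<n} (\<lambda>_. borel))"
      by measurable
    show "(\<lambda>Y. \<integral>\<^sup>+z. ennreal ((T Y z - (f0 z - G z))\<^sup>2) \<partial>lborel) \<in> borel_measurable (PiM {..<n} (\<lambda>_. borel))"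
      by measurable
    fix Y :: "nat \<Rightarrow> real" assume "Y \<in> space (PiM {..<n} (\<lambda>_. borel))"
    then have [measurable]: "T Y \<in> borel_measurable borel"
      using measurable_compose[OF measurable_Pair1' \<open>(\<lambda>(Y, x). T Y x) \<in> _\<close>] by simp
    have "ennreal (2 * ?J) = (\<integral>\<^sup>+z. ennreal (2 * (G z)\<^sup>2) \<partial>lborel)"
      using G2 by (subst nn_integral_eq_integral) auto
    also have "\<dots> \<le> (\<integral>\<^sup>+z. ennreal ((T Y z - (f0 z + G z))\<^sup>2) + ennreal ((T Y z - (f0 z - G z))\<^sup>2) \<partial>lborel)"
      by (intro nn_integral_mono ennreal_double_square_le)
    also have "\<dots> = (\<integral>\<^sup>+z. ennreal ((T Y z - (f0 z + G z))\<^sup>2) \<partial>lborel)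
        + (\<integral>\<^sup>+z. ennreal ((T Y z - (f0 z - G z))\<^sup>2) \<partial>lborel)"
      by (rule nn_integral_add) measurable
    finally show "ennreal (2 * ?J)
        \<le> (\<integral>\<^sup>+z. ennreal ((T Y z - (f0 z + G z))\<^sup>2) \<partial>lborel)
            + (\<integral>\<^sup>+z. ennreal ((T Y z - (f0 z - G z))\<^sup>2) \<partial>lborel)" .
  qed simp
  also have "\<dots> \<le> risk_L2 fe \<alpha> r L n T + risk_L2 fe \<alpha> r L n T"
    unfolding risk_L2_def by (intro add_mono SUP_upper2[OF cl(1)] SUP_upper2[OF cl(2)]) auto
  finally show "ennreal (2 * (?J * affinity_bound (chi_square_bound c m E) n))
      \<le> risk_L2 fe \<alpha> r L n T + risk_L2 fe \<alpha> r L n T"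
    by (simp add: mult.assoc)
qed

end

section \<open>Functions with even band-limited Fourier transform\<close>

subsection \<open>Cosine transforms\<close>

definition even_ext :: "real \<Rightarrow> real \<Rightarrow> (real \<Rightarrow> real) \<Rightarrow> real \<Rightarrow> real" where
  "even_ext a b v u = (if a \<le> \<bar>u\<bar> \<and> \<bar>u\<bar> \<le> b then v \<bar>u\<bar> else 0)"

text \<open>The inverse Fourier transform of \<open>even_ext a b v\<close>.\<close>

definition band :: "real \<Rightarrow> real \<Rightarrow> (real \<Rightarrow> real) \<Rightarrow> real \<Rightarrow> real" where
  "band a b v y = (LINT u|lborel. indicator {a..b} u * (v u * cos (u * y))) / pi"

lemma even_ext_minus: "even_ext a b v (- u) = even_ext a b v u"
  by (simp add: even_ext_def)

lemma band_minus: "band a b v (- y) = band a b v y"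
  by (simp add: band_def)

lemma has_bochner_integral_even_ext:
  assumes "0 \<le> a" and v: "integrable lborel (\<lambda>u. indicator {a..b} u * v u)"
  shows "has_bochner_integral lborel (even_ext a b v) (2 * (LINT u|lborel. indicator {a..b} u * v u))"
proof -
  have "(\<lambda>u. indicator {0..} u *\<^sub>R even_ext a b v u) = (\<lambda>u. indicator {a..b} u * v u)"
    using \<open>0 \<le> a\<close> by (auto simp: even_ext_def indicator_def fun_eq_iff)
  then have "has_bochner_integral lborel (\<lambda>u. indicator {0..} u *\<^sub>R even_ext a b v u)
      (LINT u|lborel. indicator {a..b} u * v u)"
    using v by (simp add: has_bochner_integral_integrable)
  from has_bochner_integral_even_function[OF this even_ext_minus] show ?thesis by simp
qed

lemma integral_hermitian:
  fixes W :: "real \<Rightarrow> complex"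
  assumes herm: "\<And>u. W (- u) = cnj (W u)" and half: "integrable lborel (\<lambda>u. indicator {0..} u *\<^sub>R W u)"
  shows "(LINT u|lborel. W u) = complex_of_real (2 * Re (LINT u|lborel. indicator {0..} u *\<^sub>R W u))"
proof -
  let ?H = "\<lambda>u. indicator {0..} u *\<^sub>R W u"
  have [measurable]: "W \<in> borel_measurable borel"
  proof -
    have "W = (\<lambda>u. if 0 \<le> u then ?H u else cnj (?H (- u)))" by (auto simp: fun_eq_iff herm[symmetric])
    moreover have "\<dots> \<in> borel_measurable borel"
      using half borel_measurable_integrable[OF
          integrable_cnj[OF lborel_integrable_real_affine[OF half, of "- 1" 0]]]
      by (intro measurable_If) auto
    ultimately show ?thesis by simp
  qed
  have reflected: "integrable lborel (\<lambda>u. ?H (- u))"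
    using lborel_integrable_real_affine[OF half, of "- 1" 0] by simp
  have "AE u in lborel. u \<noteq> (0::real)" by (rule AE_lborel_singleton)
  then have "AE u in lborel. W u = ?H u + cnj (?H (- u))"
    by eventually_elim (auto simp: herm split: split_indicator)
  moreover have "(\<lambda>u. ?H u + cnj (?H (- u))) \<in> borel_measurable lborel"
    by (intro borel_measurable_integrable Bochner_Integration.integrable_add half integrable_cnj reflected)
  ultimately have "(LINT u|lborel. W u) = (LINT u|lborel. ?H u + cnj (?H (- u)))"
    by (intro integral_cong_AE) auto
  also have "\<dots> = (LINT u|lborel. ?H u) + cnj (LINT u|lborel. ?H (- u))"
    unfolding Bochner_Integration.integral_cnj[symmetric]
    by (intro Bochner_Integration.integral_add half integrable_cnj reflected)
  also have "(LINT u|lborel. ?H (- u)) = (LINT u|lborel. ?H u)"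
    by (subst (2) lborel_integral_real_affine[where c="- 1" and t=0]) auto
  finally show ?thesis by (simp add: complex_add_cnj)
qed

lemma fourier_minus: "fourier g (- u) = cnj (fourier g u)"
  unfolding fourier_def Bochner_Integration.integral_cnj[symmetric] by (simp add: cis_cnj)

context
  fixes a b :: real and v :: "real \<Rightarrow> real"
  assumes a: "0 \<le> a" and cont: "continuous_on {a..b} v"
begin

lemma integrable_even_ext: "integrable lborel (even_ext a b v)"
  using has_bochner_integral_even_ext[OF a] integrable_indicator_Icc[OF cont]
  by (auto intro: integrable.intros)

lemma even_ext_half: "indicator {0..} u *\<^sub>R (complex_of_real (even_ext a b v u) * z)
    = indicator {a..b} u *\<^sub>R (complex_of_real (v u) * z)"
  using a by (auto simp: even_ext_def split: split_indicator)

lemma integrable_indicator_cis: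
    "integrable lborel (\<lambda>u. indicator {a..b} u *\<^sub>R (complex_of_real (v u) * cis (u * y)))"
  by (intro integrable_indicator_Icc continuous_intros cont)

lemma band_eq_Re: "band a b v y
    = Re (LINT u|lborel. indicator {a..b} u *\<^sub>R (complex_of_real (v u) * cis (- (u * y)))) / pi"
  unfolding band_def integral_Re[OF integrable_indicator_cis[of "- y"], unfolded mult_minus_right, symmetric]
  by simp

lemma cfourier_even_ext: "cfourier (\<lambda>u. complex_of_real (even_ext a b v u)) y
    = complex_of_real (2 * pi * band a b v y)"
proof -
  have "cfourier (\<lambda>u. complex_of_real (even_ext a b v u)) y
      = complex_of_real (2
          * Re (LINT u|lborel. indicator {a..b} u *\<^sub>R (complex_of_real (v u) * cis (u * y))))"
    unfolding cfourier_def using integrable_indicator_cis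
    by (subst integral_hermitian) (simp_all add: even_ext_minus cis_cnj even_ext_half)
  also have "Re (LINT u|lborel. indicator {a..b} u *\<^sub>R (complex_of_real (v u) * cis (u * y)))
      = pi * band a b v y"
    using band_eq_Re[of "- y"] by (simp add: band_minus)
  finally show ?thesis by (simp add: mult.assoc)
qed

lemma continuous_on_band: "continuous_on S (band a b v)"
proof -
  have "band a b v = (\<lambda>y. Re (cfourier (\<lambda>u. complex_of_real (even_ext a b v u)) y) / (2 * pi))"
    by (simp add: cfourier_even_ext fun_eq_iff)
  moreover have "continuous_on S \<dots>"
    using integrable_even_ext by (intro continuous_intros continuous_on_cfourier) auto
  ultimately show ?thesis by simp
qed

lemma borel_measurable_band: "band a b v \<in> borel_measurable borel"
  by (intro borel_measurable_continuous_onI continuous_on_band)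

lemma abs_band_le: "\<bar>band a b v y\<bar> \<le> (LINT u|lborel. \<bar>even_ext a b v u\<bar>) / (2 * pi)"
  using norm_cfourier_le[of "\<lambda>u. complex_of_real (even_ext a b v u)" y]
  by (simp add: cfourier_even_ext norm_mult field_simps del: of_real_mult)

lemma fourier_band:
  assumes "isCont (even_ext a b v) (- u)" and band: "integrable lborel (band a b v)"
  shows "fourier (band a b v) u = even_ext a b v u"
proof -
  let ?V = "\<lambda>u. complex_of_real (even_ext a b v u)"
  have transform: "cfourier ?V = (\<lambda>y. 2 * pi * complex_of_real (band a b v y))"
    by (simp add: cfourier_even_ext fun_eq_iff)
  have "2 * pi * fourier (band a b v) u = cfourier (cfourier ?V) u"
    unfolding transform fourier_def cfourier_def by (simp add: mult.assoc flip: integral_mult_right_zero)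
  also have "\<dots> = 2 * pi * ?V (- u)"
    using fourier_inversion[of ?V "- u"] integrable_even_ext band assms(1) by (simp add: transform)
  finally show ?thesis by (simp add: even_ext_minus)
qed

lemma integrable_band_square:
  assumes "integrable lborel (band a b v)" shows "integrable lborel (\<lambda>y. (band a b v y)\<^sup>2)"
proof (rule Bochner_Integration.integrable_bound)
  let ?C = "(LINT u|lborel. \<bar>even_ext a b v u\<bar>) / (2 * pi)"
  show "integrable lborel (\<lambda>y. ?C * band a b v y)" by (intro integrable_mult_right assms)
  have "norm ((band a b v y)\<^sup>2) \<le> norm (?C * band a b v y)" for y
    using mult_right_mono[OF abs_band_le[of y] abs_ge_zero[of "band a b v y"]]
    by (simp add: power2_eq_square abs_mult)
  then show "AE y in lborel. norm ((band a b v y)\<^sup>2) \<le> norm (?C * band a b v y)" by (rule AE_I2)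
qed (use borel_measurable_band in measurable)

lemma integral_band_square:
  assumes V: "\<And>u. isCont (even_ext a b v) u" and band: "integrable lborel (band a b v)"
  shows "(LINT y|lborel. (band a b v y)\<^sup>2) = (LINT u|lborel. indicator {a..b} u * (v u)\<^sup>2) / pi"
proof -
  let ?V = "\<lambda>u. complex_of_real (even_ext a b v u)" and ?g = "\<lambda>y. complex_of_real (band a b v y)"
  have "complex_of_real (2 * pi * (LINT y|lborel. (band a b v y)\<^sup>2)) = (LINT y|lborel. cfourier ?V y * ?g y)"
    by (simp add: cfourier_even_ext power2_eq_square mult.assoc flip: integral_complex_of_real)
  also have "\<dots> = (LINT u|lborel. ?V u * cfourier ?g u)"
    using integrable_even_ext band by (intro cfourier_multiplication_formula) auto
  also have "\<dots> = (LINT u|lborel. complex_of_real ((even_ext a b v u)\<^sup>2))"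
    using fourier_band[OF V band] by (simp add: fourier_eq_cfourier power2_eq_square)
  finally have "2 * pi * (LINT y|lborel. (band a b v y)\<^sup>2) = (LINT u|lborel. (even_ext a b v u)\<^sup>2)"
    unfolding integral_complex_of_real of_real_eq_iff .
  also have "(\<lambda>u. (even_ext a b v u)\<^sup>2) = even_ext a b (\<lambda>u. (v u)\<^sup>2)" by (auto simp: even_ext_def)
  also have "(LINT u|lborel. even_ext a b (\<lambda>u. (v u)\<^sup>2) u)
      = 2 * (LINT u|lborel. indicator {a..b} u * (v u)\<^sup>2)"
    using integrable_indicator_Icc[of a b "\<lambda>u. (v u)\<^sup>2"] cont
    by (intro has_bochner_integral_integral_eq has_bochner_integral_even_ext a)
      (auto intro: continuous_intros)
  finally show ?thesis by (simp add: field_simps)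
qed

lemma conv_band:
  assumes fe: "prob_density fe"
  shows "conv (band a b v) fe y
    = Re (LINT u|lborel. indicator {a..b} u *\<^sub>R (complex_of_real (v u) * fourier fe u
        * cis (- (u * y)))) / pi"
proof -
  let ?V = "\<lambda>u. complex_of_real (even_ext a b v u) * cis (- (u * y))"
  let ?W = "\<lambda>u. complex_of_real (even_ext a b v u) * (fourier fe u * cis (- (u * y)))"
  have V: "cfourier ?V e = complex_of_real (2 * pi * band a b v (y - e))" for e
  proof -
    have "cfourier ?V e = cfourier (\<lambda>u. complex_of_real (even_ext a b v u)) (e - y)"
      unfolding cfourier_def
      by (intro Bochner_Integration.integral_cong refl) (simp add: cis_mult algebra_simps)
    then show ?thesis using band_minus[of a b v "e - y"] by (simp add: cfourier_even_ext)
  qed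
  have fe_int: "integrable lborel (\<lambda>e. complex_of_real (fe e))" using prob_densityD(3)[OF fe] by simp
  have "complex_of_real (2 * pi * conv (band a b v) fe y)
      = (LINT e|lborel. cfourier ?V e * complex_of_real (fe e))"
    unfolding V conv_def by (simp add: mult.assoc flip: integral_complex_of_real)
  also have "\<dots> = (LINT u|lborel. ?V u * cfourier (\<lambda>e. complex_of_real (fe e)) u)"
    using integrable_even_ext fe_int by (intro cfourier_multiplication_formula integrable_mult_cis) auto
  also have "\<dots> = (LINT u|lborel. ?W u)"
    by (simp add: fourier_eq_cfourier mult_ac)
  also have "\<dots> = complex_of_real (2 * Re (LINT u|lborel. indicator {0..} u *\<^sub>R ?W u))"
  proof (rule integral_hermitian)
    show "?W (- u) = cnj (?W u)" for u by (simp add: even_ext_minus fourier_minus cis_cnj)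
    show "integrable lborel (\<lambda>u. indicator {0..} u *\<^sub>R ?W u)"
      unfolding even_ext_half
      by (intro integrable_indicator_Icc continuous_intros cont continuous_on_fourier prob_densityD(3)[OF fe])
  qed
  finally show ?thesis unfolding even_ext_half of_real_eq_iff by (simp add: eq_divide_eq mult_ac)
qed

end

subsection \<open>Oscillatory integrals\<close>

lemma has_vector_derivative_cis_mult:
  "((\<lambda>u. cis (- (u * y))) has_vector_derivative (- \<i> * y * cis (- (u * y)))) (at u within S)"
proof -
  have "((\<lambda>z. exp (- \<i> * y * z)) has_field_derivative (- \<i> * y * exp (- \<i> * y * complex_of_real u)))
      (at (complex_of_real u))"
    by (auto intro!: derivative_eq_intros)
  from has_vector_derivative_real_field[OF this]
  show ?thesis by (simp add: cis_conv_exp mult_ac)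
qed

definition C2_bound ::
    "real set \<Rightarrow> real \<Rightarrow> real \<Rightarrow> (real \<Rightarrow> complex) \<Rightarrow> (real \<Rightarrow> complex) \<Rightarrow> (real \<Rightarrow> complex) \<Rightarrow> bool" where
  "C2_bound S B k f f1 f2 \<longleftrightarrow> 0 \<le> B \<and> 0 \<le> k \<and> continuous_on S f2 \<and>
    (\<forall>u\<in>S. (f has_vector_derivative f1 u) (at u within S) \<and> (f1 has_vector_derivative f2 u) (at u within S) \<and>
      cmod (f u) \<le> B \<and> cmod (f1 u) \<le> B * k \<and> cmod (f2 u) \<le> B * k\<^sup>2)"

lemma C2_boundD:
  assumes "C2_bound S B k f f1 f2"
  shows "0 \<le> B" "0 \<le> k" "continuous_on S f" "continuous_on S f1" "continuous_on S f2"
    and "u \<in> S \<Longrightarrow> (f has_vector_derivative f1 u) (at u within S)"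
    and "u \<in> S \<Longrightarrow> (f1 has_vector_derivative f2 u) (at u within S)"
    and "u \<in> S \<Longrightarrow> cmod (f u) \<le> B" "u \<in> S \<Longrightarrow> cmod (f1 u) \<le> B * k" "u \<in> S \<Longrightarrow> cmod (f2 u) \<le> B * k\<^sup>2"
  using assms unfolding C2_bound_def by (auto intro: continuous_on_vector_derivative)

lemma C2_bound_mono:
  assumes f: "C2_bound S B k f f1 f2" and "B \<le> B'" "k \<le> k'"
  shows "C2_bound S B' k' f f1 f2"
proof -
  have "B * k \<le> B' * k'" "B * k\<^sup>2 \<le> B' * k'\<^sup>2"
    using assms C2_boundD(1,2)[OF f] by (auto intro!: mult_mono power_mono)
  then show ?thesis using assms unfolding C2_bound_def by (auto intro: order_trans)
qed

lemma C2_bound_mult: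
  assumes f: "C2_bound S B k f f1 f2" and g: "C2_bound S B' k' g g1 g2"
  shows "C2_bound S (B * B') (k + k') (\<lambda>u. f u * g u) (\<lambda>u. f u * g1 u + f1 u * g u)
    (\<lambda>u. f u * g2 u + 2 * (f1 u * g1 u) + f2 u * g u)"
  unfolding C2_bound_def
proof (intro conjI ballI)
  note F = C2_boundD[OF f] and G = C2_boundD[OF g]
  show "0 \<le> B * B'" "0 \<le> k + k'" using F(1,2) G(1,2) by auto
  show "continuous_on S (\<lambda>u. f u * g2 u + 2 * (f1 u * g1 u) + f2 u * g u)"
    by (intro continuous_intros F(3-5) G(3-5))
  fix u assume u: "u \<in> S"
  show "((\<lambda>u. f u * g u) has_vector_derivative f u * g1 u + f1 u * g u) (at u within S)"
    by (rule has_vector_derivative_mult[OF F(6)[OF u] G(6)[OF u]])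
  show "((\<lambda>u. f u * g1 u + f1 u * g u) has_vector_derivative
      f u * g2 u + 2 * (f1 u * g1 u) + f2 u * g u) (at u within S)"
    by (rule has_vector_derivative_eq_rhs[OF has_vector_derivative_add[OF
          has_vector_derivative_mult[OF F(6)[OF u] G(7)[OF u]]
              has_vector_derivative_mult[OF F(7)[OF u] G(6)[OF u]]]]) simp
  have prod: "cmod (p * q) \<le> P * Q" if "cmod p \<le> P" "cmod q \<le> Q" for p q P Q
    unfolding norm_mult using that by (intro mult_mono) (auto intro: order_trans[OF norm_ge_zero])
  show "cmod (f u * g u) \<le> B * B'" by (rule prod[OF F(8)[OF u] G(8)[OF u]])
  have "cmod (f u * g1 u + f1 u * g u) \<le> B * (B' * k') + (B * k) * B'"
    by (intro norm_triangle_le add_mono prod F(8,9)[OF u] G(8,9)[OF u])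
  then show "cmod (f u * g1 u + f1 u * g u) \<le> B * B' * (k + k')" by (simp add: algebra_simps)
  have "cmod (f u * g2 u + 2 * (f1 u * g1 u) + f2 u * g u)
      \<le> B * (B' * k'\<^sup>2) + 2 * (B * k * (B' * k')) + B * k\<^sup>2 * B'"
    by (intro norm_triangle_le add_mono prod F(8-10)[OF u] G(8-10)[OF u]) simp
  then show "cmod (f u * g2 u + 2 * (f1 u * g1 u) + f2 u * g u) \<le> B * B' * (k + k')\<^sup>2"
    by (simp add: algebra_simps power2_eq_square)
qed

lemma C2_bound_of_real:
  assumes "0 \<le> B" "0 \<le> k" "continuous_on S g2"
    and "\<And>u. u \<in> S \<Longrightarrow> (g has_real_derivative g1 u) (at u within S)"
    and "\<And>u. u \<in> S \<Longrightarrow> (g1 has_real_derivative g2 u) (at u within S)"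
    and "\<And>u. u \<in> S \<Longrightarrow> \<bar>g u\<bar> \<le> B" "\<And>u. u \<in> S \<Longrightarrow> \<bar>g1 u\<bar> \<le> B * k" "\<And>u. u \<in> S \<Longrightarrow> \<bar>g2 u\<bar> \<le> B * k\<^sup>2"
  shows "C2_bound S B k (\<lambda>u. complex_of_real (g u)) (\<lambda>u. complex_of_real (g1 u)) (\<lambda>u. complex_of_real (g2 u))"
  unfolding C2_bound_def using assms by (auto intro!: has_vector_derivative_of_real continuous_intros)

lemma norm_integral_Icc_mult_cis_le:
  fixes w :: "real \<Rightarrow> complex"
  assumes "a \<le> b" and w: "continuous_on {a..b} w" and B: "\<And>u. u \<in> {a..b} \<Longrightarrow> cmod (w u) \<le> B"
  shows "cmod (LINT u|lborel. indicator {a..b} u *\<^sub>R (w u * cis (- (u * y)))) \<le> B * (b - a)"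
proof -
  have "cmod (LINT u|lborel. indicator {a..b} u *\<^sub>R (w u * cis (- (u * y))))
      \<le> (LINT u|lborel. cmod (indicator {a..b} u *\<^sub>R (w u * cis (- (u * y)))))" by (rule integral_norm_bound)
  also have "\<dots> \<le> (LINT u|lborel. B * indicator {a..b} u)"
  proof (rule integral_mono)
    show "integrable lborel (\<lambda>u. cmod (indicator {a..b} u *\<^sub>R (w u * cis (- (u * y)))))"
      by (intro integrable_norm integrable_indicator_Icc continuous_intros w)
  qed (use B \<open>a \<le> b\<close> in \<open>auto simp: norm_mult split: split_indicator\<close>)
  also have "\<dots> = B * (b - a)" using \<open>a \<le> b\<close> by simp
  finally show ?thesis .
qed

text \<open>Two integrations by parts in one application of the fundamental theorem of calculus: the function
  \<open>(w' + \<i> y w) e^{-\<i>uy}\<close> has derivative \<open>(w'' + y\<^sup>2 w) e^{-\<i>uy}\<close> and vanishes at both end points.\<close>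

lemma oscillatory_integral_le:
  assumes ab: "a \<le> b" and w: "C2_bound {a..b} B k w w1 w2" and k: "1 \<le> k"
    and ends: "w a = 0" "w b = 0" "w1 a = 0" "w1 b = 0"
  shows "cmod (LINT u|lborel. indicator {a..b} u *\<^sub>R (w u * cis (- (u * y))))
      \<le> 2 * (B * k\<^sup>2) * (b - a) / (1 + y\<^sup>2)"
proof -
  note W = C2_boundD[OF w]
  let ?F = "\<lambda>u. (w1 u + \<i> * y * w u) * cis (- (u * y))"
  let ?I = "\<lambda>v. LINT u|lborel. indicator {a..b} u *\<^sub>R (v u * cis (- (u * y)))"
  have "(LINT u|lborel. indicator {a..b} u *\<^sub>R ((w2 u + y\<^sup>2 * w u) * cis (- (u * y)))) = ?F b - ?F a"
  proof (rule integral_FTC_Icc[OF ab])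
    fix u assume "a \<le> u" "u \<le> b"
    then have u: "u \<in> {a..b}" by simp
    show "(?F has_vector_derivative ((w2 u + y\<^sup>2 * w u) * cis (- (u * y)))) (at u within {a..b})"
      by (rule has_vector_derivative_eq_rhs[OF has_vector_derivative_mult[OF has_vector_derivative_add[OF
              W(7)[OF u] has_vector_derivative_mult_right[OF W(6)[OF u]]] has_vector_derivative_cis_mult]])
         (simp add: algebra_simps power2_eq_square)
  qed (intro continuous_intros W(3,5))
  then have "0 = (LINT u|lborel. indicator {a..b} u *\<^sub>R (w2 u * cis (- (u * y)))
      + y\<^sup>2 * (indicator {a..b} u *\<^sub>R (w u * cis (- (u * y)))))"
    using ends by (simp add: algebra_simps)
  also have "\<dots> = ?I w2 + y\<^sup>2 * ?I w"
  proof -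
    have int: "integrable lborel (\<lambda>u. indicator {a..b} u *\<^sub>R (f u * cis (- (u * y))))"
        if "continuous_on {a..b} f" for f
      by (intro integrable_indicator_Icc continuous_intros that)
    show ?thesis
      by (simp only: Bochner_Integration.integral_add[OF int[OF W(5)] integrable_mult_right[OF int[OF W(3)]]]
          integral_mult_right_zero)
  qed
  finally have "y\<^sup>2 * ?I w = - ?I w2" by (simp add: eq_neg_iff_add_eq_0 add.commute)
  then have "cmod (y\<^sup>2 * ?I w) = cmod (?I w2)" by (simp only: norm_minus_cancel)
  then have "y\<^sup>2 * cmod (?I w) = cmod (?I w2)" by (simp add: norm_mult norm_power)
  moreover have "cmod (?I w2) \<le> B * k\<^sup>2 * (b - a)"
    by (rule norm_integral_Icc_mult_cis_le[OF ab W(5,10)])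
  moreover have "cmod (?I w) \<le> B * k\<^sup>2 * (b - a)"
  proof (rule norm_integral_Icc_mult_cis_le[OF ab W(3)])
    fix u assume "u \<in> {a..b}"
    then have "cmod (w u) \<le> B * 1" using W(8) by simp
    also have "\<dots> \<le> B * k\<^sup>2" using W(1) k by (intro mult_left_mono one_le_power) auto
    finally show "cmod (w u) \<le> B * k\<^sup>2" .
  qed
  ultimately have "(1 + y\<^sup>2) * cmod (?I w) \<le> 2 * (B * k\<^sup>2) * (b - a)" by (simp add: algebra_simps)
  then show ?thesis by (simp add: field_simps one_plus_square_pos)
qed

subsection \<open>Smooth band profiles\<close>

locale band_profile =
  fixes a b B k :: real and v :: "real \<Rightarrow> real" and v1 v2 :: "real \<Rightarrow> complex"
  assumes a: "0 < a" and ab: "a < b" and k: "1 \<le> k"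
    and profile: "C2_bound {a..b} B k (\<lambda>u. complex_of_real (v u)) v1 v2"
    and ends: "v a = 0" "v b = 0" "v1 a = 0" "v1 b = 0"
begin

lemma continuous_on_profile: "continuous_on {a..b} v"
  using continuous_on_Re[OF C2_boundD(3)[OF profile]] by simp

lemma isCont_even_ext: "isCont (even_ext a b v) u"
proof -
  have "even_ext a b v = (\<lambda>u. v (min b (max a \<bar>u\<bar>)))"
    using ends ab by (auto simp: even_ext_def min_def max_def fun_eq_iff)
  moreover have "continuous_on UNIV (\<lambda>u. v (min b (max a \<bar>u\<bar>)))"
    by (rule continuous_on_compose2[OF continuous_on_profile]) (use ab in \<open>auto intro!: continuous_intros\<close>)
  ultimately show ?thesis by (simp add: continuous_on_eq_continuous_at)
qed

lemma abs_band_le_decay: "\<bar>band a b v y\<bar> \<le> (2 * (B * k\<^sup>2) * (b - a) / pi) / (1 + y\<^sup>2)"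
proof -
  let ?I = "LINT u|lborel. indicator {a..b} u *\<^sub>R (complex_of_real (v u) * cis (- (u * y)))"
  have "cmod ?I \<le> 2 * (B * k\<^sup>2) * (b - a) / (1 + y\<^sup>2)"
    by (rule oscillatory_integral_le[OF less_imp_le[OF ab] profile k]) (use ends in auto)
  then have "\<bar>Re ?I\<bar> / pi \<le> 2 * (B * k\<^sup>2) * (b - a) / (1 + y\<^sup>2) / pi"
    by (intro divide_right_mono order_trans[OF abs_Re_le_cmod]) auto
  then show ?thesis
    using band_eq_Re[OF less_imp_le[OF a] continuous_on_profile] by (simp add: abs_divide mult.commute)
qed

lemma abs_conv_band_le_decay:
  assumes fe: "prob_density fe" and \<Phi>: "C2_bound {a..b} B' k' (fourier fe) D1 D2"
  shows "\<bar>conv (band a b v) fe y\<bar> \<le> (2 * (B * B' * (k + k')\<^sup>2) * (b - a) / pi) / (1 + y\<^sup>2)"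
proof -
  let ?I = "LINT u|lborel. indicator {a..b} u *\<^sub>R (complex_of_real (v u) * fourier fe u * cis (- (u * y)))"
  have "cmod ?I \<le> 2 * (B * B' * (k + k')\<^sup>2) * (b - a) / (1 + y\<^sup>2)"
    by (rule oscillatory_integral_le[OF less_imp_le[OF ab] C2_bound_mult[OF profile \<Phi>]])
       (use ends k C2_boundD(2)[OF \<Phi>] in auto)
  then have "\<bar>Re ?I\<bar> / pi \<le> 2 * (B * B' * (k + k')\<^sup>2) * (b - a) / (1 + y\<^sup>2) / pi"
    by (intro divide_right_mono order_trans[OF abs_Re_le_cmod]) auto
  then show ?thesis
    using conv_band[OF less_imp_le[OF a] continuous_on_profile fe] by (simp add: abs_divide mult.commute)
qed

lemma integrable_band: "integrable lborel (band a b v)"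
  using abs_band_le_decay
  by (intro integrable_inverse_square_decay[of _ "2 * (B * k\<^sup>2) * (b - a) / pi"]
      borel_measurable_band[OF less_imp_le[OF a] continuous_on_profile]) simp

lemma fourier_band_profile: "fourier (band a b v) u = even_ext a b v u"
  by (rule fourier_band[OF less_imp_le[OF a] continuous_on_profile isCont_even_ext integrable_band])

lemma integral_band: "(LINT y|lborel. band a b v y) = 0"
proof -
  have "complex_of_real (LINT y|lborel. band a b v y) = 0"
    unfolding of_real_integral_eq_fourier_zero fourier_band_profile using a by (simp add: even_ext_def)
  then show ?thesis by simp
qed

lemma fourier_energy_band:
  "fourier_energy \<alpha> r (band a b v)
      = ennreal (2 * (LINT u|lborel. indicator {a..b} u * ((v u)\<^sup>2 * exp (2 * \<alpha> * u powr r))))"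
proof -
  let ?w = "\<lambda>u. (v u)\<^sup>2 * exp (2 * \<alpha> * u powr r)"
  have "continuous_on {a..b} ?w" using a by (intro continuous_intros continuous_on_profile) auto
  then have int: "integrable lborel (\<lambda>u. indicator {a..b} u * ?w u)" using integrable_indicator_Icc[of a b ?w]
    by simp
  note ext = has_bochner_integral_even_ext[OF less_imp_le[OF a] int]
  have "fourier_energy \<alpha> r (band a b v) = (\<integral>\<^sup>+u. ennreal (even_ext a b ?w u) \<partial>lborel)"
    unfolding fourier_energy_def fourier_band_profile by (intro nn_integral_cong) (simp add: even_ext_def)
  also have "\<dots> = ennreal (LINT u|lborel. even_ext a b ?w u)"
    by (rule nn_integral_eq_integral[OF integrable.intros[OF ext]]) (simp add: even_ext_def)
  also have "(LINT u|lborel. even_ext a b ?w u) = 2 * (LINT u|lborel. indicator {a..b} u * ?w u)"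
    by (rule has_bochner_integral_integral_eq[OF ext])
  finally show ?thesis .
qed

end

section \<open>A base density with quadratic decay and compact spectrum\<close>

subsection \<open>The Fejer kernel\<close>

definition fejer :: "real \<Rightarrow> real" where
  "fejer = band 0 1 (\<lambda>u. 1 - u)"

lemma even_ext_triangle: "even_ext 0 1 (\<lambda>u. 1 - u) = (\<lambda>u. max 0 (1 - \<bar>u\<bar>))"
  by (auto simp: even_ext_def)

lemma continuous_on_fejer: "continuous_on S fejer"
  unfolding fejer_def by (intro continuous_on_band continuous_intros) simp

lemma borel_measurable_fejer[measurable]: "fejer \<in> borel_measurable borel"
  by (intro borel_measurable_continuous_onI continuous_on_fejer)

lemma fejer_eq:
  assumes "y \<noteq> 0" shows "fejer y = (1 - cos y) / (pi * y\<^sup>2)"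
proof -
  have "(LINT u|lborel. indicator {0..1} u *\<^sub>R ((1 - u) * cos (u * y)))
      = ((1 - 1) * sin (1 * y) / y - cos (1 * y) / y\<^sup>2) - ((1 - 0) * sin (0 * y) / y - cos (0 * y) / y\<^sup>2)"
  proof (rule integral_FTC_Icc)
    fix u
    have "((\<lambda>u. (1 - u) * sin (u * y) / y - cos (u * y) / y\<^sup>2) has_real_derivative (1 - u) * cos (u * y))
        (at u within {0..1})"
      using assms by (auto intro!: derivative_eq_intros simp: field_simps power2_eq_square)
    then show "((\<lambda>u. (1 - u) * sin (u * y) / y - cos (u * y) / y\<^sup>2) has_vector_derivative
        (1 - u) * cos (u * y)) (at u within {0..1})"
      by (simp add: has_real_derivative_iff_has_vector_derivative)
  qed (auto intro!: continuous_intros)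
  then show ?thesis by (simp add: fejer_def band_def diff_divide_distrib mult.commute)
qed

lemma fejer_nonneg: "0 \<le> fejer y"
proof (cases "y = 0")
  case True
  then show ?thesis unfolding fejer_def band_def
    by (intro divide_nonneg_nonneg integral_nonneg_AE) (auto split: split_indicator)
qed (simp add: fejer_eq)

lemma fejer_le_one: "fejer y \<le> 1"
proof -
  have "\<bar>fejer y\<bar> \<le> (LINT u|lborel. \<bar>even_ext 0 1 (\<lambda>u. 1 - u) u\<bar>) / (2 * pi)"
    unfolding fejer_def by (intro abs_band_le continuous_intros) simp
  also have "(LINT u|lborel. \<bar>even_ext 0 1 (\<lambda>u. 1 - u) u\<bar>) \<le> (LINT u|lborel. indicator {-1..1::real} u)"
  proof (intro integral_mono integrable_abs integrable_even_ext continuous_intros)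
    show "\<bar>even_ext 0 1 (\<lambda>u. 1 - u) u\<bar> \<le> indicator {-1..1} u" for u :: real
      by (auto simp: even_ext_def split: split_indicator)
  qed auto
  finally have "\<bar>fejer y\<bar> \<le> 1 / pi" by (simp add: divide_right_mono)
  also have "\<dots> \<le> 1" using pi_ge_two by simp
  finally show ?thesis by simp
qed

lemma fejer_le: "fejer y \<le> 2 / (1 + y\<^sup>2)"
proof (cases "\<bar>y\<bar> \<le> 1")
  case True
  then have "1 \<le> 2 / (1 + y\<^sup>2)" by (simp add: abs_square_le_1 pos_le_divide_eq one_plus_square_pos)
  then show ?thesis using fejer_le_one[of y] by linarith
next
  case False
  then have y: "y \<noteq> 0" "1 \<le> y\<^sup>2" by (auto, metis abs_square_le_1 linorder_le_cases)
  then have "fejer y \<le> 2 / (2 * y\<^sup>2)"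
    unfolding fejer_eq[OF y(1)] using cos_ge_minus_one[of y] pi_ge_two
    by (intro frac_le mult_right_mono) (auto simp del: cos_ge_minus_one)
  also have "\<dots> \<le> 2 / (1 + y\<^sup>2)" using y by (intro divide_left_mono mult_pos_pos one_plus_square_pos) auto
  finally show ?thesis .
qed

lemma fejer_ge:
  assumes "\<bar>y\<bar> \<le> d" "0 < d" shows "(1 - cos y) / (pi * d\<^sup>2) \<le> fejer y"
proof (cases "y = 0")
  case False
  have "y\<^sup>2 \<le> d\<^sup>2" using assms by (simp add: power2_le_iff_abs_le)
  then show ?thesis unfolding fejer_eq[OF False] using False \<open>0 < d\<close>
    by (intro divide_left_mono mult_left_mono mult_pos_pos) auto
qed (simp add: fejer_nonneg)

lemma integrable_fejer: "integrable lborel fejer"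
  by (rule integrable_inverse_square_decay[of _ 2]) (auto simp: fejer_nonneg fejer_le)

lemma fourier_fejer: "fourier fejer u = complex_of_real (max 0 (1 - \<bar>u\<bar>))"
proof -
  have "isCont (even_ext 0 1 (\<lambda>u. 1 - u)) (- u)"
    unfolding even_ext_triangle by (intro continuous_intros)
  then show ?thesis
    using integrable_fejer unfolding fejer_def
    by (subst fourier_band) (auto intro: continuous_intros simp: even_ext_triangle)
qed

subsection \<open>The base density\<close>

text \<open>The second Fejer kernel is shifted by \<open>\<pi>\<close> because the first one vanishes at the nonzero multiples of
  \<open>2\<pi>\<close>.\<close>

definition base_density :: "real \<Rightarrow> real \<Rightarrow> real" where
  "base_density \<sigma> y = (fejer (y / \<sigma>) + fejer (y / \<sigma> - pi)) / (2 * \<sigma>)"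

lemma integrable_dilation:
  fixes g :: "real \<Rightarrow> real"
  assumes "integrable lborel g" "0 < \<sigma>" shows "integrable lborel (\<lambda>y. g (y / \<sigma>))"
  using lborel_integrable_real_affine[OF assms(1), of "1 / \<sigma>" 0] assms(2) by simp

lemma integrable_base_density: "0 < \<sigma> \<Longrightarrow> integrable lborel (base_density \<sigma>)"
  unfolding base_density_def
  by (intro integrable_divide Bochner_Integration.integrable_add integrable_dilation[OF integrable_fejer]
      integrable_dilation[OF integrable_lborel_shift[OF integrable_fejer]])

lemma fourier_base_density:
  assumes "0 < \<sigma>"
  shows "fourier (base_density \<sigma>) u = (1 + cis (pi * (\<sigma> * u))) / 2 * complex_of_real (max 0 (1 - \<bar>\<sigma> * u\<bar>))"
proof -
  have "base_density \<sigma> = (\<lambda>y. 1 / (2 * \<sigma>) * (fejer (y / \<sigma>) + fejer (y / \<sigma> - pi)))"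
    by (simp add: base_density_def fun_eq_iff)
  then have "fourier (base_density \<sigma>) u
      = complex_of_real (1 / (2 * \<sigma>)) * fourier (\<lambda>y. fejer (y / \<sigma>) + fejer (y / \<sigma> - pi)) u"
    by (simp only: fourier_cmult)
  also have "\<dots> = complex_of_real (1 / (2 * \<sigma>))
      * (fourier (\<lambda>y. fejer (y / \<sigma>)) u + fourier (\<lambda>y. fejer (y / \<sigma> - pi)) u)"
    by (simp only: fourier_add[OF integrable_dilation[OF integrable_fejer assms]
          integrable_dilation[OF integrable_lborel_shift[OF integrable_fejer] assms]])
  also have "\<dots> = (1 + cis (pi * (\<sigma> * u))) / 2 * complex_of_real (max 0 (1 - \<bar>\<sigma> * u\<bar>))"
    using fourier_dilation[OF assms, of fejer u] fourier_dilation[OF assms, of "\<lambda>z. fejer (z - pi)" u] assms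
    by (simp add: fourier_shift fourier_fejer field_simps)
  finally show ?thesis .
qed

lemma norm_fourier_base_density_le:
  assumes "0 < \<sigma>" shows "cmod (fourier (base_density \<sigma>) u) \<le> indicator {- (1 / \<sigma>)..1 / \<sigma>} u"
proof -
  have "cmod (1 + cis (pi * (\<sigma> * u))) \<le> 2"
    using norm_triangle_ineq[of 1 "cis (pi * (\<sigma> * u))"] by simp
  then have "cmod (fourier (base_density \<sigma>) u) \<le> 1 * max 0 (1 - \<bar>\<sigma> * u\<bar>)"
    unfolding fourier_base_density[OF assms] norm_mult norm_divide by (intro mult_mono) auto
  also have "\<dots> \<le> indicator {- (1 / \<sigma>)..1 / \<sigma>} u"
    using assms by (auto simp: indicator_def abs_mult abs_if field_simps)
  finally show ?thesis .
qed

lemma prob_density_base_density: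
  assumes "0 < \<sigma>" shows "prob_density (base_density \<sigma>)"
proof -
  have "complex_of_real (LINT y|lborel. base_density \<sigma> y) = 1"
    unfolding of_real_integral_eq_fourier_zero fourier_base_density[OF assms] by simp
  moreover have "0 \<le> base_density \<sigma> y" for y
    unfolding base_density_def using assms by (intro divide_nonneg_nonneg add_nonneg_nonneg fejer_nonneg) auto
  ultimately show ?thesis
    using integrable_base_density[OF assms] by (auto simp: prob_density_def of_real_eq_1_iff)
qed

lemma continuous_on_base_density: "0 < \<sigma> \<Longrightarrow> continuous_on S (base_density \<sigma>)"
  unfolding base_density_def
  by (intro continuous_intros continuous_on_compose2[OF continuous_on_fejer[of UNIV]]) auto

lemma base_density_le: "0 < \<sigma> \<Longrightarrow> base_density \<sigma> y \<le> 1 / \<sigma>"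
  using add_mono[OF fejer_le_one[of "y / \<sigma>"] fejer_le_one[of "y / \<sigma> - pi"]]
  by (simp add: base_density_def divide_le_eq)

lemma base_density_ge:
  assumes \<sigma>: "1 \<le> \<sigma>"
  shows "1 / (2 * pi ^ 3 * \<sigma>) / (1 + y\<^sup>2) \<le> base_density \<sigma> y"
proof -
  define z where "z = y / \<sigma>"
  have d: "0 < \<bar>z\<bar> + pi" by (simp add: add_nonneg_pos)
  have "2 / (pi * (\<bar>z\<bar> + pi)\<^sup>2)
      = (1 - cos z) / (pi * (\<bar>z\<bar> + pi)\<^sup>2) + (1 - cos (z - pi)) / (pi * (\<bar>z\<bar> + pi)\<^sup>2)"
    by (simp add: cos_diff flip: add_divide_distrib)
  also have "\<dots> \<le> fejer z + fejer (z - pi)"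
    by (intro add_mono fejer_ge d; use pi_gt_zero in linarith)
  finally have sum_ge: "2 / (pi * (\<bar>z\<bar> + pi)\<^sup>2) \<le> fejer z + fejer (z - pi)" .
  have "\<bar>z\<bar> * 1 \<le> \<bar>z\<bar> * \<sigma>" using \<sigma> by (intro mult_left_mono) auto
  then have "z\<^sup>2 \<le> y\<^sup>2" using \<sigma> by (simp add: z_def abs_le_square_iff[symmetric])
  moreover have pi1: "1 \<le> pi\<^sup>2" using pi_ge_two by (intro one_le_power) linarith
  ultimately have "z\<^sup>2 \<le> pi\<^sup>2 * y\<^sup>2" using mult_right_mono[OF pi1, of "y\<^sup>2"] by simp
  then have "(\<bar>z\<bar> + pi)\<^sup>2 \<le> 2 * pi\<^sup>2 * (1 + y\<^sup>2)"
    using sum_squares_bound[of "\<bar>z\<bar>" pi] by (simp add: power2_eq_square algebra_simps)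
  moreover have "1 / (2 * pi ^ 3 * \<sigma>) / (1 + y\<^sup>2) = 2 / (pi * (2 * pi\<^sup>2 * (1 + y\<^sup>2))) / (2 * \<sigma>)"
    by (simp add: power3_eq_cube power2_eq_square)
  ultimately have "1 / (2 * pi ^ 3 * \<sigma>) / (1 + y\<^sup>2) \<le> 2 / (pi * (\<bar>z\<bar> + pi)\<^sup>2) / (2 * \<sigma>)"
    using d \<sigma> by (simp only:)
      (intro divide_right_mono divide_left_mono mult_left_mono mult_pos_pos one_plus_square_pos; simp)
  also have "\<dots> \<le> base_density \<sigma> y"
    unfolding base_density_def z_def[symmetric] using sum_ge \<sigma> by (intro divide_right_mono) auto
  finally show ?thesis .
qed

lemma fourier_energy_base_density_le:
  assumes \<sigma>: "1 \<le> \<sigma>" and "0 \<le> \<alpha>" "0 \<le> r"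
  shows "fourier_energy \<alpha> r (base_density \<sigma>) \<le> ennreal (2 * exp (2 * \<alpha>) / \<sigma>)"
proof -
  have bound: "ennreal ((cmod (fourier (base_density \<sigma>) u))\<^sup>2 * exp (2 * \<alpha> * \<bar>u\<bar> powr r))
      \<le> ennreal (exp (2 * \<alpha>)) * indicator {-(1 / \<sigma>)..1 / \<sigma>} u" for u
  proof (cases "u \<in> {-(1 / \<sigma>)..1 / \<sigma>}")
    case True
    then have "\<bar>u\<bar> \<le> 1 / \<sigma>" by auto
    also have "\<dots> \<le> 1" using \<sigma> by simp
    finally have "\<bar>u\<bar> powr r \<le> 1" using \<open>0 \<le> r\<close> by (metis abs_ge_zero powr_mono2 powr_one_eq_one)
    then have "exp (2 * \<alpha> * \<bar>u\<bar> powr r) \<le> exp (2 * \<alpha>)" using \<open>0 \<le> \<alpha>\<close> by (simp add: mult_left_le)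
    moreover have "(cmod (fourier (base_density \<sigma>) u))\<^sup>2 \<le> 1"
      using norm_fourier_base_density_le[of \<sigma> u] \<sigma> True by (simp add: abs_square_le_1)
    ultimately have "(cmod (fourier (base_density \<sigma>) u))\<^sup>2 * exp (2 * \<alpha> * \<bar>u\<bar> powr r) \<le> 1 * exp (2 * \<alpha>)"
      by (intro mult_mono) auto
    then show ?thesis using True by (simp add: ennreal_leI)
  qed (use norm_fourier_base_density_le[of \<sigma> u] \<sigma> in simp)
  have "fourier_energy \<alpha> r (base_density \<sigma>)
      \<le> (\<integral>\<^sup>+u. ennreal (exp (2 * \<alpha>)) * indicator {-(1 / \<sigma>)..1 / \<sigma>} u \<partial>lborel)"
    unfolding fourier_energy_def by (intro nn_integral_mono bound)
  also have "\<dots> = ennreal (2 * exp (2 * \<alpha>) / \<sigma>)"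
    using \<sigma> by (simp add: nn_integral_cmult_indicator ennreal_mult'[symmetric] mult.commute)
  finally show ?thesis .
qed

section \<open>Perturbations inside the smoothness class\<close>

lemma prob_density_shift: "prob_density f \<Longrightarrow> prob_density (\<lambda>y. f (y - x))"
  using integrable_lborel_shift[of f x] integral_lborel_shift[of f x] by (auto simp: prob_density_def)

lemma dens_class_shift:
  assumes "f \<in> dens_class \<alpha> r L" shows "(\<lambda>y. f (y - x)) \<in> dens_class \<alpha> r L"
proof -
  have "continuous_on UNIV (\<lambda>y. f (y - x))"
    by (rule continuous_on_compose2[of UNIV f])
      (use assms in \<open>auto simp: dens_class_iff intro!: continuous_intros\<close>)
  moreover have "fourier_energy \<alpha> r (\<lambda>y. f (y - x)) = fourier_energy \<alpha> r f"
    by (simp add: fourier_energy_def fourier_shift[of f x] norm_mult)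
  ultimately show ?thesis using assms prob_density_shift[of f x] by (simp add: dens_class_iff)
qed

lemma prob_density_add:
  assumes f: "prob_density f" and g: "integrable lborel g" "(LINT y|lborel. g y) = 0" "\<And>y. \<bar>g y\<bar> \<le> f y"
  shows "prob_density (\<lambda>y. f y + g y)"
proof -
  have "0 \<le> f y + g y" for y using g(3)[of y] by linarith
  then show ?thesis using f g by (auto simp: prob_density_def)
qed

lemma fourier_energy_add_disjoint:
  assumes f: "integrable lborel f" and g: "integrable lborel g"
    and disj: "\<And>u. fourier f u = 0 \<or> fourier g u = 0"
  shows "fourier_energy \<alpha> r (\<lambda>y. f y + g y) = fourier_energy \<alpha> r f + fourier_energy \<alpha> r g"
proof -
  note [measurable] = borel_measurable_fourier[OF f] borel_measurable_fourier[OF g]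
  have "(cmod (fourier (\<lambda>y. f y + g y) u))\<^sup>2 = (cmod (fourier f u))\<^sup>2 + (cmod (fourier g u))\<^sup>2" for u
    using disj[of u] by (auto simp: fourier_add[OF f g])
  then show ?thesis
    unfolding fourier_energy_def by (simp add: distrib_right nn_integral_add)
qed

lemma dens_class_add:
  assumes f: "prob_density f" "continuous_on UNIV f"
    and g: "integrable lborel g" "(LINT y|lborel. g y) = 0" "continuous_on UNIV g" "\<And>y. \<bar>g y\<bar> \<le> f y"
    and disj: "\<And>u. fourier f u = 0 \<or> fourier g u = 0"
    and energy: "fourier_energy \<alpha> r f + fourier_energy \<alpha> r g \<le> ennreal (2 * pi * L)"
  shows "(\<lambda>y. f y + g y) \<in> dens_class \<alpha> r L"
  using energy f g
  by (simp add: dens_class_iff prob_density_add continuous_on_add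
      fourier_energy_add_disjoint[OF prob_densityD(3)[OF f(1)] g(1) disj])

lemma fourier_energy_uminus: "fourier_energy \<alpha> r (\<lambda>y. - f y) = fourier_energy \<alpha> r f"
  using fourier_cmult[of "- 1" f] by (simp add: fourier_energy_def)

section \<open>Lower bound at a fixed frequency\<close>

subsection \<open>The base density perturbed by a band-limited function\<close>

locale perturbed_base = band_profile +
  fixes fe :: "real \<Rightarrow> real" and \<alpha> r L \<sigma> m E :: real
  assumes noise: "prob_density fe" and m: "0 < m" "1 / 2 \<le> (LINT e|lborel. indicator {-m..m} e * fe e)"
    and \<alpha>: "0 \<le> \<alpha>" and r: "0 \<le> r" and \<sigma>: "1 \<le> \<sigma>" and beyond_base: "1 < a"
    and amplitude: "2 * (B * k\<^sup>2) * (b - a) / pi \<le> 1 / (2 * pi ^ 3 * \<sigma>)"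
    and energy: "exp (2 * \<alpha>) / \<sigma> + (LINT u|lborel. indicator {a..b} u * ((v u)\<^sup>2 * exp (2 * \<alpha> * u powr r)))
        \<le> pi * L"
    and conv_le: "\<And>y. \<bar>conv (band a b v) fe y\<bar> \<le> E / (1 + y\<^sup>2)"
begin

abbreviation "f0 \<equiv> base_density \<sigma>"
abbreviation "G \<equiv> band a b v"
abbreviation "\<kappa> \<equiv> chi_square_bound (1 / (2 * pi ^ 3 * \<sigma>)) m E"

lemma abs_band_le_base_density: "\<bar>G y\<bar> \<le> f0 y"
proof -
  have "\<bar>G y\<bar> \<le> 2 * (B * k\<^sup>2) * (b - a) / pi / (1 + y\<^sup>2)" by (rule abs_band_le_decay)
  also have "\<dots> \<le> 1 / (2 * pi ^ 3 * \<sigma>) / (1 + y\<^sup>2)" by (rule divide_right_mono[OF amplitude]) simp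
  also have "\<dots> \<le> f0 y" by (rule base_density_ge[OF \<sigma>])
  finally show ?thesis .
qed

lemma spectra_disjoint: "fourier f0 u = 0 \<or> fourier G u = 0"
proof (cases "a \<le> \<bar>u\<bar>")
  case True
  have "1 / \<sigma> \<le> 1" using \<sigma> by simp
  then have "u \<notin> {- (1 / \<sigma>)..1 / \<sigma>}" using True beyond_base by (auto simp: abs_if split: if_splits)
  then show ?thesis using norm_fourier_base_density_le[of \<sigma> u] \<sigma> by simp
qed (simp add: fourier_band_profile even_ext_def)

lemma fourier_energy_le: "fourier_energy \<alpha> r f0 + fourier_energy \<alpha> r G \<le> ennreal (2 * pi * L)"
proof -
  let ?I = "LINT u|lborel. indicator {a..b} u * ((v u)\<^sup>2 * exp (2 * \<alpha> * u powr r))"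
  have "0 \<le> ?I" by (intro integral_nonneg_AE AE_I2) auto
  then have "fourier_energy \<alpha> r f0 + fourier_energy \<alpha> r G \<le> ennreal (2 * exp (2 * \<alpha>) / \<sigma> + 2 * ?I)"
    using fourier_energy_base_density_le[OF \<sigma> \<alpha> r] \<sigma> by (simp add: fourier_energy_band add_right_mono)
  also have "\<dots> \<le> ennreal (2 * pi * L)" using energy by (intro ennreal_leI) simp
  finally show ?thesis .
qed

lemma plus_in_dens_class: "(\<lambda>y. f0 (y - x) + G (y - x)) \<in> dens_class \<alpha> r L"
proof (rule dens_class_shift[of "\<lambda>y. f0 y + G y"], rule dens_class_add)
  show "continuous_on UNIV G" by (rule continuous_on_band[OF less_imp_le[OF a] continuous_on_profile])
qed (use \<sigma> in \<open>auto intro: prob_density_base_density continuous_on_base_density integrable_band integral_band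
      abs_band_le_base_density fourier_energy_le simp: spectra_disjoint[simplified]\<close>)

lemma minus_in_dens_class: "(\<lambda>y. f0 (y - x) - G (y - x)) \<in> dens_class \<alpha> r L"
proof -
  have "(\<lambda>y. f0 y + - G y) \<in> dens_class \<alpha> r L"
  proof (rule dens_class_add)
    show "continuous_on UNIV (\<lambda>y. - G y)"
      by (intro continuous_on_minus continuous_on_band[OF less_imp_le[OF a] continuous_on_profile])
    show "fourier f0 u = 0 \<or> fourier (\<lambda>y. - G y) u = 0" for u
      using spectra_disjoint[of u] fourier_cmult[of "- 1" G u] by simp
  qed (use \<sigma> fourier_energy_le
      in \<open>auto intro: prob_density_base_density continuous_on_base_density integrable_band
        abs_band_le_base_density simp: integral_band fourier_energy_uminus\<close>)
  from dens_class_shift[OF this, of x] show ?thesis by simp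
qed

lemma two_hypotheses_shift:
  "two_hypotheses fe (\<lambda>y. f0 (y - x)) (\<lambda>y. G (y - x)) (1 / \<sigma>) (1 / (2 * pi ^ 3 * \<sigma>)) m x E"
proof
  show "prob_density (\<lambda>y. f0 (y - x) + G (y - x))" "prob_density (\<lambda>y. f0 (y - x) - G (y - x))"
    using plus_in_dens_class[of x] minus_in_dens_class[of x] by (auto simp: dens_class_iff)
  show "prob_density (\<lambda>y. f0 (y - x))" using \<sigma>
    by (intro prob_density_shift[of f0] prob_density_base_density) simp
  show "\<bar>conv (\<lambda>y. G (y - x)) fe y\<bar> \<le> E / (1 + (y - x)\<^sup>2)" for y unfolding conv_shift[of G] by (rule conv_le)
qed (use \<sigma> noise m base_density_le[of \<sigma>] base_density_ge[OF \<sigma>] in auto)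

lemma risk_pt_lower_bound:
  assumes "T \<in> estimators n"
  shows "ennreal ((G 0)\<^sup>2 * affinity_bound \<kappa> n) \<le> risk_pt fe \<alpha> r L n x T"
  using two_hypotheses.risk_pt_lower_bound[OF two_hypotheses_shift plus_in_dens_class minus_in_dens_class
      assms, of x x]
  by simp

lemma risk_L2_lower_bound:
  assumes "T \<in> estimators n"
  shows "ennreal ((LINT u|lborel. indicator {a..b} u * (v u)\<^sup>2) / pi * affinity_bound \<kappa> n)
      \<le> risk_L2 fe \<alpha> r L n T"
proof -
  note band = less_imp_le[OF a] continuous_on_profile
  have "integrable lborel (\<lambda>y. (G (y - 0))\<^sup>2)"
    using integrable_band_square[OF band integrable_band] by simp
  from two_hypotheses.risk_L2_lower_bound[OF two_hypotheses_shift plus_in_dens_class minus_in_dens_class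
      assms this]
  show ?thesis using integral_band_square[OF band isCont_even_ext integrable_band] by simp
qed

end

subsection \<open>Smooth cut-offs\<close>

definition cutoff :: "real \<Rightarrow> real \<Rightarrow> real \<Rightarrow> real \<Rightarrow> real" where
  "cutoff a b m u = (1 - exp (- m * (u - a)))\<^sup>2 * (1 - exp (m * (u - b)))\<^sup>2"

lemma cutoff_nonneg: "0 \<le> cutoff a b m u"
  by (simp add: cutoff_def)

lemma cutoff_le_one:
  assumes "0 \<le> m" "a \<le> u" "u \<le> b" shows "cutoff a b m u \<le> 1"
proof -
  have "exp (- m * (u - a)) \<le> 1" "exp (m * (u - b)) \<le> 1" using assms by (auto simp: mult_nonneg_nonpos)
  then have "(1 - exp (- m * (u - a)))\<^sup>2 \<le> 1" "(1 - exp (m * (u - b)))\<^sup>2 \<le> 1" by (auto simp: abs_square_le_1)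
  then show ?thesis unfolding cutoff_def by (intro mult_le_one) auto
qed

lemma cutoff_ge:
  assumes "0 \<le> m" "0 \<le> t" "a + t \<le> u" "u \<le> b - t"
  shows "(1 - exp (- m * t)) ^ 4 \<le> cutoff a b m u"
proof -
  have "m * t \<le> m * (u - a)" "m * t \<le> m * (b - u)" using assms by (auto intro!: mult_left_mono)
  then have "exp (- m * t) \<le> 1" "exp (- m * (u - a)) \<le> exp (- m * t)" "exp (m * (u - b)) \<le> exp (- m * t)"
    using assms by (auto simp: right_diff_distrib)
  then have "(1 - exp (- m * t))\<^sup>2 * (1 - exp (- m * t))\<^sup>2 \<le> cutoff a b m u"
    unfolding cutoff_def by (intro mult_mono power_mono) auto
  then show ?thesis by (simp flip: power_add)
qed

lemma C2_bound_one_minus_exp: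
  assumes "\<And>u. u \<in> S \<Longrightarrow> c * (u - t) \<le> 0"
  shows "C2_bound S 1 \<bar>c\<bar> (\<lambda>u. complex_of_real (1 - exp (c * (u - t))))
    (\<lambda>u. complex_of_real (- (c * exp (c * (u - t))))) (\<lambda>u. complex_of_real (- (c\<^sup>2 * exp (c * (u - t)))))"
proof (rule C2_bound_of_real)
  fix u assume "u \<in> S"
  then have le: "exp (c * (u - t)) \<le> 1" using assms by simp
  show "((\<lambda>u. 1 - exp (c * (u - t))) has_real_derivative - (c * exp (c * (u - t)))) (at u within S)"
    by (auto intro!: derivative_eq_intros)
  show "((\<lambda>u. - (c * exp (c * (u - t)))) has_real_derivative - (c\<^sup>2 * exp (c * (u - t)))) (at u within S)"
    by (auto intro!: derivative_eq_intros simp: power2_eq_square)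
  show "\<bar>1 - exp (c * (u - t))\<bar> \<le> 1" using le by simp
  show "\<bar>- (c * exp (c * (u - t)))\<bar> \<le> 1 * \<bar>c\<bar>" using mult_left_le[OF le abs_ge_zero[of c]]
    by (simp add: abs_mult)
  show "\<bar>- (c\<^sup>2 * exp (c * (u - t)))\<bar> \<le> 1 * \<bar>c\<bar>\<^sup>2" using mult_left_le[OF le, of "c\<^sup>2"] by (simp add: abs_mult)
qed (auto intro!: continuous_intros)

lemma exp_powr_derivative_factor_bounds:
  fixes \<alpha> r b u :: real
  defines "p \<equiv> 2 * \<alpha> * r * u powr (r - 1)" and "q \<equiv> 2 * \<alpha> * r * (r - 1) * u powr (r - 2)"
  assumes \<alpha>: "0 \<le> \<alpha>" and r: "0 \<le> r" "r \<le> 2" and u: "1 \<le> u" "u \<le> b"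
  shows "\<bar>p\<bar> \<le> (2 * \<alpha> * r + 1) * b" and "\<bar>p\<^sup>2 - q\<bar> \<le> ((2 * \<alpha> * r + 1) * b)\<^sup>2"
proof -
  define A where "A = 2 * \<alpha> * r"
  have A: "0 \<le> A" using \<alpha> r by (simp add: A_def)
  have "u powr (r - 1) \<le> u powr 1" using u r by (intro powr_mono) auto
  then have "u powr (r - 1) \<le> b" using u by simp
  then have p: "\<bar>p\<bar> \<le> A * b" using A by (simp add: p_def A_def[symmetric] abs_mult mult_left_mono)
  also have "\<dots> \<le> (A + 1) * b" using u by (simp add: algebra_simps)
  finally show "\<bar>p\<bar> \<le> (2 * \<alpha> * r + 1) * b" by (simp add: A_def)
  have "u powr (r - 2) \<le> 1" using powr_mono[of "r - 2" 0 u] u r by simp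
  then have "\<bar>r - 1\<bar> * u powr (r - 2) \<le> 1 * 1" using r by (intro mult_mono) auto
  from mult_left_mono[OF this A] have "\<bar>A * ((r - 1) * u powr (r - 2))\<bar> \<le> A" using A by (simp add: abs_mult)
  then have q: "\<bar>q\<bar> \<le> A" by (simp add: q_def A_def[symmetric] mult.assoc[symmetric])
  have "p\<^sup>2 \<le> (A * b)\<^sup>2" using p A u by (simp add: power2_le_iff_abs_le)
  then have "\<bar>p\<^sup>2 - q\<bar> \<le> (A * b)\<^sup>2 + A" using q zero_le_power2[of p] by linarith
  also have "\<dots> \<le> (A * b)\<^sup>2 + 2 * (A * b\<^sup>2) + b\<^sup>2"
  proof -
    have b: "1 \<le> b\<^sup>2" using u by (intro one_le_power) auto
    then have "A * 1 \<le> A * b\<^sup>2" using A by (intro mult_left_mono) auto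
    then show ?thesis using A b by linarith
  qed
  also have "\<dots> = ((2 * \<alpha> * r + 1) * b)\<^sup>2" unfolding A_def[symmetric]
    by (simp add: power2_eq_square algebra_simps)
  finally show "\<bar>p\<^sup>2 - q\<bar> \<le> ((2 * \<alpha> * r + 1) * b)\<^sup>2" .
qed

lemma C2_bound_exp_powr:
  assumes \<alpha>: "0 \<le> \<alpha>" and r: "0 \<le> r" "r \<le> 2" and a: "1 \<le> a" and ab: "a \<le> b"
  shows "C2_bound {a..b} (exp (- 2 * \<alpha> * a powr r)) ((2 * \<alpha> * r + 1) * b)
    (\<lambda>u. complex_of_real (exp (- 2 * \<alpha> * u powr r)))
    (\<lambda>u. complex_of_real (- (2 * \<alpha> * r * u powr (r - 1)) * exp (- 2 * \<alpha> * u powr r)))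
    (\<lambda>u. complex_of_real (((2 * \<alpha> * r * u powr (r - 1))\<^sup>2 - 2 * \<alpha> * r * (r - 1) * u powr (r - 2))
        * exp (- 2 * \<alpha> * u powr r)))"
proof (rule C2_bound_of_real)
  let ?k = "(2 * \<alpha> * r + 1) * b" and ?e = "\<lambda>u. exp (- 2 * \<alpha> * u powr r)"
  show "0 \<le> ?k" using assms by simp
  show "continuous_on {a..b} (\<lambda>u. ((2 * \<alpha> * r * u powr (r - 1))\<^sup>2 - 2 * \<alpha> * r * (r - 1) * u powr (r - 2))
      * ?e u)"
    using a by (intro continuous_intros) auto
  fix u assume u: "u \<in> {a..b}"
  then have u1: "1 \<le> u" "u \<le> b" "0 < u" using a by auto
  note bounds = exp_powr_derivative_factor_bounds[OF \<alpha> r u1(1,2)]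
  have e: "?e u \<le> ?e a" using u a r \<alpha> by (auto intro!: powr_mono2 mult_left_mono)
  then show "\<bar>?e u\<bar> \<le> ?e a" by simp
  show "(?e has_real_derivative - (2 * \<alpha> * r * u powr (r - 1)) * ?e u) (at u within {a..b})"
    using u1 by (auto intro!: derivative_eq_intros)
  show "((\<lambda>u. - (2 * \<alpha> * r * u powr (r - 1)) * ?e u) has_real_derivative
      ((2 * \<alpha> * r * u powr (r - 1))\<^sup>2 - 2 * \<alpha> * r * (r - 1) * u powr (r - 2)) * ?e u) (at u within {a..b})"
    using u1 by (auto intro!: derivative_eq_intros simp: power2_eq_square algebra_simps)
  show "\<bar>- (2 * \<alpha> * r * u powr (r - 1)) * ?e u\<bar> \<le> ?e a * ?k"
    unfolding abs_mult[of _ "?e u"] abs_minus_cancel mult.commute[of "?e a"]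
    using bounds(1) e by (intro mult_mono) auto
  show "\<bar>((2 * \<alpha> * r * u powr (r - 1))\<^sup>2 - 2 * \<alpha> * r * (r - 1) * u powr (r - 2)) * ?e u\<bar> \<le> ?e a * ?k\<^sup>2"
    unfolding abs_mult[of _ "?e u"] mult.commute[of "?e a"] using bounds(2) e by (intro mult_mono) auto
qed simp

subsection \<open>The extremal profile\<close>

definition exp_integral :: "real \<Rightarrow> real \<Rightarrow> real \<Rightarrow> real \<Rightarrow> real" where
  "exp_integral \<alpha> r a b = (LINT u|lborel. indicator {a..b} u * exp (- 2 * \<alpha> * u powr r))"

definition cut_mass :: "real \<Rightarrow> real \<Rightarrow> real \<Rightarrow> real \<Rightarrow> real" where
  "cut_mass \<alpha> r a b = (LINT u|lborel. indicator {a..b} u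
      * ((cutoff a b (a\<^sup>2) u)\<^sup>2 * exp (- 2 * \<alpha> * u powr r)))"

text \<open>On the band the profile is the smoothed extremal function of the Cauchy-Schwarz inequality that bounds the
  bias; the amplitude gives its even extension the energy \<open>2\<pi>L\<close>.\<close>

definition extremal_profile :: "real \<Rightarrow> real \<Rightarrow> real \<Rightarrow> real \<Rightarrow> real \<Rightarrow> real \<Rightarrow> real" where
  "extremal_profile \<alpha> r L a b u
      = sqrt (pi * L / cut_mass \<alpha> r a b) * (cutoff a b (a\<^sup>2) u * exp (- 2 * \<alpha> * u powr r))"

lemma integrable_cutoff_exp:
  assumes "0 < a'"
  shows "integrable lborel (\<lambda>u. indicator {a'..b'} u * (cutoff a b m u ^ j * exp (- 2 * \<alpha> * u powr r)))"
proof -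
  have "continuous_on {a'..b'} (\<lambda>u. cutoff a b m u ^ j * exp (- 2 * \<alpha> * u powr r))"
    using assms unfolding cutoff_def by (intro continuous_intros) auto
  from integrable_indicator_Icc[OF this] show ?thesis by simp
qed

lemma integrable_exp_integral:
  fixes a b \<alpha> r :: real
  assumes "0 < a" shows "integrable lborel (\<lambda>u. indicator {a..b} u * exp (- 2 * \<alpha> * u powr r))"
  using integrable_cutoff_exp[of a b 0 0 0 0, OF assms] by simp

lemma exp_integral_nonneg: "0 \<le> exp_integral \<alpha> r a b"
  unfolding exp_integral_def by (intro integral_nonneg_AE AE_I2) auto

lemma exp_integral_ge:
  assumes "0 \<le> \<alpha>" "0 \<le> r" "0 < a" "a \<le> b"
  shows "(b - a) * exp (- 2 * \<alpha> * b powr r) \<le> exp_integral \<alpha> r a b"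
proof -
  have "(b - a) * exp (- 2 * \<alpha> * b powr r) = (LINT u|lborel. indicator {a..b} u * exp (- 2 * \<alpha> * b powr r))"
    using assms by simp
  also have "\<dots> \<le> exp_integral \<alpha> r a b"
    unfolding exp_integral_def
  proof (rule integral_mono[OF _ integrable_exp_integral[OF \<open>0 < a\<close>]])
    fix u show "indicator {a..b} u * exp (- 2 * \<alpha> * b powr r) \<le> indicator {a..b} u * exp (- 2 * \<alpha> * u powr r)"
      using assms by (auto intro!: mult_left_mono powr_mono2 split: split_indicator)
  qed (use assms in auto)
  finally show ?thesis .
qed

lemma cut_mass_ge:
  assumes "0 < a" "0 \<le> t" "a + t \<le> b'" "b' \<le> b - t"
  shows "(1 - exp (- a\<^sup>2 * t)) ^ 8 * exp_integral \<alpha> r (a + t) b' \<le> cut_mass \<alpha> r a b"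
  unfolding exp_integral_def cut_mass_def integral_mult_right_zero[symmetric]
proof (rule integral_mono[OF integrable_mult_right[OF integrable_exp_integral] integrable_cutoff_exp])
  fix u
  have "(1 - exp (- a\<^sup>2 * t)) ^ 8 \<le> (cutoff a b (a\<^sup>2) u)\<^sup>2" if "u \<in> {a + t..b'}"
    using power_mono[OF cutoff_ge[of "a\<^sup>2" t a u b], of 2] that assms by (simp flip: power_mult)
  then show "(1 - exp (- a\<^sup>2 * t)) ^ 8 * (indicator {a + t..b'} u * exp (- 2 * \<alpha> * u powr r))
      \<le> indicator {a..b} u * ((cutoff a b (a\<^sup>2) u)\<^sup>2 * exp (- 2 * \<alpha> * u powr r))"
    using assms by (auto split: split_indicator)
qed (use assms in auto)

lemma eventually_cut_mass_ge:
  assumes \<alpha>: "0 \<le> \<alpha>" and r: "0 < r" "r < 2"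
  shows "\<forall>\<^sub>F a in at_top. \<forall>b\<ge>a + 1 / a. exp (- 2 * \<alpha> * a powr r) / (6 * exp (2 * \<alpha>) * a) \<le> cut_mass \<alpha> r a b"
proof -
  have "((\<lambda>a::real. (a + 1 / a) powr r - a powr r) \<longlongrightarrow> 0) at_top" using r by real_asymp
  then have "\<forall>\<^sub>F a::real in at_top. (a + 1 / a) powr r - a powr r < 1" by (rule order_tendstoD) simp
  moreover have "((\<lambda>a::real. (1 - exp (- a\<^sup>2 * (1 / (3 * a)))) ^ 8) \<longlongrightarrow> 1) at_top" by real_asymp
  then have "\<forall>\<^sub>F a::real in at_top. 1 / 2 < (1 - exp (- a\<^sup>2 * (1 / (3 * a)))) ^ 8"
    by (rule order_tendstoD) simp
  ultimately show ?thesis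
    using eventually_gt_at_top[of 0]
  proof eventually_elim
    case (elim a)
    define t where "t = 1 / (3 * a)"
    have t: "0 < t" "3 * t = 1 / a" using elim by (auto simp: t_def)
    show ?case
    proof (intro allI impI)
      fix b assume b: "a + 1 / a \<le> b"
      have "exp (- 2 * \<alpha> * (a powr r + 1)) \<le> exp (- 2 * \<alpha> * (a + 2 * t) powr r)"
      proof -
        have "(a + 2 * t) powr r \<le> (a + 1 / a) powr r" using t elim r by (intro powr_mono2) auto
        then have "(a + 2 * t) powr r \<le> a powr r + 1" using elim by linarith
        then show ?thesis using \<alpha> by (simp add: mult_left_mono)
      qed
      then have "1 / 2 * (t * exp (- 2 * \<alpha> * (a powr r + 1)))
          \<le> 1 / 2 * ((a + 2 * t - (a + t)) * exp (- 2 * \<alpha> * (a + 2 * t) powr r))"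
        using t by (simp add: mult_left_mono)
      also have "\<dots> \<le> 1 / 2 * exp_integral \<alpha> r (a + t) (a + 2 * t)"
        using t elim \<alpha> r by (intro mult_left_mono exp_integral_ge) auto
      also have "\<dots> \<le> (1 - exp (- a\<^sup>2 * t)) ^ 8 * exp_integral \<alpha> r (a + t) (a + 2 * t)"
        using elim by (intro mult_right_mono exp_integral_nonneg) (simp add: t_def)
      also have "\<dots> \<le> cut_mass \<alpha> r a b"
        using t b elim by (intro cut_mass_ge) auto
      also have "1 / 2 * (t * exp (- 2 * \<alpha> * (a powr r + 1)))
          = exp (- 2 * \<alpha> * a powr r) / (6 * exp (2 * \<alpha>) * a)"
        by (simp add: t_def exp_diff distrib_left)
      finally show "exp (- 2 * \<alpha> * a powr r) / (6 * exp (2 * \<alpha>) * a) \<le> cut_mass \<alpha> r a b" .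
    qed
  qed
qed

context
  fixes \<alpha> r L a b :: real
  assumes L: "0 \<le> L" and a: "0 < a" and mass: "0 < cut_mass \<alpha> r a b"
begin

lemma extremal_profile_energy:
  "(LINT u|lborel. indicator {a..b} u * ((extremal_profile \<alpha> r L a b u)\<^sup>2 * exp (2 * \<alpha> * u powr r))) = pi * L"
proof -
  have "(exp (- 2 * \<alpha> * u powr r))\<^sup>2 * exp (2 * \<alpha> * u powr r) = exp (- 2 * \<alpha> * u powr r)" for u
    by (simp add: power2_eq_square flip: exp_add)
  then have "(extremal_profile \<alpha> r L a b u)\<^sup>2 * exp (2 * \<alpha> * u powr r)
      = pi * L / cut_mass \<alpha> r a b * ((cutoff a b (a\<^sup>2) u)\<^sup>2 * exp (- 2 * \<alpha> * u powr r))" for u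
    using L mass unfolding extremal_profile_def by (simp add: power_mult_distrib mult.assoc)
  then have "(LINT u|lborel. indicator {a..b} u * ((extremal_profile \<alpha> r L a b u)\<^sup>2 * exp (2 * \<alpha> * u powr r)))
      = pi * L / cut_mass \<alpha> r a b * cut_mass \<alpha> r a b"
    unfolding cut_mass_def[of \<alpha> r a b] by (simp add: mult.left_commute[of "indicator _ _"])
  then show ?thesis using mass by simp
qed

lemma band_extremal_profile_zero_ge: "L / pi * cut_mass \<alpha> r a b \<le> (band a b (extremal_profile \<alpha> r L a b) 0)\<^sup>2"
proof -
  let ?A = "sqrt (pi * L / cut_mass \<alpha> r a b)"
    and ?J = "LINT u|lborel. indicator {a..b} u * (cutoff a b (a\<^sup>2) u * exp (- 2 * \<alpha> * u powr r))"
  have "cut_mass \<alpha> r a b \<le> ?J"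
    unfolding cut_mass_def
  proof (rule integral_mono)
    show "integrable lborel (\<lambda>u. indicator {a..b} u * (cutoff a b (a\<^sup>2) u * exp (- 2 * \<alpha> * u powr r)))"
      using integrable_cutoff_exp[OF a, of _ a b "a\<^sup>2" 1] by simp
    fix u
    have "(cutoff a b (a\<^sup>2) u)\<^sup>2 \<le> cutoff a b (a\<^sup>2) u" if "u \<in> {a..b}"
      using mult_left_le[OF cutoff_le_one[of "a\<^sup>2" a u b] cutoff_nonneg[of a b "a\<^sup>2" u]] that
      by (simp add: power2_eq_square)
    then show "indicator {a..b} u * ((cutoff a b (a\<^sup>2) u)\<^sup>2 * exp (- 2 * \<alpha> * u powr r))
        \<le> indicator {a..b} u * (cutoff a b (a\<^sup>2) u * exp (- 2 * \<alpha> * u powr r))"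
      by (auto split: split_indicator)
  qed (use integrable_cutoff_exp[OF a] in simp)
  then have "(?A * cut_mass \<alpha> r a b / pi)\<^sup>2 \<le> (?A * ?J / pi)\<^sup>2"
    using mass L by (intro power_mono divide_right_mono mult_left_mono) auto
  moreover have "(?A * cut_mass \<alpha> r a b / pi)\<^sup>2 = pi * L / cut_mass \<alpha> r a b * (cut_mass \<alpha> r a b)\<^sup>2 / pi\<^sup>2"
    using mass L by (simp add: power_mult_distrib power_divide)
  then have "(?A * cut_mass \<alpha> r a b / pi)\<^sup>2 = L / pi * cut_mass \<alpha> r a b"
    using mass by (simp add: power2_eq_square)
  moreover have "band a b (extremal_profile \<alpha> r L a b) 0 = ?A * ?J / pi"
    by (simp add: band_def extremal_profile_def mult.left_commute[of "indicator _ _"])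
  ultimately show ?thesis by simp
qed

lemma integral_extremal_profile_square_ge:
  assumes "0 \<le> \<alpha>" "0 \<le> r"
  shows "L * exp (- 2 * \<alpha> * b powr r)
      \<le> (LINT u|lborel. indicator {a..b} u * (extremal_profile \<alpha> r L a b u)\<^sup>2) / pi"
proof -
  let ?v = "extremal_profile \<alpha> r L a b"
  have v: "continuous_on {a..b} ?v"
    using a unfolding extremal_profile_def cutoff_def by (intro continuous_intros) auto
  have "exp (- 2 * \<alpha> * b powr r) * (pi * L)
      = (LINT u|lborel. exp (- 2 * \<alpha> * b powr r)
          * (indicator {a..b} u * ((?v u)\<^sup>2 * exp (2 * \<alpha> * u powr r))))"
    unfolding integral_mult_right_zero extremal_profile_energy ..
  also have "\<dots> \<le> (LINT u|lborel. indicator {a..b} u * (?v u)\<^sup>2)"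
  proof (rule integral_mono)
    have "continuous_on {a..b} (\<lambda>u. (?v u)\<^sup>2)" "continuous_on {a..b} (\<lambda>u. (?v u)\<^sup>2 * exp (2 * \<alpha> * u powr r))"
      using v a by (auto intro!: continuous_intros)
    from this[THEN integrable_indicator_Icc]
    show "integrable lborel (\<lambda>u. indicator {a..b} u * (?v u)\<^sup>2)"
      "integrable lborel (\<lambda>u. exp (- 2 * \<alpha> * b powr r)
          * (indicator {a..b} u * ((?v u)\<^sup>2 * exp (2 * \<alpha> * u powr r))))" by simp_all
    fix u
    have "exp (- 2 * \<alpha> * b powr r) * exp (2 * \<alpha> * u powr r) \<le> 1" if "u \<in> {a..b}"
      using that a assms by (auto simp flip: exp_add intro!: mult_left_mono powr_mono2)
    from mult_left_le[OF this, of "(?v u)\<^sup>2"]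
    show "exp (- 2 * \<alpha> * b powr r) * (indicator {a..b} u * ((?v u)\<^sup>2 * exp (2 * \<alpha> * u powr r)))
        \<le> indicator {a..b} u * (?v u)\<^sup>2"
      by (auto simp: mult_ac split: split_indicator)
  qed
  finally show ?thesis by (simp add: field_simps)
qed

lemma extremal_profile_C2_bound:
  assumes \<alpha>: "0 \<le> \<alpha>" and r: "0 \<le> r" "r \<le> 2" and a1: "1 \<le> a" and ab: "a \<le> b"
  obtains v1 v2 where "C2_bound {a..b} (sqrt (pi * L / cut_mass \<alpha> r a b) * exp (- 2 * \<alpha> * a powr r))
      (4 * a\<^sup>2 + (2 * \<alpha> * r + 1) * b)
      (\<lambda>u. complex_of_real (extremal_profile \<alpha> r L a b u)) v1 v2" "v1 a = 0" "v1 b = 0"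
proof -
  let ?A = "sqrt (pi * L / cut_mass \<alpha> r a b)"
  have left: "- (a\<^sup>2) * (u - a) \<le> 0" and right: "a\<^sup>2 * (u - b) \<le> 0" if "u \<in> {a..b}" for u
    using that by (auto simp: mult_nonneg_nonpos)
  note P = C2_bound_one_minus_exp[OF left] and Q = C2_bound_one_minus_exp[OF right]
  have A: "C2_bound {a..b} ?A 0 (\<lambda>u. complex_of_real ?A) (\<lambda>u. complex_of_real 0) (\<lambda>u. complex_of_real 0)"
    by (rule C2_bound_of_real) (use L mass in auto)
  note product = C2_bound_mult[OF A
      C2_bound_mult[OF C2_bound_mult[OF C2_bound_mult[OF P P] C2_bound_mult[OF Q Q]]
        C2_bound_exp_powr[OF \<alpha> r a1 ab]]]
  have const: "?A * (1 * 1 * (1 * 1) * exp (- 2 * \<alpha> * a powr r)) = ?A * exp (- 2 * \<alpha> * a powr r)"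
    "0 + (\<bar>- (a\<^sup>2)\<bar> + \<bar>- (a\<^sup>2)\<bar> + (\<bar>a\<^sup>2\<bar> + \<bar>a\<^sup>2\<bar>) + (2 * \<alpha> * r + 1) * b) = 4 * a\<^sup>2 + (2 * \<alpha> * r + 1) * b"
      by simp_all
  have profile: "complex_of_real ?A
      * (complex_of_real (1 - exp (- (a\<^sup>2) * (u - a))) * complex_of_real (1 - exp (- (a\<^sup>2) * (u - a))) *
      (complex_of_real (1 - exp (a\<^sup>2 * (u - b))) * complex_of_real (1 - exp (a\<^sup>2 * (u - b))))
          * complex_of_real (exp (- 2 * \<alpha> * u powr r)))
    = complex_of_real (extremal_profile \<alpha> r L a b u)" for u
    by (simp only: extremal_profile_def cutoff_def power2_eq_square of_real_mult)
  show ?thesis by (rule that[OF product[unfolded const profile]]) simp_all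
qed

end

subsection \<open>Decay of the perturbation\<close>

lemma powr_mult_exp_le:
  fixes B C \<beta> s g u a b :: real
  assumes "0 \<le> \<beta>" "0 \<le> s" "0 \<le> B" "B \<le> C" "g \<le> real K" "1 \<le> a" "a \<le> u" "u \<le> b"
  shows "B * \<bar>u\<bar> powr g * exp (- \<beta> * \<bar>u\<bar> powr s) \<le> C * b ^ K * exp (- \<beta> * a powr s)"
proof -
  have "u powr g \<le> u powr real K" using assms by (intro powr_mono) auto
  also have "\<dots> = u ^ K" using assms by (simp add: powr_realpow)
  also have "\<dots> \<le> b ^ K" using assms by (intro power_mono) auto
  finally have "u powr g \<le> b ^ K" .
  moreover have "exp (- \<beta> * u powr s) \<le> exp (- \<beta> * a powr s)"
    using assms by (auto intro!: mult_left_mono powr_mono2)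
  ultimately show ?thesis using assms by (auto intro!: mult_mono)
qed

lemma noise_C2_bound:
  assumes N: "assumption_N \<beta> s \<Phi>" and ND: "assumption_ND \<beta> s \<Phi>"
  obtains C K a0 D1 D2 where "0 < C"
    "\<And>a b. a0 \<le> a \<Longrightarrow> a \<le> b \<Longrightarrow> C2_bound {a..b} (C * b ^ K * exp (- \<beta> * a powr s)) 1 \<Phi> D1 D2"
proof -
  obtain u0 B0 g0 where \<beta>: "0 < \<beta>" "0 < s" and B0: "0 < B0"
    and \<Phi>: "\<And>u. u0 \<le> \<bar>u\<bar> \<Longrightarrow> cmod (\<Phi> u) \<le> B0 * \<bar>u\<bar> powr g0 * exp (- \<beta> * \<bar>u\<bar> powr s)"
    using N unfolding assumption_N_def by metis
  obtain u1 B1 g1 D1 D2 where B1: "0 < B1"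
    and D1: "\<And>u. u1 \<le> \<bar>u\<bar> \<Longrightarrow> (\<Phi> has_vector_derivative D1 u) (at u within {v. u1 \<le> \<bar>v\<bar>})"
    and D2: "\<And>u. u1 \<le> \<bar>u\<bar> \<Longrightarrow> (D1 has_vector_derivative D2 u) (at u within {v. u1 \<le> \<bar>v\<bar>})"
    and D: "\<And>u. u1 \<le> \<bar>u\<bar> \<Longrightarrow> max (cmod (D1 u)) (cmod (D2 u)) \<le> B1 * \<bar>u\<bar> powr g1 * exp (- \<beta> * \<bar>u\<bar> powr s)"
    and cont: "continuous_on {v. u1 \<le> \<bar>v\<bar>} D2"
    using ND unfolding assumption_ND_def by metis
  obtain K where K: "max g0 g1 \<le> real K" using real_arch_simple by blast
  show ?thesis
  proof
    show "0 < max B0 B1" using B0 by simp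
    fix a b :: real assume a: "max 1 (max u0 u1) \<le> a" and ab: "a \<le> b"
    let ?M = "max B0 B1 * b ^ K * exp (- \<beta> * a powr s)"
    have sub: "{a..b} \<subseteq> {v. u1 \<le> \<bar>v\<bar>}" using a by auto
    show "C2_bound {a..b} ?M 1 \<Phi> D1 D2"
      unfolding C2_bound_def mult_1_right power_one
    proof (intro conjI ballI)
      fix u assume u: "u \<in> {a..b}"
      then have u0: "u0 \<le> \<bar>u\<bar>" and u1: "u1 \<le> \<bar>u\<bar>" using a by auto
      show "(\<Phi> has_vector_derivative D1 u) (at u within {a..b})"
          "(D1 has_vector_derivative D2 u) (at u within {a..b})"
        using D1[OF u1] D2[OF u1] sub by (auto intro: has_vector_derivative_within_subset)
      have "B0 * \<bar>u\<bar> powr g0 * exp (- \<beta> * \<bar>u\<bar> powr s) \<le> ?M" "B1 * \<bar>u\<bar> powr g1 * exp (- \<beta> * \<bar>u\<bar> powr s) \<le> ?M"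
        by (rule powr_mult_exp_le; use \<beta> B0 B1 K a u in auto)+
      then show "cmod (\<Phi> u) \<le> ?M" "cmod (D1 u) \<le> ?M" "cmod (D2 u) \<le> ?M" using \<Phi>[OF u0] D[OF u1] by auto
    qed (use B0 a ab continuous_on_subset[OF cont sub] in auto)
  qed
qed

lemma extremal_amplitude_le:
  assumes L: "0 \<le> L" and a: "1 \<le> a"
    and mass: "exp (- 2 * \<alpha> * a powr r) / (6 * exp (2 * \<alpha>) * a) \<le> cut_mass \<alpha> r a b"
  shows "sqrt (pi * L / cut_mass \<alpha> r a b) * exp (- 2 * \<alpha> * a powr r)
    \<le> sqrt (6 * pi * L * exp (2 * \<alpha>)) * (a * exp (- \<alpha> * a powr r))"
proof -
  let ?e = "exp (- \<alpha> * a powr r)"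
  have e: "exp (- 2 * \<alpha> * a powr r) = ?e\<^sup>2" by (simp add: exp_double[symmetric] mult.assoc)
  have pos: "0 < ?e\<^sup>2 / (6 * exp (2 * \<alpha>) * a)" using a by simp
  then have "pi * L / cut_mass \<alpha> r a b \<le> pi * L / (?e\<^sup>2 / (6 * exp (2 * \<alpha>) * a))"
    using mass L unfolding e by (intro divide_left_mono mult_pos_pos) auto
  also have "\<dots> = 6 * pi * L * exp (2 * \<alpha>) * a / ?e\<^sup>2" by simp
  also have "\<dots> \<le> 6 * pi * L * exp (2 * \<alpha>) * a\<^sup>2 / ?e\<^sup>2"
    using L a by (intro divide_right_mono mult_left_mono) (auto simp: power2_eq_square)
  finally have "sqrt (pi * L / cut_mass \<alpha> r a b) \<le> sqrt (6 * pi * L * exp (2 * \<alpha>)) * a / ?e"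
    using a by (intro real_le_lsqrt) (auto simp: power_mult_distrib power_divide L real_sqrt_mult)
  from mult_right_mono[OF this, of "?e\<^sup>2"] show ?thesis
    unfolding e by (simp add: power2_eq_square)
qed

lemma eventually_band_profile_extremal:
  assumes \<alpha>: "0 \<le> \<alpha>" and r: "0 < r" "r < 2" and L: "0 \<le> L"
  shows "\<forall>\<^sub>F a in at_top. \<forall>b\<in>{a + 1 / a..2 * a}. 0 < cut_mass \<alpha> r a b \<and> (\<exists>v1 v2. band_profile a b
    (sqrt (6 * pi * L * exp (2 * \<alpha>)) * (a * exp (- \<alpha> * a powr r))) ((4 * \<alpha> * r + 6) * a\<^sup>2)
        (extremal_profile \<alpha> r L a b) v1 v2)"
  using eventually_cut_mass_ge[OF \<alpha> r] eventually_ge_at_top[of 1]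
proof eventually_elim
  case (elim a)
  show ?case
  proof (intro ballI conjI)
    fix b assume b: "b \<in> {a + 1 / a..2 * a}"
    then have ab: "a < b" using elim by (auto intro: less_le_trans[of a "a + 1 / a"])
    have mass: "exp (- 2 * \<alpha> * a powr r) / (6 * exp (2 * \<alpha>) * a) \<le> cut_mass \<alpha> r a b" using elim b by auto
    moreover have "0 < exp (- 2 * \<alpha> * a powr r) / (6 * exp (2 * \<alpha>) * a)" using elim by simp
    ultimately show pos: "0 < cut_mass \<alpha> r a b" by linarith
    obtain v1 v2 where v:
        "C2_bound {a..b} (sqrt (pi * L / cut_mass \<alpha> r a b) * exp (- 2 * \<alpha> * a powr r))
          (4 * a\<^sup>2 + (2 * \<alpha> * r + 1) * b)
        (\<lambda>u. complex_of_real (extremal_profile \<alpha> r L a b u)) v1 v2" "v1 a = 0" "v1 b = 0"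
      using extremal_profile_C2_bound[OF L _ pos \<alpha>] r elim ab by auto
    have square: "a \<le> a\<^sup>2" using elim by (simp add: power2_eq_square)
    then have "(2 * \<alpha> * r + 1) * b \<le> (2 * \<alpha> * r + 1) * (2 * a\<^sup>2)" using b \<alpha> r by (intro mult_left_mono) auto
    then have k: "4 * a\<^sup>2 + (2 * \<alpha> * r + 1) * b \<le> (4 * \<alpha> * r + 6) * a\<^sup>2" by (simp add: algebra_simps)
    have "band_profile a b (sqrt (6 * pi * L * exp (2 * \<alpha>)) * (a * exp (- \<alpha> * a powr r)))
        ((4 * \<alpha> * r + 6) * a\<^sup>2)
        (extremal_profile \<alpha> r L a b) v1 v2"
    proof
      have "1 * 1 \<le> (4 * \<alpha> * r + 6) * a\<^sup>2" using square elim \<alpha> r by (intro mult_mono) auto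
      then show "1 \<le> (4 * \<alpha> * r + 6) * a\<^sup>2" by simp
      show "extremal_profile \<alpha> r L a b a = 0" "extremal_profile \<alpha> r L a b b = 0"
        by (simp_all add: extremal_profile_def cutoff_def)
    qed (use elim ab v C2_bound_mono[OF v(1) extremal_amplitude_le[OF L _ mass] k] in auto)
    then show "\<exists>v1 v2. band_profile a b (sqrt (6 * pi * L * exp (2 * \<alpha>)) * (a * exp (- \<alpha> * a powr r)))
        ((4 * \<alpha> * r + 6) * a\<^sup>2)
        (extremal_profile \<alpha> r L a b) v1 v2" by blast
  qed
qed

lemma conv_band_decay_le:
  fixes C C' k a b :: real
  assumes "band_profile a b (C * (a * exp (- \<alpha> * a powr r))) (k * a\<^sup>2) v v1 v2" and fe: "prob_density fe"
    and \<Phi>: "C2_bound {a..b} (C' * b ^ K * exp (- \<beta> * a powr s)) 1 (fourier fe) D1 D2"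
    and C: "0 \<le> C" "0 \<le> C'" and k0: "0 \<le> k" and a1: "1 \<le> a" and b: "b \<le> 2 * a"
  shows "\<bar>conv (band a b v) fe y\<bar>
      \<le> (2 ^ Suc K * C * C' * (k + 1)\<^sup>2 * (a ^ (K + 6) * exp (- \<alpha> * a powr r - \<beta> * a powr s))) / (1 + y\<^sup>2)"
proof -
  interpret band_profile a b "C * (a * exp (- \<alpha> * a powr r))" "k * a\<^sup>2" v v1 v2 by fact
  let ?e = "exp (- \<alpha> * a powr r)" and ?f = "exp (- \<beta> * a powr s)"
  have ba: "0 \<le> b" "b - a \<le> a" "0 \<le> b - a" using a b ab by auto
  have "k * a\<^sup>2 + 1 \<le> (k + 1) * a\<^sup>2" "0 \<le> k * a\<^sup>2"
    using k0 one_le_power[OF a1, of 2] by (auto simp: algebra_simps)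
  then have "2 * (C * (a * ?e) * (C' * b ^ K * ?f) * (k * a\<^sup>2 + 1)\<^sup>2) * (b - a) / pi
      \<le> 2 * (C * (a * ?e) * (C' * (2 * a) ^ K * ?f) * ((k + 1) * a\<^sup>2)\<^sup>2) * a / 1"
    using C a b ba pi_ge_two by (intro frac_le mult_mono order_refl power_mono mult_nonneg_nonneg) auto
  also have "\<dots> = 2 ^ Suc K * C * C' * (k + 1)\<^sup>2 * (a ^ (K + 6) * (?e * ?f))"
    by (simp add: power_mult_distrib power_add power_numeral_reduce mult_ac)
  also have "?e * ?f = exp (- \<alpha> * a powr r - \<beta> * a powr s)" by (simp flip: exp_add)
  finally show ?thesis by (intro order_trans[OF abs_conv_band_le_decay[OF fe \<Phi>] divide_right_mono]) auto
qed

lemma perturbed_base_extremal_profile: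
  assumes v: "band_profile a b (C * (a * exp (- \<alpha> * a powr r))) (k * a\<^sup>2) (extremal_profile \<alpha> r L a b) v1 v2"
    and \<Phi>: "C2_bound {a..b} (C' * b ^ K * exp (- \<beta> * a powr s)) 1 (fourier fe) D1 D2"
    and mass: "0 < cut_mass \<alpha> r a b"
    and nonneg: "0 \<le> \<alpha>" "0 \<le> r" "0 \<le> L" "0 \<le> C" "0 \<le> C'" "0 \<le> k" and a1: "1 < a" and b: "b \<le> 2 * a"
    and fe: "prob_density fe" and m: "0 < m" "1 / 2 \<le> (LINT e|lborel. indicator {-m..m} e * fe e)"
    and \<sigma>: "1 \<le> \<sigma>" "exp (2 * \<alpha>) / \<sigma> + pi * L \<le> pi * L'"
    and small: "2 * (C * (a * exp (- \<alpha> * a powr r)) * (k * a\<^sup>2)\<^sup>2) * a / pi \<le> 1 / (2 * pi ^ 3 * \<sigma>)"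
  shows "perturbed_base a b (C * (a * exp (- \<alpha> * a powr r))) (k * a\<^sup>2) (extremal_profile \<alpha> r L a b) v1 v2
    fe \<alpha> r L' \<sigma> m
    (2 ^ Suc K * C * C' * (k + 1)\<^sup>2 * (a ^ (K + 6) * exp (- \<alpha> * a powr r - \<beta> * a powr s)))"
proof -
  interpret band_profile a b "C * (a * exp (- \<alpha> * a powr r))" "k * a\<^sup>2" "extremal_profile \<alpha> r L a b" v1 v2
    by (rule v)
  show ?thesis
  proof
    have "2 * (C * (a * exp (- \<alpha> * a powr r)) * (k * a\<^sup>2)\<^sup>2) * (b - a) / pi
        \<le> 2 * (C * (a * exp (- \<alpha> * a powr r)) * (k * a\<^sup>2)\<^sup>2) * a / pi"
      using b nonneg a1 by (intro divide_right_mono mult_left_mono) auto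
    then show "2 * (C * (a * exp (- \<alpha> * a powr r)) * (k * a\<^sup>2)\<^sup>2) * (b - a) / pi \<le> 1 / (2 * pi ^ 3 * \<sigma>)"
      using small by linarith
    show "exp (2 * \<alpha>) / \<sigma>
        + (LINT u|lborel. indicator {a..b} u * ((extremal_profile \<alpha> r L a b u)\<^sup>2 * exp (2 * \<alpha> * u powr r)))
            \<le> pi * L'"
      using \<sigma> extremal_profile_energy[OF nonneg(3) a mass] by simp
    show "\<bar>conv (band a b (extremal_profile \<alpha> r L a b)) fe y\<bar>
        \<le> 2 ^ Suc K * C * C' * (k + 1)\<^sup>2 * (a ^ (K + 6) * exp (- \<alpha> * a powr r - \<beta> * a powr s))
            / (1 + y\<^sup>2)" for y
      using nonneg a1 b by (intro conv_band_decay_le[OF v fe \<Phi>]) auto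
  qed (use fe m nonneg \<sigma> a1 in auto)
qed

lemma eventually_perturbed_base:
  assumes \<alpha>: "0 < \<alpha>" and r: "0 < r" "r < 2" and L: "0 \<le> L" and fe: "prob_density fe"
    and N: "assumption_N \<beta> s (fourier fe)" and ND: "assumption_ND \<beta> s (fourier fe)"
    and m: "0 < m" "1 / 2 \<le> (LINT e|lborel. indicator {-m..m} e * fe e)"
    and \<sigma>: "1 \<le> \<sigma>" "exp (2 * \<alpha>) / \<sigma> + pi * L \<le> pi * L'"
  obtains C K where "\<forall>\<^sub>F a in at_top. \<forall>b\<in>{a + 1 / a..2 * a}. 0 < cut_mass \<alpha> r a b \<and>
    (\<exists>B j v1 v2. perturbed_base a b B j (extremal_profile \<alpha> r L a b) v1 v2 fe \<alpha> r L' \<sigma> m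
      (C * (a ^ K * exp (- \<alpha> * a powr r - \<beta> * a powr s))))"
proof -
  obtain C' K a0 D1 D2 where C': "0 < C'"
    and \<Phi>: "\<And>a b. a0 \<le> a \<Longrightarrow> a \<le> b \<Longrightarrow> C2_bound {a..b} (C' * b ^ K * exp (- \<beta> * a powr s)) 1 (fourier fe) D1 D2"
    by (rule noise_C2_bound[OF N ND]) blast
  define C k where "C = sqrt (6 * pi * L * exp (2 * \<alpha>))" and "k = 4 * \<alpha> * r + 6"
  have C: "0 \<le> C" and k0: "0 \<le> k" using L \<alpha> r by (auto simp: C_def k_def)
  have "((\<lambda>a::real. a ^ 6 * exp (- \<alpha> * a powr r)) \<longlongrightarrow> 0) at_top" using \<alpha> r by real_asymp
  from tendsto_mult_right[OF this, of "2 * C * k\<^sup>2 / pi"]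
  have "((\<lambda>a. 2 * (C * (a * exp (- \<alpha> * a powr r)) * (k * a\<^sup>2)\<^sup>2) * a / pi) \<longlongrightarrow> 0) at_top"
    by (simp add: power_mult_distrib power_numeral_reduce mult_ac)
  then have "\<forall>\<^sub>F a in at_top. 2 * (C * (a * exp (- \<alpha> * a powr r)) * (k * a\<^sup>2)\<^sup>2) * a / pi
      < 1 / (2 * pi ^ 3 * \<sigma>)"
    by (rule order_tendstoD) (use \<sigma> in simp)
  moreover note eventually_band_profile_extremal[OF less_imp_le[OF \<alpha>] r L, folded C_def k_def]
  ultimately have "\<forall>\<^sub>F a in at_top. \<forall>b\<in>{a + 1 / a..2 * a}. 0 < cut_mass \<alpha> r a b \<and>
    (\<exists>B j v1 v2. perturbed_base a b B j (extremal_profile \<alpha> r L a b) v1 v2 fe \<alpha> r L' \<sigma> m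
      (2 ^ Suc K * C * C' * (k + 1)\<^sup>2 * (a ^ (K + 6) * exp (- \<alpha> * a powr r - \<beta> * a powr s))))"
    using eventually_ge_at_top[of a0] eventually_gt_at_top[of 1]
  proof eventually_elim
    case (elim a)
    show ?case
    proof (intro ballI conjI)
      fix b assume b: "b \<in> {a + 1 / a..2 * a}"
      then show mass: "0 < cut_mass \<alpha> r a b" using elim by blast
      obtain v1 v2 where v:
          "band_profile a b (C * (a * exp (- \<alpha> * a powr r))) (k * a\<^sup>2) (extremal_profile \<alpha> r L a b) v1 v2"
        using elim b by blast
      have "0 < 1 / a" "a + 1 / a \<le> b" using elim b by auto
      then have "a \<le> b" by linarith
      then have "perturbed_base a b (C * (a * exp (- \<alpha> * a powr r))) (k * a\<^sup>2) (extremal_profile \<alpha> r L a b) 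
          v1 v2 fe \<alpha> r L' \<sigma> m
        (2 ^ Suc K * C * C' * (k + 1)\<^sup>2 * (a ^ (K + 6) * exp (- \<alpha> * a powr r - \<beta> * a powr s)))"
        using elim b C C' k0 \<alpha> r L
        by (intro perturbed_base_extremal_profile[OF v \<Phi> mass _ _ _ _ _ _ _ _ fe m \<sigma>]) auto
      then show "\<exists>B j v1 v2. perturbed_base a b B j (extremal_profile \<alpha> r L a b) v1 v2 fe \<alpha> r L' \<sigma> m
        (2 ^ Suc K * C * C' * (k + 1)\<^sup>2 * (a ^ (K + 6) * exp (- \<alpha> * a powr r - \<beta> * a powr s)))" by blast
    qed
  qed
  then show ?thesis by (rule that)
qed

subsection \<open>The minimax lower bounds\<close>

definition balance :: "real \<Rightarrow> real \<Rightarrow> real \<Rightarrow> real \<Rightarrow> real \<Rightarrow> real" where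
  "balance \<alpha> \<beta> r s a = 2 * \<beta> * a powr s + 2 * \<alpha> * a powr r"

lemma chi_square_bound_decay:
  "chi_square_bound c m (C * (a ^ K * exp (- \<alpha> * a powr r - \<beta> * a powr s)))
    = chi_square_bound c m C * (a ^ (2 * K) * exp (- balance \<alpha> \<beta> r s a))"
proof -
  have "(exp (- \<alpha> * a powr r - \<beta> * a powr s))\<^sup>2 = exp (- balance \<alpha> \<beta> r s a)"
    by (simp add: balance_def algebra_simps flip: exp_double)
  then show ?thesis
    by (simp add: chi_square_bound_def power_mult_distrib power_mult[symmetric] mult.commute[of K])
qed

lemma ennreal_mult_right_mono_pos:
  assumes "0 \<le> x" "x \<le> y" shows "ennreal (x * z) \<le> ennreal (y * z)"
proof (cases "0 \<le> z")
  case False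
  then have "x * z \<le> 0" using assms by (intro mult_nonneg_nonpos) auto
  then show ?thesis by (simp add: ennreal_neg)
qed (use assms in \<open>intro ennreal_leI mult_right_mono\<close>)

lemma minimax_lower_bound_cut_mass:
  assumes \<alpha>: "0 < \<alpha>" and r: "0 < r" "r < 2" and L: "0 \<le> L" "L < L'" and fe: "prob_density fe"
    and N: "assumption_N \<beta> s (fourier fe)" and ND: "assumption_ND \<beta> s (fourier fe)"
  obtains C K where "0 \<le> C" "\<forall>\<^sub>F a in at_top. \<forall>b\<in>{a + 1 / a..2 * a}. \<forall>n x. \<forall>T\<in>estimators n.
     ennreal (L / pi * cut_mass \<alpha> r a b * affinity_bound (C * (a ^ K * exp (- balance \<alpha> \<beta> r s a))) n)
       \<le> risk_pt fe \<alpha> r L' n x T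
   \<and> ennreal (L * exp (- 2 * \<alpha> * b powr r) * affinity_bound (C * (a ^ K * exp (- balance \<alpha> \<beta> r s a))) n)
       \<le> risk_L2 fe \<alpha> r L' n T"
proof -
  obtain m where m: "0 < m" "1 / 2 \<le> (LINT e|lborel. indicator {-m..m} e * fe e)"
    by (rule prob_density_tight[OF fe])
  define \<sigma> where "\<sigma> = max 1 (exp (2 * \<alpha>) / (pi * (L' - L)))"
  have "1 \<le> \<sigma>" "exp (2 * \<alpha>) / (pi * (L' - L)) \<le> \<sigma>" by (auto simp: \<sigma>_def)
  moreover from this have "exp (2 * \<alpha>) / \<sigma> \<le> pi * (L' - L)" using L by (simp add: divide_le_eq mult.commute)
  ultimately have \<sigma>: "1 \<le> \<sigma>" "exp (2 * \<alpha>) / \<sigma> + pi * L \<le> pi * L'" by (auto simp: right_diff_distrib)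
  obtain C K where base: "\<forall>\<^sub>F a in at_top. \<forall>b\<in>{a + 1 / a..2 * a}. 0 < cut_mass \<alpha> r a b \<and>
      (\<exists>B k v1 v2. perturbed_base a b B k (extremal_profile \<alpha> r L a b) v1 v2 fe \<alpha> r L' \<sigma> m
        (C * (a ^ K * exp (- \<alpha> * a powr r - \<beta> * a powr s))))"
    by (rule eventually_perturbed_base[OF \<alpha> r L(1) fe N ND m \<sigma>])
  let ?C = "chi_square_bound (1 / (2 * pi ^ 3 * \<sigma>)) m C"
  let ?\<rho> = "\<lambda>a. affinity_bound (?C * (a ^ (2 * K) * exp (- balance \<alpha> \<beta> r s a)))"
  have "\<forall>\<^sub>F a in at_top. \<forall>b\<in>{a + 1 / a..2 * a}. \<forall>n x. \<forall>T\<in>estimators n.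
      ennreal (L / pi * cut_mass \<alpha> r a b * ?\<rho> a n) \<le> risk_pt fe \<alpha> r L' n x T
    \<and> ennreal (L * exp (- 2 * \<alpha> * b powr r) * ?\<rho> a n) \<le> risk_L2 fe \<alpha> r L' n T"
    using base
  proof eventually_elim
    case (elim a)
    show ?case
    proof (intro ballI allI conjI)
      fix b n x T assume b: "b \<in> {a + 1 / a..2 * a}" and T: "T \<in> estimators n"
      obtain B k v1 v2 where "perturbed_base a b B k (extremal_profile \<alpha> r L a b) v1 v2 fe \<alpha> r L' \<sigma> m
        (C * (a ^ K * exp (- \<alpha> * a powr r - \<beta> * a powr s)))" and mass: "0 < cut_mass \<alpha> r a b"
        using elim b by blast
      then interpret perturbed_base a b B k "extremal_profile \<alpha> r L a b" v1 v2 fe \<alpha> r L' \<sigma> m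
        "C * (a ^ K * exp (- \<alpha> * a powr r - \<beta> * a powr s))" by simp
      have "0 \<le> L / pi * cut_mass \<alpha> r a b" using L mass by simp
      then show "ennreal (L / pi * cut_mass \<alpha> r a b * ?\<rho> a n) \<le> risk_pt fe \<alpha> r L' n x T"
        by (rule order_trans[OF ennreal_mult_right_mono_pos[OF _ band_extremal_profile_zero_ge[OF L(1) a mass]]
              risk_pt_lower_bound[OF T, unfolded chi_square_bound_decay]])
      have "0 \<le> L * exp (- 2 * \<alpha> * b powr r)" using L by simp
      then show "ennreal (L * exp (- 2 * \<alpha> * b powr r) * ?\<rho> a n) \<le> risk_L2 fe \<alpha> r L' n T"
        by (rule order_trans[OF ennreal_mult_right_mono_pos[OF _ integral_extremal_profile_square_ge[OF L(1) a mass]]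
              risk_L2_lower_bound[OF T, unfolded chi_square_bound_decay]]) (use \<alpha> r in auto)
    qed
  qed
  then show ?thesis using \<sigma> by (intro that[of ?C "2 * K"]) (auto simp: chi_square_bound_def)
qed

section \<open>Asymptotics of the bias integral\<close>

text \<open>An approximate antiderivative of \<open>-exp(-2\<alpha>u\<^sup>r)\<close>; at \<open>u = 1/h\<^sub>*\<close> it is the pointwise rate up to the factor
  \<open>L/\<pi>\<close>.\<close>

definition tail_rate :: "real \<Rightarrow> real \<Rightarrow> real \<Rightarrow> real" where
  "tail_rate \<alpha> r u = u powr (1 - r) * exp (- 2 * \<alpha> * u powr r) / (2 * \<alpha> * r)"

definition tail_error :: "real \<Rightarrow> real \<Rightarrow> real \<Rightarrow> real" where
  "tail_error \<alpha> r u = \<bar>1 - r\<bar> / (2 * \<alpha> * r) * u powr (- r)"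

lemma tendsto_divide_if_powr_diff:
  fixes a b :: "'a \<Rightarrow> real"
  assumes r: "0 < r" and a: "filterlim a at_top F" and b: "\<forall>\<^sub>F x in F. 0 < b x"
    and diff: "((\<lambda>x. a x powr r - b x powr r) \<longlongrightarrow> 0) F"
  shows "((\<lambda>x. b x / a x) \<longlongrightarrow> 1) F"
proof -
  have "filterlim (\<lambda>u::real. u powr r) at_top at_top" using r by real_asymp
  from tendsto_divide_0[OF diff filterlim_at_top_imp_at_infinity[OF filterlim_compose[OF this a]]]
  have "((\<lambda>x. (a x powr r - b x powr r) / a x powr r) \<longlongrightarrow> 0) F" .
  then have "((\<lambda>x. (1 - (a x powr r - b x powr r) / a x powr r) powr (1 / r)) \<longlongrightarrow> (1 - 0) powr (1 / r)) F"
    by (intro tendsto_intros) auto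
  moreover have "\<forall>\<^sub>F x in F. (1 - (a x powr r - b x powr r) / a x powr r) powr (1 / r) = b x / a x"
    using eventually_compose_filterlim[OF eventually_gt_at_top[of 0] a] b
    by eventually_elim (use r in \<open>simp add: diff_divide_distrib powr_powr flip: powr_divide\<close>)
  ultimately show ?thesis using Lim_transform_eventually by force
qed

context
  fixes \<alpha> r :: real
  assumes \<alpha>: "0 < \<alpha>" and r: "0 < r"
begin

lemma tail_rate_pos: "0 < u \<Longrightarrow> 0 < tail_rate \<alpha> r u"
  using \<alpha> r by (simp add: tail_rate_def)

lemma tendsto_tail_rate_at_top: "(tail_rate \<alpha> r \<longlongrightarrow> 0) at_top"
  unfolding tail_rate_def[abs_def] using \<alpha> r by real_asymp

lemma tendsto_tail_error_at_top: "(tail_error \<alpha> r \<longlongrightarrow> 0) at_top"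
proof -
  have "((\<lambda>u::real. u powr (- r)) \<longlongrightarrow> 0) at_top" using r by real_asymp
  from tendsto_mult_right_zero[OF this] show ?thesis unfolding tail_error_def[abs_def] .
qed

lemma tail_rate_derivative:
  assumes u: "0 < u"
  shows "(tail_rate \<alpha> r has_real_derivative
      - (exp (- 2 * \<alpha> * u powr r) * (1 - (1 - r) / (2 * \<alpha> * r) * u powr (- r)))) (at u)"
proof -
  let ?e = "exp (- 2 * \<alpha> * u powr r)" and ?c = "2 * \<alpha> * r"
  have powr: "((\<lambda>u. u powr (1 - r)) has_real_derivative (1 - r) * u powr (- r)) (at u)"
    using has_real_derivative_powr[OF u, of "1 - r"] by simp
  have exp: "((\<lambda>u. exp (- 2 * \<alpha> * u powr r)) has_real_derivative - (?c * u powr (r - 1)) * ?e) (at u)"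
    using u by (auto intro!: derivative_eq_intros)
  have "u powr (r - 1) * u powr (1 - r) = 1" using u by (simp flip: powr_add)
  then have "- (?c * u powr (r - 1)) * ?e * u powr (1 - r) = - ?c * ?e"
    by (simp add: mult.assoc mult.left_commute[of ?e])
  then have "((1 - r) * u powr (- r) * ?e + - (?c * u powr (r - 1)) * ?e * u powr (1 - r)) / ?c
      = - (?e * (1 - (1 - r) / ?c * u powr (- r)))"
    using \<alpha> r by (simp add: field_simps)
  from DERIV_cong[OF DERIV_cdivide[OF DERIV_mult[OF powr exp]] this]
  show ?thesis unfolding tail_rate_def[abs_def] .
qed

lemma tail_error_ge:
  assumes "0 < a" "a \<le> u" shows "\<bar>(1 - r) / (2 * \<alpha> * r) * u powr (- r)\<bar> \<le> tail_error \<alpha> r a"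
proof -
  have "u powr (- r) \<le> a powr (- r)" using assms r by (intro powr_mono2') auto
  then have "\<bar>1 - r\<bar> / (2 * \<alpha> * r) * u powr (- r) \<le> tail_error \<alpha> r a"
    unfolding tail_error_def using \<alpha> r by (intro mult_left_mono) auto
  then show ?thesis using \<alpha> r by (simp add: abs_mult abs_divide)
qed

lemma tail_rate_diff_le:
  assumes a: "0 < a" and ab: "a \<le> b"
  shows "tail_rate \<alpha> r a - tail_rate \<alpha> r b \<le> (1 + tail_error \<alpha> r a) * exp_integral \<alpha> r a b"
proof -
  let ?e = "\<lambda>u. exp (- 2 * \<alpha> * u powr r)" and ?d = "\<lambda>u. (1 - r) / (2 * \<alpha> * r) * u powr (- r)"
  have cont: "continuous_on {a..b} (\<lambda>u. ?e u * (1 - ?d u))" using a by (intro continuous_intros) auto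
  have "(LINT u|lborel. indicator {a..b} u *\<^sub>R (?e u * (1 - ?d u))) = - tail_rate \<alpha> r b - (- tail_rate \<alpha> r a)"
  proof (rule integral_FTC_Icc[OF ab _ cont])
    fix u assume "a \<le> u" "u \<le> b"
    then have "((\<lambda>u. - tail_rate \<alpha> r u) has_real_derivative - (- (?e u * (1 - ?d u)))) (at u within {a..b})"
      using a by (intro DERIV_minus has_field_derivative_at_within[OF tail_rate_derivative]) auto
    then show "((\<lambda>u. - tail_rate \<alpha> r u) has_vector_derivative ?e u * (1 - ?d u)) (at u within {a..b})"
      by (simp add: has_real_derivative_iff_has_vector_derivative)
  qed
  then have "tail_rate \<alpha> r a - tail_rate \<alpha> r b = (LINT u|lborel. indicator {a..b} u * (?e u * (1 - ?d u)))"
    by simp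
  also have "\<dots> \<le> (LINT u|lborel. (1 + tail_error \<alpha> r a) * (indicator {a..b} u * ?e u))"
  proof (rule integral_mono)
    show "integrable lborel (\<lambda>u. indicator {a..b} u * (?e u * (1 - ?d u)))"
      using integrable_indicator_Icc[OF cont] by simp
    fix u
    have "?e u * (1 - ?d u) \<le> ?e u * (1 + tail_error \<alpha> r a)" if "u \<in> {a..b}"
      using abs_le_D2[OF tail_error_ge[OF a, of u]] that by (intro mult_left_mono) auto
    then show "indicator {a..b} u * (?e u * (1 - ?d u))
        \<le> (1 + tail_error \<alpha> r a) * (indicator {a..b} u * ?e u)"
      by (simp add: mult.commute split: split_indicator)
  qed (intro integrable_mult_right integrable_exp_integral[OF a])
  also have "\<dots> = (1 + tail_error \<alpha> r a) * exp_integral \<alpha> r a b" by (simp add: exp_integral_def)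
  finally show ?thesis .
qed

lemma exp_tail_le:
  assumes a: "0 < a" and small: "tail_error \<alpha> r a < 1"
  shows "exp_tail \<alpha> r a \<le> ennreal (2 * tail_rate \<alpha> r a / (1 - tail_error \<alpha> r a))"
proof -
  let ?e = "\<lambda>u. exp (- 2 * \<alpha> * u powr r)" and ?d = "\<lambda>u. (1 - r) / (2 * \<alpha> * r) * u powr (- r)"
  let ?c = "1 - tail_error \<alpha> r a"
  have "(\<integral>\<^sup>+u. ennreal ?c * (indicator {a..} u * ennreal (?e u)) \<partial>lborel)
      \<le> (\<integral>\<^sup>+u. ennreal (?e u * (1 - ?d u)) * indicator {a..} u \<partial>lborel)"
  proof (rule nn_integral_mono)
    fix u
    have "?c * ?e u \<le> ?e u * (1 - ?d u)" if "a \<le> u"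
      using abs_le_D1[OF tail_error_ge[OF a that]] unfolding mult.commute[of ?c]
      by (intro mult_left_mono) auto
    then show "ennreal ?c * (indicator {a..} u * ennreal (?e u))
        \<le> ennreal (?e u * (1 - ?d u)) * indicator {a..} u"
      using small by (auto simp: ennreal_mult[symmetric] intro!: ennreal_leI split: split_indicator)
  qed
  also have "\<dots> = ennreal (0 - - tail_rate \<alpha> r a)"
  proof (rule nn_integral_FTC_atLeast)
    fix u assume u: "a \<le> u"
    show "((\<lambda>u. - tail_rate \<alpha> r u) has_real_derivative ?e u * (1 - ?d u)) (at u)"
      using DERIV_minus[OF tail_rate_derivative, of u] a u by simp
    show "0 \<le> ?e u * (1 - ?d u)" using abs_le_D1[OF tail_error_ge[OF a u]] small by simp
  qed (use tendsto_minus[OF tendsto_tail_rate_at_top] in auto)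
  finally have bound: "ennreal ?c * (\<integral>\<^sup>+u. indicator {a..} u * ennreal (?e u) \<partial>lborel)
      \<le> ennreal (tail_rate \<alpha> r a)"
    by (simp add: nn_integral_cmult)
  have "exp_tail \<alpha> r a = 2 * (\<integral>\<^sup>+u. indicator {0..} u * (indicator {a<..} u * ennreal (?e u)) \<partial>lborel)"
    unfolding exp_tail_def
    by (subst nn_integral_lborel_even[symmetric]) (auto intro!: nn_integral_cong split: split_indicator)
  also have "\<dots> \<le> 2 * (\<integral>\<^sup>+u. indicator {a..} u * ennreal (?e u) \<partial>lborel)"
    by (intro mult_left_mono nn_integral_mono) (auto split: split_indicator)
  finally have "ennreal ?c * exp_tail \<alpha> r a \<le> 2 * ennreal (tail_rate \<alpha> r a)"
    using mult_left_mono[OF bound, of 2] by (simp add: mult.left_commute order_trans[OF mult_left_mono])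
  from divide_right_mono_ennreal[OF this, of "ennreal ?c"]
  have "exp_tail \<alpha> r a \<le> 2 * ennreal (tail_rate \<alpha> r a) / ennreal ?c"
    using small by (simp add: mult.commute[of "ennreal ?c"] mult_divide_eq_ennreal)
  then show ?thesis using small tail_rate_pos[OF a]
    by (simp add: divide_ennreal ennreal_mult'[symmetric] flip: ennreal_numeral)
qed

lemma tail_rate_ratio:
  assumes "0 < a" "0 < b"
  shows "tail_rate \<alpha> r b / tail_rate \<alpha> r a = (b / a) powr (1 - r) * exp (2 * \<alpha> * (a powr r - b powr r))"
  using assms \<alpha> r by (simp add: tail_rate_def powr_divide right_diff_distrib exp_diff exp_minus field_simps)

lemma tendsto_tail_rate_ratio:
  assumes a: "filterlim a at_top F" and b: "\<forall>\<^sub>F x in F. 0 < b x"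
    and diff: "((\<lambda>x. a x powr r - b x powr r) \<longlongrightarrow> 0) F"
  shows "((\<lambda>x. tail_rate \<alpha> r (b x) / tail_rate \<alpha> r (a x)) \<longlongrightarrow> 1) F"
proof -
  have "((\<lambda>x. (b x / a x) powr (1 - r) * exp (2 * \<alpha> * (a x powr r - b x powr r)))
      \<longlongrightarrow> 1 powr (1 - r) * exp (2 * \<alpha> * 0)) F"
    by (intro tendsto_intros diff tendsto_divide_if_powr_diff[OF r a b]) simp
  moreover have "\<forall>\<^sub>F x in F. (b x / a x) powr (1 - r) * exp (2 * \<alpha> * (a x powr r - b x powr r))
      = tail_rate \<alpha> r (b x) / tail_rate \<alpha> r (a x)"
    using eventually_compose_filterlim[OF eventually_gt_at_top[of 0] a] b
    by eventually_elim (simp add: tail_rate_ratio)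
  ultimately show ?thesis using Lim_transform_eventually by force
qed

lemma tendsto_tail_rate_double:
  "((\<lambda>a. tail_rate \<alpha> r (2 * a - 1 / a) / tail_rate \<alpha> r a) \<longlongrightarrow> 0) at_top"
proof -
  have "((\<lambda>a::real. 1 - (2 - 1 / a\<^sup>2) powr r) \<longlongrightarrow> 1 - 2 powr r) at_top" by real_asymp
  moreover have "filterlim (\<lambda>a::real. 2 * \<alpha> * a powr r) at_top at_top" using \<alpha> r by real_asymp
  ultimately have "filterlim (\<lambda>a::real. (1 - (2 - 1 / a\<^sup>2) powr r) * (2 * \<alpha> * a powr r)) at_bot at_top"
    using r by (intro filterlim_tendsto_neg_mult_at_bot) auto
  from filterlim_compose[OF exp_at_bot this]
  have "((\<lambda>a::real. exp ((1 - (2 - 1 / a\<^sup>2) powr r) * (2 * \<alpha> * a powr r))) \<longlongrightarrow> 0) at_top" .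
  moreover have "((\<lambda>a::real. (2 - 1 / a\<^sup>2) powr (1 - r)) \<longlongrightarrow> 2 powr (1 - r)) at_top" by real_asymp
  ultimately have "((\<lambda>a::real. (2 - 1 / a\<^sup>2) powr (1 - r)
      * exp ((1 - (2 - 1 / a\<^sup>2) powr r) * (2 * \<alpha> * a powr r))) \<longlongrightarrow> 0) at_top"
    using tendsto_mult by fastforce
  moreover have "\<forall>\<^sub>F a in at_top. (2 - 1 / a\<^sup>2) powr (1 - r)
      * exp ((1 - (2 - 1 / a\<^sup>2) powr r) * (2 * \<alpha> * a powr r))
      = tail_rate \<alpha> r (2 * a - 1 / a) / tail_rate \<alpha> r a"
    using eventually_ge_at_top[of 1]
  proof eventually_elim
    case (elim a)
    define t where "t = 2 - 1 / a\<^sup>2"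
    have "1 / a\<^sup>2 \<le> 1" using elim by (simp add: one_le_power)
    then have t: "0 < t" by (simp add: t_def)
    moreover have "2 * a - 1 / a = a * t" using elim by (simp add: t_def power2_eq_square field_simps)
    ultimately show ?case
      unfolding t_def[symmetric] using elim by (simp add: tail_rate_ratio powr_mult algebra_simps)
  qed
  ultimately show ?thesis by (rule Lim_transform_eventually)
qed

lemma eventually_cut_mass_ge_tail_rate:
  assumes r2: "r < 2" and \<delta>: "\<delta> < 1"
  shows "\<forall>\<^sub>F a in at_top. \<delta> * tail_rate \<alpha> r a \<le> cut_mass \<alpha> r a (2 * a)"
proof -
  let ?t = "\<lambda>a::real. a + 1 / a" and ?b = "\<lambda>a::real. 2 * a - 1 / a"
  let ?q = "\<lambda>a. (1 - exp (- a\<^sup>2 * (1 / a))) ^ 8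
      * ((tail_rate \<alpha> r (?t a) / tail_rate \<alpha> r a - tail_rate \<alpha> r (?b a) / tail_rate \<alpha> r a)
    / (1 + tail_error \<alpha> r (?t a)))"
  have ratio: "((\<lambda>a. tail_rate \<alpha> r (?t a) / tail_rate \<alpha> r a) \<longlongrightarrow> 1) at_top"
  proof (rule tendsto_tail_rate_ratio)
    show "((\<lambda>a::real. a powr r - ?t a powr r) \<longlongrightarrow> 0) at_top" using r r2 by real_asymp
  qed (real_asymp | rule filterlim_ident)+
  have error: "((\<lambda>a. tail_error \<alpha> r (?t a)) \<longlongrightarrow> 0) at_top"
    by (rule filterlim_compose[OF tendsto_tail_error_at_top]) real_asymp
  have "((\<lambda>a::real. (1 - exp (- a\<^sup>2 * (1 / a))) ^ 8) \<longlongrightarrow> 1) at_top" by real_asymp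
  then have "(?q \<longlongrightarrow> 1 * ((1 - 0) / (1 + 0))) at_top"
    by (intro tendsto_intros ratio tendsto_tail_rate_double error) auto
  then have "\<forall>\<^sub>F a in at_top. \<delta> < ?q a" by (rule order_tendstoD) (use \<delta> in simp)
  then show ?thesis
    using eventually_ge_at_top[of 2]
  proof eventually_elim
    case (elim a)
    have pos: "0 < tail_rate \<alpha> r a" using elim by (intro tail_rate_pos) simp
    have "0 < 1 / a" "1 / a \<le> 1" using elim by auto
    then have order: "0 < ?t a" "?t a \<le> ?b a" using elim(2) by linarith+
    have "0 \<le> tail_error \<alpha> r (?t a)" using \<alpha> r by (simp add: tail_error_def)
    then have "(tail_rate \<alpha> r (?t a) - tail_rate \<alpha> r (?b a)) / (1 + tail_error \<alpha> r (?t a))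
        \<le> exp_integral \<alpha> r (?t a) (?b a)"
      using tail_rate_diff_le[OF order] by (simp add: divide_le_eq mult.commute)
    then have "(1 - exp (- a\<^sup>2 * (1 / a))) ^ 8
        * ((tail_rate \<alpha> r (?t a) - tail_rate \<alpha> r (?b a)) / (1 + tail_error \<alpha> r (?t a)))
        \<le> (1 - exp (- a\<^sup>2 * (1 / a))) ^ 8 * exp_integral \<alpha> r (?t a) (?b a)"
      by (rule mult_left_mono) simp
    also have "\<dots> \<le> cut_mass \<alpha> r a (2 * a)" using elim order by (intro cut_mass_ge) auto
    finally have "?q a * tail_rate \<alpha> r a \<le> cut_mass \<alpha> r a (2 * a)" using pos
      by (simp flip: diff_divide_distrib)
    moreover have "\<delta> * tail_rate \<alpha> r a \<le> ?q a * tail_rate \<alpha> r a" using elim pos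
      by (intro mult_right_mono) auto
    ultimately show ?case by linarith
  qed
qed

lemma eventually_exp_powr_ge:
  assumes r2: "r < 2" and \<delta>: "\<delta> < 1"
  shows "\<forall>\<^sub>F a in at_top. \<delta> * exp (- 2 * \<alpha> * a powr r) \<le> exp (- 2 * \<alpha> * (a + 1 / a) powr r)"
proof -
  have "((\<lambda>a::real. a powr r - (a + 1 / a) powr r) \<longlongrightarrow> 0) at_top" using r r2 by real_asymp
  then have "((\<lambda>a::real. exp (2 * \<alpha> * (a powr r - (a + 1 / a) powr r))) \<longlongrightarrow> exp (2 * \<alpha> * 0)) at_top"
    by (intro tendsto_intros)
  then have "\<forall>\<^sub>F a::real in at_top. \<delta> < exp (2 * \<alpha> * (a powr r - (a + 1 / a) powr r))"
    by (rule order_tendstoD) (use \<delta> in simp)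
  then show ?thesis
  proof eventually_elim
    case (elim a)
    from mult_right_mono[OF less_imp_le[OF this], of "exp (- 2 * \<alpha> * a powr r)"]
    show ?case by (simp add: algebra_simps flip: exp_add)
  qed
qed

end

lemma minimax_lower_bound:
  assumes \<alpha>: "0 < \<alpha>" and r: "0 < r" "r < 2" and L: "0 < L" and fe: "prob_density fe"
    and N: "assumption_N \<beta> s (fourier fe)" and ND: "assumption_ND \<beta> s (fourier fe)" and \<delta>: "0 \<le> \<delta>" "\<delta> < 1"
  obtains C K where "0 \<le> C" "\<forall>\<^sub>F a in at_top. \<forall>n x. \<forall>T\<in>estimators n.
     ennreal (\<delta> * (L / pi * tail_rate \<alpha> r a) * affinity_bound (C * (a ^ K * exp (- balance \<alpha> \<beta> r s a))) n)
       \<le> risk_pt fe \<alpha> r L n x T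
   \<and> ennreal (\<delta> * (L * exp (- 2 * \<alpha> * a powr r)) * affinity_bound (C * (a ^ K * exp (- balance \<alpha> \<beta> r s a))) n)
       \<le> risk_L2 fe \<alpha> r L n T"
proof -
  let ?\<gamma> = "sqrt \<delta>"
  have \<gamma>: "0 \<le> ?\<gamma>" "?\<gamma> < 1" using \<delta> by auto
  have \<gamma>\<gamma>: "\<delta> * (L * y) = ?\<gamma> * L * (?\<gamma> * y)" for y using \<delta> by (simp add: algebra_simps)
  obtain C K where C: "0 \<le> C" and bound: "\<forall>\<^sub>F a in at_top. \<forall>b\<in>{a + 1 / a..2 * a}. \<forall>n x. \<forall>T\<in>estimators n.
       ennreal (?\<gamma> * L / pi * cut_mass \<alpha> r a b * affinity_bound (C * (a ^ K * exp (- balance \<alpha> \<beta> r s a))) n)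
         \<le> risk_pt fe \<alpha> r L n x T
     \<and> ennreal (?\<gamma> * L * exp (- 2 * \<alpha> * b powr r)
         * affinity_bound (C * (a ^ K * exp (- balance \<alpha> \<beta> r s a))) n)
         \<le> risk_L2 fe \<alpha> r L n T"
    using minimax_lower_bound_cut_mass[OF \<alpha> r _ _ fe N ND, of "?\<gamma> * L" L] \<gamma> L by auto
  have "\<forall>\<^sub>F a in at_top. \<forall>n x. \<forall>T\<in>estimators n.
       ennreal (\<delta> * (L / pi * tail_rate \<alpha> r a) * affinity_bound (C * (a ^ K * exp (- balance \<alpha> \<beta> r s a))) n)
         \<le> risk_pt fe \<alpha> r L n x T
     \<and> ennreal (\<delta> * (L * exp (- 2 * \<alpha> * a powr r))
         * affinity_bound (C * (a ^ K * exp (- balance \<alpha> \<beta> r s a))) n)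
         \<le> risk_L2 fe \<alpha> r L n T"
    using bound eventually_cut_mass_ge_tail_rate[OF \<alpha> r \<gamma>(2)] eventually_exp_powr_ge[OF \<alpha> r \<gamma>(2)]
        eventually_ge_at_top[of 1]
  proof eventually_elim
    case (elim a)
    have "1 / a \<le> 1" using elim by simp
    then have "1 / a \<le> a" using elim by linarith
    then have b: "2 * a \<in> {a + 1 / a..2 * a}" "a + 1 / a \<in> {a + 1 / a..2 * a}" by auto
    have pt: "0 \<le> \<delta> * (L / pi * tail_rate \<alpha> r a)"
        "\<delta> * (L / pi * tail_rate \<alpha> r a) \<le> ?\<gamma> * L / pi * cut_mass \<alpha> r a (2 * a)"
      using elim \<delta> L \<gamma> tail_rate_pos[OF \<alpha> r(1), of a] by (auto simp: \<gamma>\<gamma> divide_right_mono mult_left_mono)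
    have L2: "0 \<le> \<delta> * (L * exp (- 2 * \<alpha> * a powr r))"
        "\<delta> * (L * exp (- 2 * \<alpha> * a powr r)) \<le> ?\<gamma> * L * exp (- 2 * \<alpha> * (a + 1 / a) powr r)"
      unfolding \<gamma>\<gamma> using elim \<delta> L \<gamma> by (auto intro: mult_left_mono)
    show ?case
      using elim(1) b ennreal_mult_right_mono_pos[OF pt] ennreal_mult_right_mono_pos[OF L2]
      by (meson order_trans)
  qed
  with C show ?thesis by (rule that)
qed

section \<open>Bandwidths\<close>

lemma abs_powr_diff_le:
  fixes x y p :: real
  assumes x: "0 \<le> x" and y: "0 < y" and p: "0 \<le> p" "p \<le> 1"
  shows "\<bar>x powr p - y powr p\<bar> \<le> y powr (p - 1) * \<bar>x - y\<bar>"
proof -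
  define t where "t = x / y"
  have t: "0 \<le> t" "x = y * t" using x y by (auto simp: t_def)
  have "\<bar>t powr p - 1\<bar> \<le> \<bar>t - 1\<bar>"
  proof (cases "1 \<le> t")
    case True
    then have "1 \<le> t powr p" "t powr p \<le> t powr 1" using p powr_mono[of p 1 t]
      by (auto intro: ge_one_powr_ge_zero)
    then show ?thesis using True by simp
  next
    case False
    then have "t powr p \<le> 1" "t powr 1 \<le> t powr p" using t p powr_mono'[of p 1 t] by (auto intro: powr_le1)
    then show ?thesis using False t by simp
  qed
  then have "y powr p * \<bar>t powr p - 1\<bar> \<le> y powr (p - 1) * y * \<bar>t - 1\<bar>"
    using y powr_add[of y "p - 1" 1] by (simp add: mult_left_mono)
  moreover have "x powr p - y powr p = y powr p * (t powr p - 1)" "x - y = y * (t - 1)"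
    using t y by (simp_all add: powr_mult right_diff_distrib)
  ultimately show ?thesis using y by (simp add: abs_mult mult.assoc)
qed

lemma power_le_powr_divide:
  fixes a y s :: real
  assumes "0 < a" "0 < s" "a powr s \<le> y" shows "a ^ k \<le> y powr (real k / s)"
proof -
  have "a ^ k = (a powr s) powr (real k / s)" using assms by (simp add: powr_powr powr_realpow)
  also have "\<dots> \<le> y powr (real k / s)" using assms by (intro powr_mono2) auto
  finally show ?thesis .
qed

lemma filterlim_ln_nat: "filterlim (\<lambda>n. ln (real n)) at_top sequentially"
  by (rule filterlim_compose[OF ln_at_top filterlim_real_sequentially])

lemma tendsto_powr_mult_exp_ln_square:
  assumes "0 < c" shows "((\<lambda>l::real. (c * l) powr q * exp (- (ln l)\<^sup>2)) \<longlongrightarrow> 0) at_top"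
  using assms by real_asymp

locale bandwidth_balance =
  fixes \<alpha> \<beta> r s :: real
  assumes \<alpha>: "0 < \<alpha>" and \<beta>: "0 < \<beta>" and r: "0 < r" "r < s"
begin

abbreviation "W \<equiv> balance \<alpha> \<beta> r s"

abbreviation "a_star n \<equiv> 1 / h_star \<alpha> \<beta> r s n"

lemma s: "0 < s"
  using r by linarith

lemma balance_strict_mono: "0 \<le> a \<Longrightarrow> a < b \<Longrightarrow> W a < W b"
  unfolding balance_def using \<alpha> \<beta> r s by (intro add_strict_mono mult_strict_left_mono powr_less_mono2) auto

lemma filterlim_at_top_if_balance:
  assumes W: "filterlim (\<lambda>x. W (a x)) at_top F" and a: "\<forall>\<^sub>F x in F. 0 \<le> a x"
  shows "filterlim a at_top F"
  unfolding filterlim_at_top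
proof
  fix z
  have "\<forall>\<^sub>F x in F. W (max 0 z) < W (a x)" using W by (simp add: filterlim_at_top_dense)
  with a show "\<forall>\<^sub>F x in F. z \<le> a x"
  proof eventually_elim
    case (elim x)
    then have "\<not> a x < max 0 z" using balance_strict_mono less_asym by blast
    then show ?case by simp
  qed
qed

lemma balance_inverse: "0 < h \<Longrightarrow> W (1 / h) = 2 * \<beta> / h powr s + 2 * \<alpha> / h powr r"
  by (simp add: balance_def powr_divide)

lemma bandwidth_equation_unique:
  assumes "0 < y" shows "\<exists>!h. 0 < h \<and> 2 * \<beta> / h powr s + 2 * \<alpha> / h powr r = y"
proof -
  define m where "m = (y / (2 * \<beta>)) powr (1 / s)"
  have m: "0 \<le> m" "y \<le> W m" using assms \<alpha> \<beta> s by (auto simp: m_def balance_def powr_powr)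
  have "continuous_on {0..m} W"
    unfolding balance_def[abs_def] using r s by (intro continuous_intros continuous_on_powr') auto
  then obtain a where a: "0 \<le> a" "W a = y" using IVT'[of W 0 y m] m assms by (auto simp: balance_def)
  then have a0: "0 < a" using assms by (cases "a = 0") (auto simp: balance_def)
  show ?thesis
  proof (rule ex1I[of _ "1 / a"])
    show "0 < 1 / a \<and> 2 * \<beta> / (1 / a) powr s + 2 * \<alpha> / (1 / a) powr r = y"
      using a0 a balance_inverse[of "1 / a"] by simp
    fix h assume h: "0 < h \<and> 2 * \<beta> / h powr s + 2 * \<alpha> / h powr r = y"
    then have "W (1 / h) = W a" using a by (simp add: balance_inverse)
    then have "1 / h = a"
      using balance_strict_mono[of a "1 / h"] balance_strict_mono[of "1 / h" a] a0 h
      by (cases "1 / h" a rule: linorder_cases) auto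
    then show "h = 1 / a" by auto
  qed
qed

lemma h_star_balance:
  assumes "0 < ln (real n) - (ln (ln (real n)))\<^sup>2"
  shows "0 < h_star \<alpha> \<beta> r s n" "W (a_star n) = ln (real n) - (ln (ln (real n)))\<^sup>2"
  using theI'[OF bandwidth_equation_unique[OF assms]] unfolding h_star_def[symmetric]
  by (auto simp: balance_inverse)

lemma eventually_h_star:
  "\<forall>\<^sub>F n in sequentially. 1 < n \<and> 1 \<le> ln (real n) \<and> (ln (ln (real n)))\<^sup>2 \<le> ln (real n) / 2 \<and>
    0 < h_star \<alpha> \<beta> r s n \<and>
    W (a_star n) = ln (real n) - (ln (ln (real n)))\<^sup>2"
proof -
  have "\<forall>\<^sub>F l::real in at_top. 1 \<le> l" "\<forall>\<^sub>F l::real in at_top. (ln l)\<^sup>2 \<le> l / 2" by real_asymp+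
  from eventually_compose_filterlim[OF eventually_conj[OF this] filterlim_ln_nat] eventually_gt_at_top[of 1]
      show ?thesis
  proof eventually_elim
    case (elim n)
    then have "0 < ln (real n) - (ln (ln (real n)))\<^sup>2" by linarith
    from h_star_balance[OF this] elim show ?case by blast
  qed
qed

lemma eventually_a_star_pos: "\<forall>\<^sub>F n in sequentially. 0 < a_star n"
  using eventually_h_star by eventually_elim simp

lemma filterlim_a_star: "filterlim a_star at_top sequentially"
proof (rule filterlim_at_top_if_balance)
  have "filterlim (\<lambda>l::real. l - (ln l)\<^sup>2) at_top at_top" by real_asymp
  from filterlim_compose[OF this filterlim_ln_nat] show "filterlim (\<lambda>n. W (a_star n)) at_top sequentially"
    by (rule filterlim_mono_eventually[OF _ order_refl order_refl])
      (use eventually_h_star in \<open>eventually_elim, simp\<close>)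
  show "\<forall>\<^sub>F n in sequentially. 0 \<le> a_star n" using eventually_a_star_pos by eventually_elim simp
qed

definition equivalent_cutoff :: "(nat \<Rightarrow> real) \<Rightarrow> bool" where
  "equivalent_cutoff a \<longleftrightarrow> (\<forall>\<^sub>F n in sequentially. 0 < a n) \<and> (\<lambda>n. a_star n powr r - a n powr r) \<longlonglongrightarrow> 0"

lemma equivalent_cutoff_a_star: "equivalent_cutoff a_star"
  unfolding equivalent_cutoff_def using eventually_a_star_pos by simp

lemma filterlim_equivalent_cutoff:
  assumes a: "equivalent_cutoff a" shows "filterlim a at_top sequentially"
proof -
  have pos: "\<forall>\<^sub>F n in sequentially. 0 < a n" and diff: "(\<lambda>n. a_star n powr r - a n powr r) \<longlonglongrightarrow> 0"
    using a by (auto simp: equivalent_cutoff_def)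
  have "(\<lambda>n. a n / a_star n) \<longlonglongrightarrow> 1" by (rule tendsto_divide_if_powr_diff[OF r(1) filterlim_a_star pos diff])
  from filterlim_tendsto_pos_mult_at_top[OF this zero_less_one filterlim_a_star]
  show ?thesis
    by (rule filterlim_mono_eventually[OF _ order_refl order_refl])
      (use eventually_a_star_pos in \<open>eventually_elim, simp\<close>)
qed

lemma equivalent_cutoffI:
  assumes pos: "\<forall>\<^sub>F n in sequentially. 0 < a n"
    and close: "\<forall>\<^sub>F n in sequentially. \<bar>a n powr s - a_star n powr s\<bar> \<le> D (a_star n)"
    and D: "((\<lambda>x. x powr (r - s) * D x) \<longlongrightarrow> 0) at_top"
  shows "equivalent_cutoff a"
  unfolding equivalent_cutoff_def
proof (intro conjI pos Lim_null_comparison[OF _ filterlim_compose[OF D filterlim_a_star]])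
  show "\<forall>\<^sub>F n in sequentially. norm (a_star n powr r - a n powr r) \<le> a_star n powr (r - s) * D (a_star n)"
    using pos close eventually_a_star_pos
  proof eventually_elim
    case (elim n)
    have "\<bar>(a n powr s) powr (r / s) - (a_star n powr s) powr (r / s)\<bar>
        \<le> (a_star n powr s) powr (r / s - 1) * \<bar>a n powr s - a_star n powr s\<bar>"
      using elim r s by (intro abs_powr_diff_le) auto
    also have "\<dots> \<le> (a_star n powr s) powr (r / s - 1) * D (a_star n)" using elim
      by (intro mult_left_mono) auto
    finally show ?case using s elim by (simp add: powr_powr right_diff_distrib abs_minus_commute)
  qed
qed

definition negligible_variance :: "(nat \<Rightarrow> real) \<Rightarrow> bool" where
  "negligible_variance a \<longleftrightarrow> (\<forall>k. (\<lambda>n. a n ^ k * exp (W (a n)) / real n) \<longlonglongrightarrow> 0)"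

definition undetectable :: "(nat \<Rightarrow> real) \<Rightarrow> bool" where
  "undetectable a \<longleftrightarrow> (\<forall>k. (\<lambda>n. real n * (a n ^ k * exp (- W (a n)))) \<longlonglongrightarrow> 0)"

lemma negligible_variance_a_star: "negligible_variance a_star"
  unfolding negligible_variance_def
proof
  fix k
  have "((\<lambda>l::real. (1 / (2 * \<beta>) * l) powr (real k / s) * exp (- (ln l)\<^sup>2)) \<longlongrightarrow> 0) at_top"
    using \<beta> by (intro tendsto_powr_mult_exp_ln_square) simp
  from filterlim_compose[OF this filterlim_ln_nat]
  show "(\<lambda>n. a_star n ^ k * exp (W (a_star n)) / real n) \<longlonglongrightarrow> 0"
  proof (rule Lim_null_comparison[rotated])
    show "\<forall>\<^sub>F n in sequentially. norm (a_star n ^ k * exp (W (a_star n)) / real n)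
        \<le> (1 / (2 * \<beta>) * ln (real n)) powr (real k / s) * exp (- (ln (ln (real n)))\<^sup>2)"
      using eventually_h_star
    proof eventually_elim
      case (elim n)
      then have a: "0 < a_star n" and W: "W (a_star n) = ln (real n) - (ln (ln (real n)))\<^sup>2" by auto
      have "exp (W (a_star n)) / real n = exp (- (ln (ln (real n)))\<^sup>2)" using elim unfolding W
        by (simp add: exp_diff exp_minus field_simps)
      moreover have "0 \<le> 2 * \<alpha> * a_star n powr r" using \<alpha> by simp
      then have "2 * \<beta> * a_star n powr s \<le> ln (real n)"
        using W zero_le_power2[of "ln (ln (real n))"] unfolding balance_def by linarith
      then have "a_star n ^ k \<le> (1 / (2 * \<beta>) * ln (real n)) powr (real k / s)"
        using \<beta> a s by (intro power_le_powr_divide) (auto simp: field_simps)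
      ultimately show ?case using a by (simp flip: times_divide_eq_right)
    qed
  qed
qed

subsection \<open>The cut-off of the lower bound\<close>

text \<open>Raising \<open>a_star\<^sup>s\<close> by \<open>(log log n)\<^sup>2/\<beta>\<close> turns the balance \<open>log n - (log log n)\<^sup>2\<close> into at least
  \<open>log n + (log log n)\<^sup>2\<close>.\<close>

definition lower_cutoff :: "nat \<Rightarrow> real" where
  "lower_cutoff n = (a_star n powr s + (ln (ln (real n)))\<^sup>2 / \<beta>) powr (1 / s)"

lemma lower_cutoff_powr:
  assumes "0 < a_star n"
  shows "0 < lower_cutoff n" "lower_cutoff n powr s = a_star n powr s + (ln (ln (real n)))\<^sup>2 / \<beta>"
proof -
  have "0 < a_star n powr s" "0 \<le> (ln (ln (real n)))\<^sup>2 / \<beta>" using assms \<beta> by auto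
  then have "0 < a_star n powr s + (ln (ln (real n)))\<^sup>2 / \<beta>" by linarith
  then show "0 < lower_cutoff n" "lower_cutoff n powr s = a_star n powr s + (ln (ln (real n)))\<^sup>2 / \<beta>"
    using s by (auto simp: lower_cutoff_def powr_powr)
qed

lemma balance_lower_cutoff_ge:
  assumes a: "0 < a_star n" shows "W (a_star n) + 2 * (ln (ln (real n)))\<^sup>2 \<le> W (lower_cutoff n)"
proof -
  note b = lower_cutoff_powr[OF a]
  have "a_star n powr s \<le> lower_cutoff n powr s" using b(2) \<beta> by simp
  from powr_mono2[OF _ powr_ge_zero this, of "r / s"]
  have "(a_star n powr s) powr (r / s) \<le> (lower_cutoff n powr s) powr (r / s)" using r s by simp
  then have "2 * \<alpha> * a_star n powr r \<le> 2 * \<alpha> * lower_cutoff n powr r" using \<alpha> s by (simp add: powr_powr)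
  moreover have "2 * \<beta> * lower_cutoff n powr s = 2 * \<beta> * a_star n powr s + 2 * (ln (ln (real n)))\<^sup>2"
    unfolding b(2) using \<beta> by (simp add: distrib_left)
  ultimately show ?thesis unfolding balance_def by linarith
qed

lemma equivalent_lower_cutoff: "equivalent_cutoff lower_cutoff"
proof (rule equivalent_cutoffI)
  show "\<forall>\<^sub>F n in sequentially. 0 < lower_cutoff n"
    using eventually_a_star_pos by eventually_elim (rule lower_cutoff_powr)
  show "((\<lambda>x. x powr (r - s) * ((ln (2 * W x))\<^sup>2 / \<beta>)) \<longlongrightarrow> 0) at_top"
    unfolding balance_def using \<alpha> \<beta> r by real_asymp
  show "\<forall>\<^sub>F n in sequentially. \<bar>lower_cutoff n powr s - a_star n powr s\<bar> \<le> (ln (2 * W (a_star n)))\<^sup>2 / \<beta>"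
    using eventually_h_star
  proof eventually_elim
    case (elim n)
    then have "ln (real n) \<le> 2 * W (a_star n)" by auto
    then have "(ln (ln (real n)))\<^sup>2 \<le> (ln (2 * W (a_star n)))\<^sup>2" using elim by (intro power_mono ln_mono) auto
    then show ?case using lower_cutoff_powr[of n] elim \<beta> by (simp add: divide_right_mono)
  qed
qed

lemma undetectable_lower_cutoff: "undetectable lower_cutoff"
  unfolding undetectable_def
proof
  fix k
  have "((\<lambda>l::real. (1 / \<beta> * l) powr (real k / s) * exp (- (ln l)\<^sup>2)) \<longlongrightarrow> 0) at_top"
    using \<beta> by (intro tendsto_powr_mult_exp_ln_square) simp
  from filterlim_compose[OF this filterlim_ln_nat]
  show "(\<lambda>n. real n * (lower_cutoff n ^ k * exp (- W (lower_cutoff n)))) \<longlonglongrightarrow> 0"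
  proof (rule Lim_null_comparison[rotated])
    show "\<forall>\<^sub>F n in sequentially. norm (real n * (lower_cutoff n ^ k * exp (- W (lower_cutoff n))))
        \<le> (1 / \<beta> * ln (real n)) powr (real k / s) * exp (- (ln (ln (real n)))\<^sup>2)"
      using eventually_h_star
    proof eventually_elim
      case (elim n)
      let ?ll = "(ln (ln (real n)))\<^sup>2"
      have a: "0 < a_star n" using elim by simp
      note b = lower_cutoff_powr[OF a]
      have W: "W (a_star n) = ln (real n) - ?ll" using elim by simp
      have "- W (lower_cutoff n) \<le> - ln (real n) - ?ll" using balance_lower_cutoff_ge[OF a] W by linarith
      then have "exp (- W (lower_cutoff n)) \<le> exp (- ln (real n) - ?ll)" by simp
      also have "\<dots> = exp (- ?ll) / real n" using elim by (simp add: exp_diff exp_minus field_simps)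
      finally have "real n * exp (- W (lower_cutoff n)) \<le> exp (- ?ll)" using elim by (simp add: field_simps)
      moreover have "0 \<le> 2 * \<alpha> * a_star n powr r" using \<alpha> by simp
      then have "2 * \<beta> * a_star n powr s \<le> ln (real n) - ?ll" using W unfolding balance_def by linarith
      then have "2 * \<beta> * lower_cutoff n powr s \<le> 2 * ln (real n)"
        unfolding b(2) using \<beta> elim by (simp add: distrib_left)
      then have "lower_cutoff n ^ k \<le> (1 / \<beta> * ln (real n)) powr (real k / s)"
        using b(1) s \<beta> by (intro power_le_powr_divide) (auto simp: field_simps)
      ultimately have "lower_cutoff n ^ k * (real n * exp (- W (lower_cutoff n)))
          \<le> (1 / \<beta> * ln (real n)) powr (real k / s) * exp (- ?ll)"
        by (intro mult_mono) auto
      then show ?case using b(1) by (simp add: mult_ac)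
    qed
  qed
qed

subsection \<open>The bandwidth \<open>h_a\<close>\<close>

lemma h_a_cutoff:
  assumes "0 < ln (real n) / (2 * \<beta>) - sqrt (ln (real n) / (2 * \<beta>))"
  shows "0 < h_a \<beta> s n" "(1 / h_a \<beta> s n) powr s = ln (real n) / (2 * \<beta>) - sqrt (ln (real n) / (2 * \<beta>))"
  using assms s by (auto simp: h_a_def powr_powr powr_minus inverse_eq_divide)

lemma eventually_h_a:
  "\<forall>\<^sub>F n in sequentially. 0 < h_a \<beta> s n \<and>
    (1 / h_a \<beta> s n) powr s = ln (real n) / (2 * \<beta>) - sqrt (ln (real n) / (2 * \<beta>))"
proof -
  have "\<forall>\<^sub>F l in at_top. 0 < l / (2 * \<beta>) - sqrt (l / (2 * \<beta>))" using \<beta> by real_asymp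
  from eventually_compose_filterlim[OF this filterlim_ln_nat] show ?thesis
    by eventually_elim (use h_a_cutoff in blast)
qed

lemma equivalent_cutoff_h_a:
  assumes r2: "r < s / 2" shows "equivalent_cutoff (\<lambda>n. 1 / h_a \<beta> s n)"
proof (rule equivalent_cutoffI)
  show "\<forall>\<^sub>F n in sequentially. 0 < 1 / h_a \<beta> s n" using eventually_h_a by eventually_elim simp
  show "((\<lambda>x. x powr (r - s) * (sqrt (W x / \<beta>) + (ln (2 * W x))\<^sup>2 / (2 * \<beta>) + \<alpha> / \<beta> * x powr r)) \<longlongrightarrow> 0) at_top"
    unfolding balance_def using \<alpha> \<beta> r r2 by real_asymp
  show "\<forall>\<^sub>F n in sequentially. \<bar>(1 / h_a \<beta> s n) powr s - a_star n powr s\<bar>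
      \<le> sqrt (W (a_star n) / \<beta>) + (ln (2 * W (a_star n)))\<^sup>2 / (2 * \<beta>) + \<alpha> / \<beta> * a_star n powr r"
    using eventually_h_star eventually_h_a
  proof eventually_elim
    case (elim n)
    let ?l = "ln (real n)" and ?W = "W (a_star n)"
    have W: "?l \<le> 2 * ?W" using elim by linarith
    then have "sqrt (?l / (2 * \<beta>)) \<le> sqrt (?W / \<beta>)" using \<beta> by (simp add: field_simps)
    moreover have "(ln ?l)\<^sup>2 / (2 * \<beta>) \<le> (ln (2 * ?W))\<^sup>2 / (2 * \<beta>)"
      using W elim \<beta> by (intro divide_right_mono power_mono ln_mono) auto
    moreover have "a_star n powr s = (?l - (ln ?l)\<^sup>2 - 2 * \<alpha> * a_star n powr r) / (2 * \<beta>)"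
      using elim \<beta> by (simp add: balance_def eq_divide_eq mult.commute)
    then have "a_star n powr s = ?l / (2 * \<beta>) - (ln ?l)\<^sup>2 / (2 * \<beta>) - \<alpha> / \<beta> * a_star n powr r"
      using \<beta> by (simp add: diff_divide_distrib)
    moreover have "0 \<le> sqrt (?l / (2 * \<beta>))" "0 \<le> (ln ?l)\<^sup>2 / (2 * \<beta>)" "0 \<le> \<alpha> / \<beta> * a_star n powr r"
      using \<alpha> \<beta> elim by auto
    ultimately show ?case using elim by linarith
  qed
qed

lemma negligible_variance_h_a:
  assumes r2: "r < s / 2" shows "negligible_variance (\<lambda>n. 1 / h_a \<beta> s n)"
  unfolding negligible_variance_def
proof
  fix k
  have p: "r / s < 1 / 2" using r2 s by (simp add: field_simps)
  have "((\<lambda>l::real. (l / (2 * \<beta>)) powr (real k / s)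
      * exp (2 * \<alpha> * (l / (2 * \<beta>)) powr (r / s) - 2 * \<beta> * sqrt (l / (2 * \<beta>)))) \<longlongrightarrow> 0) at_top"
    using p \<alpha> \<beta> by real_asymp
  from filterlim_compose[OF this filterlim_ln_nat]
  show "(\<lambda>n. (1 / h_a \<beta> s n) ^ k * exp (W (1 / h_a \<beta> s n)) / real n) \<longlonglongrightarrow> 0"
  proof (rule Lim_null_comparison[rotated])
    show "\<forall>\<^sub>F n in sequentially. norm ((1 / h_a \<beta> s n) ^ k * exp (W (1 / h_a \<beta> s n)) / real n)
        \<le> (ln (real n) / (2 * \<beta>)) powr (real k / s)
          * exp (2 * \<alpha> * (ln (real n) / (2 * \<beta>)) powr (r / s) - 2 * \<beta> * sqrt (ln (real n) / (2 * \<beta>)))"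
      using eventually_h_star eventually_h_a
    proof eventually_elim
      case (elim n)
      define a t where "a = 1 / h_a \<beta> s n" and "t = ln (real n) / (2 * \<beta>)"
      have a: "0 < a" "a powr s = t - sqrt t" and t: "0 \<le> t" using elim \<beta> by (auto simp: a_def t_def)
      have le: "a powr s \<le> t" using a t by simp
      from powr_mono2[OF _ powr_ge_zero this, of "r / s"] have "a powr r \<le> t powr (r / s)" using r s
        by (simp add: powr_powr)
      then have "2 * \<alpha> * a powr r \<le> 2 * \<alpha> * t powr (r / s)" using \<alpha> by simp
      moreover have "2 * \<beta> * a powr s = ln (real n) - 2 * \<beta> * sqrt t" unfolding a(2) using \<beta>
        by (simp add: t_def right_diff_distrib)
      ultimately have "exp (W a) \<le> exp (ln (real n) + (2 * \<alpha> * t powr (r / s) - 2 * \<beta> * sqrt t))"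
        by (simp add: balance_def)
      also have "\<dots> = real n * exp (2 * \<alpha> * t powr (r / s) - 2 * \<beta> * sqrt t)" using elim by (simp add: exp_add)
      finally have "exp (W a) / real n \<le> exp (2 * \<alpha> * t powr (r / s) - 2 * \<beta> * sqrt t)" using elim
        by (simp add: divide_le_eq mult.commute)
      then have "a ^ k * (exp (W a) / real n)
          \<le> t powr (real k / s) * exp (2 * \<alpha> * t powr (r / s) - 2 * \<beta> * sqrt t)"
        using a s le by (intro mult_mono power_le_powr_divide) auto
      then show ?case unfolding a_def[symmetric] t_def[symmetric] using a by simp
    qed
  qed
qed

end

section \<open>Sharp rates\<close>

subsection \<open>Normalized risks\<close>

lemma ennreal_mult_inverse_le: "x \<le> ennreal y \<Longrightarrow> 0 < R \<Longrightarrow> x * ennreal (1 / R) \<le> ennreal (y / R)"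
  using mult_right_mono[of x "ennreal y" "ennreal (1 / R)"] by (simp flip: ennreal_mult'')

lemma ennreal_le_mult_inverse: "ennreal y \<le> x \<Longrightarrow> 0 < R \<Longrightarrow> ennreal (y / R) \<le> x * ennreal (1 / R)"
  using mult_right_mono[of "ennreal y" x "ennreal (1 / R)"] by (simp flip: ennreal_mult'')

lemma limsup_normalized_le_one:
  fixes f :: "nat \<Rightarrow> ennreal" and u R S :: "nat \<Rightarrow> real"
  assumes f: "\<forall>\<^sub>F n in sequentially. f n \<le> ennreal (u n * R n)" and S: "\<forall>\<^sub>F n in sequentially. 0 < S n"
    and u: "u \<longlonglongrightarrow> 1" and ratio: "(\<lambda>n. R n / S n) \<longlonglongrightarrow> 1"
  shows "limsup (\<lambda>n. f n * ennreal (1 / S n)) \<le> 1"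
proof -
  have "\<forall>\<^sub>F n in sequentially. f n * ennreal (1 / S n) \<le> ennreal (u n * (R n / S n))"
    using f S by eventually_elim (use ennreal_mult_inverse_le in fastforce)
  then have "limsup (\<lambda>n. f n * ennreal (1 / S n)) \<le> limsup (\<lambda>n. ennreal (u n * (R n / S n)))"
    by (rule Limsup_mono)
  also have "(\<lambda>n. ennreal (u n * (R n / S n))) \<longlonglongrightarrow> ennreal (1 * 1)" by (intro tendsto_intros u ratio)
  then have "limsup (\<lambda>n. ennreal (u n * (R n / S n))) = 1" by (simp add: lim_imp_Limsup)
  finally show ?thesis .
qed

lemma liminf_normalized_ge_one:
  fixes f :: "nat \<Rightarrow> ennreal" and u R S :: "nat \<Rightarrow> real"
  assumes f: "\<And>\<delta>. 0 < \<delta> \<Longrightarrow> \<delta> < 1 \<Longrightarrow> \<exists>u. u \<longlonglongrightarrow> \<delta> \<and> (\<forall>\<^sub>F n in sequentially. ennreal (u n * R n) \<le> f n)"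
    and S: "\<forall>\<^sub>F n in sequentially. 0 < S n" and ratio: "(\<lambda>n. R n / S n) \<longlonglongrightarrow> 1"
  shows "1 \<le> liminf (\<lambda>n. f n * ennreal (1 / S n))"
  unfolding le_Liminf_iff
proof (intro allI impI)
  fix y :: ennreal assume y: "y < 1"
  then obtain t where t: "y = ennreal t" "0 \<le> t" by (cases y) auto
  then have "t < 1" using y by (simp add: ennreal_less_one_iff)
  then obtain \<delta> where \<delta>: "t < \<delta>" "\<delta> < 1" using dense by blast
  then obtain u where u: "u \<longlonglongrightarrow> \<delta>" "\<forall>\<^sub>F n in sequentially. ennreal (u n * R n) \<le> f n" using f[of \<delta>] t by auto
  have "(\<lambda>n. u n * (R n / S n)) \<longlonglongrightarrow> \<delta>" using tendsto_mult[OF u(1) ratio] by simp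
  then have "\<forall>\<^sub>F n in sequentially. t < u n * (R n / S n)" by (rule order_tendstoD) fact
  with u(2) S show "\<forall>\<^sub>F n in sequentially. y < f n * ennreal (1 / S n)"
  proof eventually_elim
    case (elim n)
    have "y < ennreal (u n * R n / S n)" using elim t by (simp add: ennreal_less_iff)
    also have "\<dots> \<le> f n * ennreal (1 / S n)" using elim by (intro ennreal_le_mult_inverse)
    finally show ?case .
  qed
qed

lemma tendsto_one_between:
  fixes f g :: "nat \<Rightarrow> ennreal"
  assumes f: "1 \<le> liminf f" and fg: "\<forall>\<^sub>F n in sequentially. f n \<le> g n" and g: "limsup g \<le> 1"
  shows "f \<longlonglongrightarrow> 1" "g \<longlonglongrightarrow> 1"
proof -
  have "liminf f \<le> liminf g" "limsup f \<le> limsup g" using fg by (auto intro: Liminf_mono Limsup_mono)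
  moreover have "liminf f \<le> limsup f" "liminf g \<le> limsup g" by (auto intro: Liminf_le_Limsup)
  ultimately have "liminf f = 1" "limsup f = 1" "liminf g = 1" "limsup g = 1" using f g by auto
  then show "f \<longlonglongrightarrow> 1" "g \<longlonglongrightarrow> 1" by (auto simp: tendsto_iff_Liminf_eq_Limsup)
qed

lemma tendsto_affinity_bound:
  assumes \<kappa>: "\<forall>\<^sub>F n in sequentially. 0 \<le> \<kappa> n" and null: "(\<lambda>n. real n * \<kappa> n) \<longlonglongrightarrow> 0"
  shows "(\<lambda>n. affinity_bound (\<kappa> n) n) \<longlonglongrightarrow> 1"
proof -
  have "(\<lambda>n. exp (real n * \<kappa> n) - 1) \<longlonglongrightarrow> exp 0 - 1" by (intro tendsto_intros null)
  then have upper: "(\<lambda>n. exp (real n * \<kappa> n) - 1) \<longlonglongrightarrow> 0" by simp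
  have "(\<lambda>n. (1 + \<kappa> n) ^ n - 1) \<longlonglongrightarrow> 0"
  proof (rule tendsto_sandwich[OF _ _ tendsto_const upper])
    show "\<forall>\<^sub>F n in sequentially. 0 \<le> (1 + \<kappa> n) ^ n - 1" using \<kappa> by eventually_elim simp
    show "\<forall>\<^sub>F n in sequentially. (1 + \<kappa> n) ^ n - 1 \<le> exp (real n * \<kappa> n) - 1"
      using \<kappa>
    proof eventually_elim
      case (elim n)
      then have "(1 + \<kappa> n) ^ n \<le> exp (\<kappa> n) ^ n" by (intro power_mono) auto
      then show ?case by (simp add: exp_of_nat_mult)
    qed
  qed
  then have "(\<lambda>n. 1 - 2 * sqrt ((1 + \<kappa> n) ^ n - 1)) \<longlonglongrightarrow> 1 - 2 * sqrt 0" by (intro tendsto_intros)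
  then show ?thesis by (simp add: affinity_bound_def)
qed

subsection \<open>Upper bounds\<close>

lemma noise_inverse_le:
  assumes fe: "prob_density fe" and N: "assumption_N \<beta> s (fourier fe)" and nonzero: "\<And>u. fourier fe u \<noteq> 0"
  obtains C K where
    "\<And>a u. 1 \<le> a \<Longrightarrow> \<bar>u\<bar> \<le> a \<Longrightarrow> 1 / cmod (fourier fe u) \<le> C * a ^ K * exp (\<beta> * a powr s)"
proof -
  obtain u0 b \<gamma> where b: "0 < b" and \<beta>: "0 < \<beta>" "0 < s"
    and lower: "\<And>u. u0 \<le> \<bar>u\<bar> \<Longrightarrow> b * \<bar>u\<bar> powr \<gamma> * exp (- \<beta> * \<bar>u\<bar> powr s) \<le> cmod (fourier fe u)"
    using N unfolding assumption_N_def by metis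
  define u1 where "u1 = max 1 u0"
  have "continuous_on {-u1..u1} (\<lambda>u. 1 / cmod (fourier fe u))"
    using continuous_on_fourier[OF prob_densityD(3)[OF fe]] nonzero by (intro continuous_intros) auto
  then have "bounded ((\<lambda>u. 1 / cmod (fourier fe u)) ` {-u1..u1})"
    by (intro compact_imp_bounded compact_continuous_image) auto
  then obtain C0 where C0: "0 < C0" "\<And>u. u \<in> {-u1..u1} \<Longrightarrow> 1 / cmod (fourier fe u) \<le> C0"
    unfolding bounded_pos by (auto simp: abs_le_iff)
  obtain K where K: "- \<gamma> \<le> real K" using real_arch_simple by blast
  show ?thesis
  proof (rule that[of "max C0 (1 / b)" K])
    fix a u :: real assume a: "1 \<le> a" and u: "\<bar>u\<bar> \<le> a"
    show "1 / cmod (fourier fe u) \<le> max C0 (1 / b) * a ^ K * exp (\<beta> * a powr s)"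
    proof (cases "\<bar>u\<bar> \<le> u1")
      case True
      then have "1 / cmod (fourier fe u) \<le> C0 * 1 * 1" using C0(2)[of u] by (auto simp: abs_le_iff)
      also have "\<dots> \<le> max C0 (1 / b) * a ^ K * exp (\<beta> * a powr s)"
        using C0(1) a \<beta> by (intro mult_mono one_le_power) auto
      finally show ?thesis .
    next
      case False
      then have u1: "1 \<le> \<bar>u\<bar>" "u0 \<le> \<bar>u\<bar>" by (auto simp: u1_def)
      have "\<bar>u\<bar> powr (- \<gamma>) \<le> \<bar>u\<bar> powr real K" using u1 K by (intro powr_mono)
      also have "\<dots> = \<bar>u\<bar> ^ K" using u1 by (intro powr_realpow) simp
      also have "\<dots> \<le> a ^ K" using u by (intro power_mono) auto
      finally have power: "\<bar>u\<bar> powr (- \<gamma>) \<le> a ^ K" .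
      have "1 / cmod (fourier fe u) \<le> 1 / (b * \<bar>u\<bar> powr \<gamma> * exp (- \<beta> * \<bar>u\<bar> powr s))"
        using lower[OF u1(2)] b u1 nonzero[of u] by (intro divide_left_mono mult_pos_pos) auto
      also have "\<dots> = 1 / b * \<bar>u\<bar> powr (- \<gamma>) * exp (\<beta> * \<bar>u\<bar> powr s)"
        by (simp add: powr_minus exp_minus field_simps)
      also have "\<dots> \<le> max C0 (1 / b) * a ^ K * exp (\<beta> * a powr s)"
        using power b u \<beta> C0(1) by (intro mult_mono) (auto intro!: powr_mono2)
      finally show ?thesis .
    qed
  qed
qed

locale deconvolution_problem = bandwidth_balance +
  fixes fe :: "real \<Rightarrow> real" and L :: real
  assumes s_le_2: "s \<le> 2" and L: "0 < L" and noise: "prob_density fe" and N: "assumption_N \<beta> s (fourier fe)"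
    and ND: "assumption_ND \<beta> s (fourier fe)" and noise_nonzero: "\<And>u. fourier fe u \<noteq> 0"
begin

lemma r_less_2: "r < 2"
  using r s_le_2 by linarith

lemma tail_rate_ge:
  assumes "1 \<le> a" shows "exp (- 2 * \<alpha> * a powr r) / a / (2 * \<alpha> * r) \<le> tail_rate \<alpha> r a"
proof -
  have "a powr (- 1) \<le> a powr (1 - r)" using assms r_less_2 by (intro powr_mono) auto
  then have "exp (- 2 * \<alpha> * a powr r) * a powr (- 1) \<le> exp (- 2 * \<alpha> * a powr r) * a powr (1 - r)"
    by (intro mult_left_mono) auto
  then show ?thesis
    unfolding tail_rate_def using assms \<alpha> r
    by (intro divide_right_mono) (auto simp: powr_minus_divide mult.commute)
qed

lemma exp_balance: "exp (W a) = (exp (\<beta> * a powr s))\<^sup>2 * exp (2 * \<alpha> * a powr r)"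
  by (simp add: balance_def exp_add mult.assoc flip: exp_double)

lemma pointwise_variance_le:
  fixes a C x :: real
  assumes a: "1 \<le> a" and x: "0 \<le> x"
  shows "(a * (C * a ^ K * exp (\<beta> * a powr s)) / pi)\<^sup>2 / x
    \<le> 2 * \<alpha> * r * C\<^sup>2 / (pi * L) * (a ^ (2 * K + 3) * exp (W a) / x) * (L / pi * tail_rate \<alpha> r a)"
proof -
  have algebra: "(a * (C * b * E) / pi)\<^sup>2 / x
      = 2 * \<alpha> * r * C\<^sup>2 / (pi * L) * ((a * b)\<^sup>2 * a * (E\<^sup>2 * F) / x)
          * (L / pi * (inverse F / a / (2 * \<alpha> * r)))"
    if "0 < F" for b E F :: real
    using that a \<alpha> r L by (simp add: power2_eq_square mult_ac)
  have cancel: "exp (- 2 * \<alpha> * a powr r) = inverse (exp (2 * \<alpha> * a powr r))" by (simp flip: exp_minus)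
  have power: "a ^ (2 * K + 3) = (a * a ^ K)\<^sup>2 * a"
    by (simp add: power_add power_even_eq power2_eq_square power3_eq_cube)
  have "(a * (C * a ^ K * exp (\<beta> * a powr s)) / pi)\<^sup>2 / x
      = 2 * \<alpha> * r * C\<^sup>2 / (pi * L) * (a ^ (2 * K + 3) * exp (W a) / x)
          * (L / pi * (exp (- 2 * \<alpha> * a powr r) / a / (2 * \<alpha> * r)))"
    unfolding power exp_balance cancel by (rule algebra) simp
  also have "\<dots> \<le> 2 * \<alpha> * r * C\<^sup>2 / (pi * L) * (a ^ (2 * K + 3) * exp (W a) / x) * (L / pi * tail_rate \<alpha> r a)"
    using tail_rate_ge[OF a] a \<alpha> r L x by (intro mult_left_mono) auto
  finally show ?thesis .
qed

lemma integrated_variance_eq: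
  fixes a C x :: real
  shows "a * (C * a ^ K * exp (\<beta> * a powr s))\<^sup>2 / pi / x
    = C\<^sup>2 / (pi * L) * (a ^ (2 * K + 1) * exp (W a) / x) * (L * exp (- 2 * \<alpha> * a powr r))"
proof -
  have algebra: "a * (C * b * E)\<^sup>2 / pi / x = C\<^sup>2 / (pi * L) * (b\<^sup>2 * a * (E\<^sup>2 * F) / x) * (L * inverse F)"
    if "0 < F" for b E F :: real
    using that L by (simp add: power2_eq_square mult_ac)
  have cancel: "exp (- 2 * \<alpha> * a powr r) = inverse (exp (2 * \<alpha> * a powr r))" by (simp flip: exp_minus)
  have power: "a ^ (2 * K + 1) = (a ^ K)\<^sup>2 * a" by (simp add: power_add power_even_eq)
  show ?thesis unfolding power exp_balance cancel by (rule algebra) simp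
qed

context
  fixes h :: "nat \<Rightarrow> real"
  assumes cutoff: "filterlim (\<lambda>n. 1 / h n) at_top sequentially"
    and negligible: "negligible_variance (\<lambda>n. 1 / h n)"
begin

lemma eventually_deconvolution:
  obtains C K where
    "\<forall>\<^sub>F n in sequentially. deconvolution fe (h n) (C * (1 / h n) ^ K * exp (\<beta> * (1 / h n) powr s))"
proof -
  obtain C K where inverse: "\<And>a u. 1 \<le> a \<Longrightarrow> \<bar>u\<bar> \<le> a \<Longrightarrow> 1 / cmod (fourier fe u) \<le> C * a ^ K * exp (\<beta> * a powr s)"
    by (rule noise_inverse_le[OF noise N noise_nonzero]) blast
  have "\<forall>\<^sub>F n in sequentially. deconvolution fe (h n) (C * (1 / h n) ^ K * exp (\<beta> * (1 / h n) powr s))"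
    using eventually_compose_filterlim[OF eventually_ge_at_top[of 1] cutoff]
  proof eventually_elim
    case (elim n)
    then have "0 < 1 / h n" by linarith
    then show ?case using inverse[OF elim] noise noise_nonzero by unfold_locales auto
  qed
  then show ?thesis by (rule that)
qed

lemma tendsto_variance: "(\<lambda>n. c * ((1 / h n) ^ k * exp (W (1 / h n)) / real n)) \<longlonglongrightarrow> 0"
  using negligible by (intro tendsto_mult_right_zero) (simp add: negligible_variance_def)

lemma tendsto_tail_error: "(\<lambda>n. tail_error \<alpha> r (1 / h n)) \<longlonglongrightarrow> 0"
  by (rule filterlim_compose[OF tendsto_tail_error_at_top[OF \<alpha> r(1)] cutoff])

lemma eventually_exp_tail_le:
  "\<forall>\<^sub>F n in sequentially. 1 \<le> 1 / h n \<and> tail_error \<alpha> r (1 / h n) < 1 \<and>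
    exp_tail \<alpha> r (1 / h n) \<le> ennreal (2 * tail_rate \<alpha> r (1 / h n) / (1 - tail_error \<alpha> r (1 / h n)))"
  using order_tendstoD(2)[OF tendsto_tail_error zero_less_one]
      eventually_compose_filterlim[OF eventually_ge_at_top[of 1] cutoff]
proof eventually_elim
  case (elim n)
  then have "0 < 1 / h n" by linarith
  from exp_tail_le[OF \<alpha> r(1) this elim(1)] elim show ?case by blast
qed

lemma risk_pt_kernel_est_asymptotically_le:
  obtains u where "u \<longlonglongrightarrow> 1" "\<forall>\<^sub>F n in sequentially.
    risk_pt fe \<alpha> r L n x (\<lambda>Y z. kernel_est fe n (h n) Y z)
        \<le> ennreal (u n * (L / pi * tail_rate \<alpha> r (1 / h n)))"
proof -
  obtain C K where dec:
      "\<forall>\<^sub>F n in sequentially. deconvolution fe (h n) (C * (1 / h n) ^ K * exp (\<beta> * (1 / h n) powr s))"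
    by (rule eventually_deconvolution)
  define v where "v n = 2 * \<alpha> * r * C\<^sup>2 / (pi * L)
      * ((1 / h n) ^ (2 * K + 3) * exp (W (1 / h n)) / real n)" for n
  define w where "w n = 1 / (1 - tail_error \<alpha> r (1 / h n))" for n
  show ?thesis
  proof
    have "w \<longlonglongrightarrow> 1 / (1 - 0)" unfolding w_def[abs_def] by (intro tendsto_intros tendsto_tail_error) simp
    moreover have "v \<longlonglongrightarrow> 0" unfolding v_def[abs_def] by (rule tendsto_variance)
    ultimately show "(\<lambda>n. v n + w n) \<longlonglongrightarrow> 1" using tendsto_add[of v 0 _ w] by simp
    show "\<forall>\<^sub>F n in sequentially. risk_pt fe \<alpha> r L n x (\<lambda>Y z. kernel_est fe n (h n) Y z)
        \<le> ennreal ((v n + w n) * (L / pi * tail_rate \<alpha> r (1 / h n)))"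
      using dec eventually_exp_tail_le eventually_gt_at_top[of 0]
    proof eventually_elim
      case (elim n)
      let ?a = "1 / h n" and ?M = "C * (1 / h n) ^ K * exp (\<beta> * (1 / h n) powr s)"
      interpret deconvolution fe "h n" ?M by fact
      have pos: "0 < tail_rate \<alpha> r ?a" using bandwidth by (intro tail_rate_pos[OF \<alpha> r(1)]) simp
      have tail: "exp_tail \<alpha> r ?a < \<infinity>" using elim by (auto intro: order_le_less_trans)
      have "exp_tail \<alpha> r ?a \<le> ennreal (2 * tail_rate \<alpha> r ?a * w n)" using elim by (simp add: w_def)
      then have "ennreal (L / (2 * pi)) * exp_tail \<alpha> r ?a
          \<le> ennreal (L / (2 * pi)) * ennreal (2 * tail_rate \<alpha> r ?a * w n)"
        by (rule mult_left_mono) simp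
      also have "\<dots> = ennreal (w n * (L / pi * tail_rate \<alpha> r ?a))" using L
        by (simp add: mult_ac flip: ennreal_mult')
      finally have "ennreal (L / (2 * pi)) * exp_tail \<alpha> r ?a \<le> ennreal (w n * (L / pi * tail_rate \<alpha> r ?a))" .
      moreover have "ennreal ((?a * ?M / pi)\<^sup>2 / real n) \<le> ennreal (v n * (L / pi * tail_rate \<alpha> r ?a))"
        unfolding v_def using elim by (intro ennreal_leI pointwise_variance_le) auto
      ultimately have "risk_pt fe \<alpha> r L n x (\<lambda>Y z. kernel_est fe n (h n) Y z)
          \<le> ennreal (v n * (L / pi * tail_rate \<alpha> r ?a)) + ennreal (w n * (L / pi * tail_rate \<alpha> r ?a))"
        by (intro order_trans[OF risk_pt_kernel_est_le[OF tail elim(3)] add_mono])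
      also have "\<dots> = ennreal ((v n + w n) * (L / pi * tail_rate \<alpha> r ?a))"
        unfolding distrib_right using elim \<alpha> r L bandwidth pos
        by (intro ennreal_plus[symmetric] mult_nonneg_nonneg) (auto simp: v_def w_def)
      finally show ?case .
    qed
  qed
qed

lemma risk_L2_kernel_est_asymptotically_le:
  obtains u where "u \<longlonglongrightarrow> 1" "\<forall>\<^sub>F n in sequentially.
    risk_L2 fe \<alpha> r L n (\<lambda>Y z. kernel_est fe n (h n) Y z)
        \<le> ennreal (u n * (L * exp (- 2 * \<alpha> * (1 / h n) powr r)))"
proof -
  obtain C K where dec:
      "\<forall>\<^sub>F n in sequentially. deconvolution fe (h n) (C * (1 / h n) ^ K * exp (\<beta> * (1 / h n) powr s))"
    by (rule eventually_deconvolution)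
  define v where "v n = C\<^sup>2 / (pi * L) * ((1 / h n) ^ (2 * K + 1) * exp (W (1 / h n)) / real n)" for n
  show ?thesis
  proof
    have "v \<longlonglongrightarrow> 0" unfolding v_def[abs_def] by (rule tendsto_variance)
    then show "(\<lambda>n. v n + 1) \<longlonglongrightarrow> 1" using tendsto_add[OF _ tendsto_const, of v 0 _ 1] by simp
    show "\<forall>\<^sub>F n in sequentially. risk_L2 fe \<alpha> r L n (\<lambda>Y z. kernel_est fe n (h n) Y z)
        \<le> ennreal ((v n + 1) * (L * exp (- 2 * \<alpha> * (1 / h n) powr r)))"
      using dec eventually_exp_tail_le eventually_gt_at_top[of 0]
    proof eventually_elim
      case (elim n)
      let ?a = "1 / h n" and ?M = "C * (1 / h n) ^ K * exp (\<beta> * (1 / h n) powr s)"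
      interpret deconvolution fe "h n" ?M by fact
      have tail: "exp_tail \<alpha> r ?a < \<infinity>" using elim by (auto intro: order_le_less_trans)
      have "0 \<le> v n" using L bandwidth by (simp add: v_def)
      then have "ennreal (?a * ?M\<^sup>2 / pi / real n) + ennreal (L * exp (- 2 * \<alpha> * ?a powr r))
          = ennreal ((v n + 1) * (L * exp (- 2 * \<alpha> * ?a powr r)))"
        unfolding integrated_variance_eq v_def[symmetric] distrib_right mult_1 using L
        by (intro ennreal_plus[symmetric]) auto
      with risk_L2_kernel_est_le[OF tail less_imp_le[OF \<alpha>] less_imp_le[OF r(1)] elim(3), of L] show ?case
        by simp
    qed
  qed
qed

lemma eventually_kernel_est_in_estimators:
  "\<forall>\<^sub>F n in sequentially. (\<lambda>Y z. kernel_est fe n (h n) Y z) \<in> estimators n"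
proof -
  obtain C K where "\<forall>\<^sub>F n in sequentially. deconvolution fe (h n)
      (C * (1 / h n) ^ K * exp (\<beta> * (1 / h n) powr s))"
    by (rule eventually_deconvolution)
  then show ?thesis by eventually_elim (rule deconvolution.kernel_est_in_estimators)
qed

end

subsection \<open>Convergence of the normalized risks\<close>

lemma rate_pt_eq: "0 < a_star n \<Longrightarrow> rate_pt \<alpha> \<beta> r s L n = L / pi * tail_rate \<alpha> r (a_star n)"
  by (simp add: rate_pt_def tail_rate_def powr_divide powr_diff field_simps)

lemma rate_L2_eq: "0 < a_star n \<Longrightarrow> rate_L2 \<alpha> \<beta> r s L n = L * exp (- 2 * \<alpha> * a_star n powr r)"
  by (simp add: rate_L2_def powr_divide)

lemma eventually_rate_pos:
  "\<forall>\<^sub>F n in sequentially. 0 < rate_pt \<alpha> \<beta> r s L n"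
  "\<forall>\<^sub>F n in sequentially. 0 < rate_L2 \<alpha> \<beta> r s L n"
  using eventually_a_star_pos
  by (eventually_elim, use L tail_rate_pos[OF \<alpha> r(1)] in \<open>simp add: rate_pt_eq rate_L2_eq\<close>)+

context
  fixes a :: "nat \<Rightarrow> real"
  assumes a: "equivalent_cutoff a"
begin

lemma rate_pt_ratio_tendsto: "(\<lambda>n. (L / pi * tail_rate \<alpha> r (a n)) / rate_pt \<alpha> \<beta> r s L n) \<longlonglongrightarrow> 1"
proof -
  have "(\<lambda>n. tail_rate \<alpha> r (a n) / tail_rate \<alpha> r (a_star n)) \<longlonglongrightarrow> 1"
    using a by (intro tendsto_tail_rate_ratio \<alpha> r filterlim_a_star) (auto simp: equivalent_cutoff_def)
  moreover have "\<forall>\<^sub>F n in sequentially. tail_rate \<alpha> r (a n) / tail_rate \<alpha> r (a_star n)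
      = (L / pi * tail_rate \<alpha> r (a n)) / rate_pt \<alpha> \<beta> r s L n"
    using eventually_a_star_pos by eventually_elim (use L in \<open>simp add: rate_pt_eq\<close>)
  ultimately show ?thesis by (rule Lim_transform_eventually)
qed

lemma rate_L2_ratio_tendsto: "(\<lambda>n. (L * exp (- 2 * \<alpha> * a n powr r)) / rate_L2 \<alpha> \<beta> r s L n) \<longlonglongrightarrow> 1"
proof -
  have "(\<lambda>n. exp (2 * \<alpha> * (a_star n powr r - a n powr r))) \<longlonglongrightarrow> exp (2 * \<alpha> * 0)"
    using a by (intro tendsto_intros) (auto simp: equivalent_cutoff_def)
  moreover have "\<forall>\<^sub>F n in sequentially. exp (2 * \<alpha> * (a_star n powr r - a n powr r))
      = (L * exp (- 2 * \<alpha> * a n powr r)) / rate_L2 \<alpha> \<beta> r s L n"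
    using eventually_a_star_pos
    by eventually_elim (use L in \<open>simp add: rate_L2_eq right_diff_distrib exp_minus exp_diff field_simps\<close>)
  ultimately show ?thesis using Lim_transform_eventually by force
qed

end

lemma limsup_risk_kernel_est_le_one:
  assumes h: "equivalent_cutoff (\<lambda>n. 1 / h n)" "negligible_variance (\<lambda>n. 1 / h n)"
  shows "limsup (\<lambda>n. risk_pt fe \<alpha> r L n x (\<lambda>Y z. kernel_est fe n (h n) Y z)
      * ennreal (1 / rate_pt \<alpha> \<beta> r s L n)) \<le> 1"
    and "limsup (\<lambda>n. risk_L2 fe \<alpha> r L n (\<lambda>Y z. kernel_est fe n (h n) Y z)
        * ennreal (1 / rate_L2 \<alpha> \<beta> r s L n)) \<le> 1"
proof -
  note cutoff = filterlim_equivalent_cutoff[OF h(1)] h(2)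
  obtain u where u: "u \<longlonglongrightarrow> 1" "\<forall>\<^sub>F n in sequentially.
      risk_pt fe \<alpha> r L n x (\<lambda>Y z. kernel_est fe n (h n) Y z)
          \<le> ennreal (u n * (L / pi * tail_rate \<alpha> r (1 / h n)))"
    by (rule risk_pt_kernel_est_asymptotically_le[OF cutoff])
  show "limsup (\<lambda>n. risk_pt fe \<alpha> r L n x (\<lambda>Y z. kernel_est fe n (h n) Y z)
      * ennreal (1 / rate_pt \<alpha> \<beta> r s L n)) \<le> 1"
    by (rule limsup_normalized_le_one[OF u(2) eventually_rate_pos(1) u(1) rate_pt_ratio_tendsto[OF h(1)]])
  obtain u where u: "u \<longlonglongrightarrow> 1" "\<forall>\<^sub>F n in sequentially.
      risk_L2 fe \<alpha> r L n (\<lambda>Y z. kernel_est fe n (h n) Y z)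
          \<le> ennreal (u n * (L * exp (- 2 * \<alpha> * (1 / h n) powr r)))"
    by (rule risk_L2_kernel_est_asymptotically_le[OF cutoff])
  show "limsup (\<lambda>n. risk_L2 fe \<alpha> r L n (\<lambda>Y z. kernel_est fe n (h n) Y z)
      * ennreal (1 / rate_L2 \<alpha> \<beta> r s L n)) \<le> 1"
    by (rule limsup_normalized_le_one[OF u(2) eventually_rate_pos(2) u(1) rate_L2_ratio_tendsto[OF h(1)]])
qed

lemma minimax_risk_asymptotically_ge:
  assumes \<delta>: "0 < \<delta>" "\<delta> < 1"
  obtains u where "u \<longlonglongrightarrow> \<delta>" 
    "\<forall>\<^sub>F n in sequentially. ennreal (u n * (L / pi * tail_rate \<alpha> r (lower_cutoff n)))
        \<le> (INF T\<in>estimators n. risk_pt fe \<alpha> r L n x T)"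
    "\<forall>\<^sub>F n in sequentially. ennreal (u n * (L * exp (- 2 * \<alpha> * lower_cutoff n powr r)))
        \<le> (INF T\<in>estimators n. risk_L2 fe \<alpha> r L n T)"
proof -
  obtain C K where C: "0 \<le> C" and bound: "\<forall>\<^sub>F a in at_top. \<forall>n x. \<forall>T\<in>estimators n.
       ennreal (\<delta> * (L / pi * tail_rate \<alpha> r a) * affinity_bound (C * (a ^ K * exp (- W a))) n)
           \<le> risk_pt fe \<alpha> r L n x T
     \<and> ennreal (\<delta> * (L * exp (- 2 * \<alpha> * a powr r)) * affinity_bound (C * (a ^ K * exp (- W a))) n)
         \<le> risk_L2 fe \<alpha> r L n T"
    by (rule minimax_lower_bound[OF \<alpha> r(1) r_less_2 L noise N ND less_imp_le[OF \<delta>(1)] \<delta>(2)])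
  let ?\<kappa> = "\<lambda>n. C * (lower_cutoff n ^ K * exp (- W (lower_cutoff n)))"
  show ?thesis
  proof
    have "(\<lambda>n. affinity_bound (?\<kappa> n) n) \<longlonglongrightarrow> 1"
    proof (rule tendsto_affinity_bound)
      show "\<forall>\<^sub>F n in sequentially. 0 \<le> ?\<kappa> n"
        using eventually_a_star_pos by eventually_elim (use C lower_cutoff_powr(1) in \<open>simp add: less_imp_le\<close>)
      have "(\<lambda>n. real n * (lower_cutoff n ^ K * exp (- W (lower_cutoff n)))) \<longlonglongrightarrow> 0"
        using undetectable_lower_cutoff unfolding undetectable_def by blast
      from tendsto_mult_right_zero[OF this, of C] show "(\<lambda>n. real n * ?\<kappa> n) \<longlonglongrightarrow> 0"
        by (simp add: mult.left_commute)
    qed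
    from tendsto_mult_left[OF this, of \<delta>] show "(\<lambda>n. \<delta> * affinity_bound (?\<kappa> n) n) \<longlonglongrightarrow> \<delta>" by simp
    note eventually_bound =
        eventually_compose_filterlim[OF bound filterlim_equivalent_cutoff[OF equivalent_lower_cutoff]]
    show "\<forall>\<^sub>F n in sequentially. ennreal (\<delta> * affinity_bound (?\<kappa> n) n
        * (L / pi * tail_rate \<alpha> r (lower_cutoff n)))
        \<le> (INF T\<in>estimators n. risk_pt fe \<alpha> r L n x T)"
      using eventually_bound unfolding mult.assoc[of \<delta>] mult.commute[of "affinity_bound _ _"]
      by eventually_elim (auto intro!: INF_greatest)
    show "\<forall>\<^sub>F n in sequentially. ennreal (\<delta> * affinity_bound (?\<kappa> n) n
        * (L * exp (- 2 * \<alpha> * lower_cutoff n powr r)))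
        \<le> (INF T\<in>estimators n. risk_L2 fe \<alpha> r L n T)"
      using eventually_bound unfolding mult.assoc[of \<delta>] mult.commute[of "affinity_bound _ _"]
      by eventually_elim (auto intro!: INF_greatest)
  qed
qed

lemma liminf_minimax_risk_ge_one:
  "1 \<le> liminf (\<lambda>n. (INF T\<in>estimators n. risk_pt fe \<alpha> r L n x T) * ennreal (1 / rate_pt \<alpha> \<beta> r s L n))"
  "1 \<le> liminf (\<lambda>n. (INF T\<in>estimators n. risk_L2 fe \<alpha> r L n T) * ennreal (1 / rate_L2 \<alpha> \<beta> r s L n))"
proof -
  show "1 \<le> liminf (\<lambda>n. (INF T\<in>estimators n. risk_pt fe \<alpha> r L n x T) * ennreal (1 / rate_pt \<alpha> \<beta> r s L n))"
    by (rule liminf_normalized_ge_one[OF _ eventually_rate_pos(1)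
        rate_pt_ratio_tendsto[OF equivalent_lower_cutoff]],
      rule minimax_risk_asymptotically_ge[of _ x]) blast+
  show "1 \<le> liminf (\<lambda>n. (INF T\<in>estimators n. risk_L2 fe \<alpha> r L n T) * ennreal (1 / rate_L2 \<alpha> \<beta> r s L n))"
    by (rule liminf_normalized_ge_one[OF _ eventually_rate_pos(2)
        rate_L2_ratio_tendsto[OF equivalent_lower_cutoff]],
      rule minimax_risk_asymptotically_ge) blast+
qed

end

theorem theorem5:
  fixes \<alpha> L r s \<beta> x :: real and fe :: "real \<Rightarrow> real" and h :: "nat \<Rightarrow> real"
  assumes "0 < \<alpha>" and "0 < L" and "0 < r" and "r < s" and "s \<le> 2"
    and "prob_density fe"
    and "assumption_N \<beta> s (fourier fe)"
    and "assumption_ND \<beta> s (fourier fe)"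
    and "\<forall>u. fourier fe u \<noteq> 0"
    and "h = h_star \<alpha> \<beta> r s \<or> (r < s / 2 \<and> h = h_a \<beta> s)"
  shows "((\<lambda>n. risk_pt fe \<alpha> r L n x (\<lambda>Y z. kernel_est fe n (h n) Y z)
              * ennreal (1 / rate_pt \<alpha> \<beta> r s L n)) \<longlongrightarrow> 1) sequentially
       \<and> ((\<lambda>n. (INF T \<in> estimators n. risk_pt fe \<alpha> r L n x T)
              * ennreal (1 / rate_pt \<alpha> \<beta> r s L n)) \<longlongrightarrow> 1) sequentially
       \<and> ((\<lambda>n. risk_L2 fe \<alpha> r L n (\<lambda>Y z. kernel_est fe n (h n) Y z)
              * ennreal (1 / rate_L2 \<alpha> \<beta> r s L n)) \<longlongrightarrow> 1) sequentially
       \<and> ((\<lambda>n. (INF T \<in> estimators n. risk_L2 fe \<alpha> r L n T)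
              * ennreal (1 / rate_L2 \<alpha> \<beta> r s L n)) \<longlongrightarrow> 1) sequentially"
proof -
  interpret deconvolution_problem \<alpha> \<beta> r s fe L
    using assms by unfold_locales (auto simp: assumption_N_def)
  have h: "equivalent_cutoff (\<lambda>n. 1 / h n)" "negligible_variance (\<lambda>n. 1 / h n)"
    using assms(10) equivalent_cutoff_a_star equivalent_cutoff_h_a negligible_variance_a_star
        negligible_variance_h_a by auto
  note estimator = eventually_kernel_est_in_estimators[OF filterlim_equivalent_cutoff[OF h(1)] h(2)]
  have "\<forall>\<^sub>F n in sequentially. (INF T\<in>estimators n. risk_pt fe \<alpha> r L n x T)
      * ennreal (1 / rate_pt \<alpha> \<beta> r s L n)
      \<le> risk_pt fe \<alpha> r L n x (\<lambda>Y z. kernel_est fe n (h n) Y z) * ennreal (1 / rate_pt \<alpha> \<beta> r s L n)"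
    using estimator by eventually_elim (intro mult_right_mono INF_lower; simp)
  note pt = tendsto_one_between[OF liminf_minimax_risk_ge_one(1) this limsup_risk_kernel_est_le_one(1)[OF h]]
  have "\<forall>\<^sub>F n in sequentially. (INF T\<in>estimators n. risk_L2 fe \<alpha> r L n T) * ennreal (1 / rate_L2 \<alpha> \<beta> r s L n)
      \<le> risk_L2 fe \<alpha> r L n (\<lambda>Y z. kernel_est fe n (h n) Y z) * ennreal (1 / rate_L2 \<alpha> \<beta> r s L n)"
    using estimator by eventually_elim (intro mult_right_mono INF_lower; simp)
  note L2 = tendsto_one_between[OF liminf_minimax_risk_ge_one(2) this limsup_risk_kernel_est_le_one(2)[OF h]]
  show ?thesis using pt L2 by blast
qed

end
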